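(* Let $n,d,r,s$ be positive integers with $r\le s\le \dim_{\mathbb C} S_d$. For a set $\underline Q=\{Q_1,\dots,Q_s\}$ of $s$ points of $\mathbb P S_1$ and a matrix $A=(\alpha_{ij})\in \mathrm{Mat}(s,r;\mathbb C)$, let $$\eta=\eta_{A,\underline Q}:\ \mathrm{Mat}(1,r;(I_{\underline Q})_d)\longrightarrow \bigoplus_{i=1}^s R_d/(I_{Q_i}^{(2)})_d,\qquad [u_1,\dots,u_r]\longmapsto \Big[\sum_{j=1}^r\alpha_{ij}u_j+(I_{Q_i}^{(2)})_d\Big]_{1\le i\le s}.$$ If the points $\underline Q$ and the matrix $A$ are general, then $$\operatorname{codim}(\Sigma,\,G(r,S_d))=\dim_{\mathbb C}\ker(\eta).$$
   Context: $V$ is a $\mathbb C$-vector space of dimension $n+1$, $S=\bigoplus_{d\ge0}\mathrm{Sym}^d V$ and $R=\bigoplus_{d\ge 0}\mathrm{Sym}^d V^*$, so that $\mathbb P S_1=\mathrm{Proj}\,R\cong\mathbb P^n$ (points of $\mathbb P S_1$ are nonzero linear forms $Q\in S_1=V$ up to scalar, and $R$ is the homogeneous coordinate ring of $\mathbb P S_1$). For a closed subscheme $X\subseteq \mathbb P S_1$, $I_X\subseteq R$ is its homogeneous ideal and $I_X^{(2)}$ its second symbolic power; thus $(I_{\underline Q})_d$ is the space of degree $d$ forms in $R$ vanishing at all $Q_i$, and $(I_{Q_i}^{(2)})_d$ the space of degree $d$ forms vanishing to order at least $2$ at $Q_i$. $\mathrm{Mat}(a,b;W)$ is the space of $a\times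 b$ matrices with entries in $W$. $G(r,S_d)$ is the Grassmannian of $r$-dimensional subspaces of $S_d$. $U_s\subseteq \mathrm{Sym}^s(\mathbb P S_1)$ is the open set of unordered $s$-tuples $\{Q_1,\dots,Q_s\}$ for which $Q_1^d,\dots,Q_s^d$ are linearly independent over $\mathbb C$. $\Sigma\subseteq G(r,S_d)$ is the (constructible) set of all $\Lambda\in G(r,S_d)$ such that $\Lambda\subseteq \mathrm{span}(Q_1^d,\dots,Q_s^d)$ for some $\{Q_1,\dots,Q_s\}\in U_s$. "General" means: for all $(\underline Q,A)$ in some nonempty Zariski open subset of the parameter space. *)

theory Defs
  imports "HOL-Analysis.Analysis" "HOL-Library.Poly_Mapping" "HOL-Library.Extended_Nat"
begin

section \<open>Polynomials over the complex numbers\<close>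

text \<open>
  Polynomials in variables indexed by \<open>'i\<close>, as the monoid algebra of the monomials
  \<open>'i \<Rightarrow>\<^sub>0 nat\<close>. For a finite type \<open>'v\<close> with \<open>n + 1\<close> elements, \<open>'v mpoly\<close> serves both as
  \<open>S = Sym V\<close>, in a basis \<open>(x\<^sub>v)\<close> of \<open>V\<close>, and as \<open>R = Sym V\<^sup>*\<close>, in the dual basis.
\<close>

type_synonym 'i mpoly = "('i \<Rightarrow>\<^sub>0 nat) \<Rightarrow>\<^sub>0 complex"

definition pscale :: "complex \<Rightarrow> 'i mpoly \<Rightarrow> 'i mpoly" where
  "pscale c p = Poly_Mapping.map ((*) c) p"

definition peval :: "'i mpoly \<Rightarrow> ('i \<Rightarrow> complex) \<Rightarrow> complex" where
  "peval p x = (\<Sum>m\<in>Poly_Mapping.keys p. Poly_Mapping.lookup p m * (\<Prod>v\<in>Poly_Mapping.keys m. x v ^ Poly_Mapping.lookup m v))"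

lemma lookup_pscale [simp]: "Poly_Mapping.lookup (pscale c p) m = c * Poly_Mapping.lookup p m"
  by (simp add: pscale_def Poly_Mapping.map.rep_eq when_def)

interpretation mp: vector_space "pscale :: complex \<Rightarrow> 'i mpoly \<Rightarrow> 'i mpoly"
  by unfold_locales
    (auto intro!: poly_mapping_eqI simp: lookup_add algebra_simps)

definition row_scale :: "complex \<Rightarrow> ('i mpoly)^'r \<Rightarrow> ('i mpoly)^'r" where
  "row_scale c u = (\<chi> j. pscale c (u $ j))"

interpretation row: vector_space "row_scale :: complex \<Rightarrow> ('i mpoly)^'r \<Rightarrow> ('i mpoly)^'r"
  by unfold_locales
    (auto simp: row_scale_def vec_eq_iff mp.scale_right_distrib mp.scale_left_distrib)

definition forms :: "nat \<Rightarrow> 'v::finite mpoly set" where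
  "forms d = {p. \<forall>m\<in>Poly_Mapping.keys p. (\<Sum>v\<in>UNIV. Poly_Mapping.lookup m v) = d}"

text \<open>Value of \<open>f \<in> R\<close> at the vector \<open>q \<in> S\<^sub>1 = V\<close>.\<close>

definition eval_at :: "'v::finite mpoly \<Rightarrow> 'v mpoly \<Rightarrow> complex" where
  "eval_at f q = peval f (\<lambda>v. Poly_Mapping.lookup q (Poly_Mapping.single v 1))"


section \<open>Points and their ideals\<close>

text \<open>A point of \<open>\<P>S\<^sub>1\<close> is the line in \<open>S\<^sub>1\<close> spanned by a nonzero linear form.\<close>

definition line :: "'v::finite mpoly \<Rightarrow> 'v mpoly set" where
  "line q = mp.span {q}"

definition points :: "'v::finite mpoly set set" where
  "points = line ` (forms 1 - {0})"

definition ideal_gen :: "'a::comm_ring_1 set \<Rightarrow> 'a set" where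
  "ideal_gen B = module.span (*) B"

definition ideal_prod :: "'a::comm_ring_1 set \<Rightarrow> 'a set \<Rightarrow> 'a set" where
  "ideal_prod I J = ideal_gen {a * b | a b. a \<in> I \<and> b \<in> J}"

text \<open>The second symbolic power \<open>I\<^sup>2R\<^sub>I \<inter> R\<close> of a prime ideal \<open>I\<close>. It is only used for the
  ideal of a single point, which is prime.\<close>

definition symbolic_square :: "'a::comm_ring_1 set \<Rightarrow> 'a set" where
  "symbolic_square I = {f. \<exists>g. g \<notin> I \<and> g * f \<in> ideal_prod I I}"

definition vanishing_ideal :: "'v::finite mpoly set set \<Rightarrow> 'v mpoly set" where
  "vanishing_ideal X = ideal_gen {f. (\<exists>k. f \<in> forms k) \<and> (\<forall>P\<in>X. \<forall>q\<in>P. eval_at f q = 0)}"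


section \<open>Zariski topologies\<close>

text \<open>The Zariski topology on \<open>X\<close> induced by the coordinate functions \<open>c\<close>; it is generated by
  the principal open sets.\<close>

definition zariski :: "'a set \<Rightarrow> ('a \<Rightarrow> 'i \<Rightarrow> complex) \<Rightarrow> 'a topology" where
  "zariski X c = topology_generated_by (range (\<lambda>f. {x \<in> X. peval f (c x) \<noteq> 0}))"

definition quotient_topology :: "'a topology \<Rightarrow> ('a \<Rightarrow> 'b) \<Rightarrow> 'b topology" where
  "quotient_topology X f =
     topology (\<lambda>U. U \<subseteq> f ` topspace X \<and> openin X {x \<in> topspace X. f x \<in> U})"

lemma openin_quotient_topology:
  "openin (quotient_topology X f) U \<longleftrightarrow>
     U \<subseteq> f ` topspace X \<and> openin X {x \<in> topspace X. f x \<in> U}"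
proof -
  have "istopology (\<lambda>U. U \<subseteq> f ` topspace X \<and> openin X {x \<in> topspace X. f x \<in> U})"
    unfolding istopology_def
  proof (intro conjI allI impI)
    fix S T
    assume "S \<subseteq> f ` topspace X \<and> openin X {x \<in> topspace X. f x \<in> S}"
      and "T \<subseteq> f ` topspace X \<and> openin X {x \<in> topspace X. f x \<in> T}"
    moreover have "{x \<in> topspace X. f x \<in> S \<inter> T} =
        {x \<in> topspace X. f x \<in> S} \<inter> {x \<in> topspace X. f x \<in> T}" by auto
    ultimately show "S \<inter> T \<subseteq> f ` topspace X" "openin X {x \<in> topspace X. f x \<in> S \<inter> T}"
      by auto
  next
    fix K
    assume K: "\<forall>S\<in>K. S \<subseteq> f ` topspace X \<and> openin X {x \<in> topspace X. f x \<in> S}"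
    then show "\<Union>K \<subseteq> f ` topspace X" by blast
    have "{x \<in> topspace X. f x \<in> \<Union>K} = (\<Union>S\<in>K. {x \<in> topspace X. f x \<in> S})" by auto
    with K show "openin X {x \<in> topspace X. f x \<in> \<Union>K}" by auto
  qed
  then show ?thesis by (simp add: quotient_topology_def)
qed

lemma topspace_quotient_topology [simp]: "topspace (quotient_topology X f) = f ` topspace X"
proof
  show "topspace (quotient_topology X f) \<subseteq> f ` topspace X"
    by (auto simp: topspace_def openin_quotient_topology)
  have "{x \<in> topspace X. f x \<in> f ` topspace X} = topspace X" by auto
  then have "openin (quotient_topology X f) (f ` topspace X)"
    by (simp add: openin_quotient_topology)
  then show "f ` topspace X \<subseteq> topspace (quotient_topology X f)" by (rule openin_subset)
qed

lemma quotient_map_quotient_topology: "quotient_map X (quotient_topology X f) f"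
  by (auto simp: quotient_map_def openin_quotient_topology)

lemma topspace_zariski [simp]: "topspace (zariski X c) = X"
proof -
  have "X = {x \<in> X. peval 1 (c x) \<noteq> 0}" by (simp add: peval_def)
  then show ?thesis by (auto simp: zariski_def topology_generated_by_topspace)
qed


section \<open>Codimension\<close>

definition irreducible_closed :: "'a topology \<Rightarrow> 'a set \<Rightarrow> bool" where
  "irreducible_closed X Z \<longleftrightarrow> closedin X Z \<and> Z \<noteq> {} \<and>
     (\<forall>C D. closedin X C \<and> closedin X D \<and> Z \<subseteq> C \<union> D \<longrightarrow> Z \<subseteq> C \<or> Z \<subseteq> D)"

text \<open>The supremum of the lengths of chains \<open>Z = F\<^sub>0 \<subset> \<dots> \<subset> F\<^sub>k\<close> of irreducible closed sets.\<close>

definition codim_irreducible :: "'a topology \<Rightarrow> 'a set \<Rightarrow> enat" where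
  "codim_irreducible X Z =
     (SUP k \<in> {k. \<exists>F. F 0 = Z \<and> (\<forall>i\<le>k. irreducible_closed X (F i)) \<and> (\<forall>i<k. F i \<subset> F (Suc i))}.
        enat k)"

definition codim :: "'a set \<Rightarrow> 'a topology \<Rightarrow> enat" where
  "codim Y X =
     (INF Z \<in> {Z. irreducible_closed X Z \<and> Z \<subseteq> X closure_of Y}. codim_irreducible X Z)"


section \<open>The Grassmannian and the locus \<open>\<Sigma>\<close>\<close>

definition grassmannian :: "nat \<Rightarrow> nat \<Rightarrow> 'v::finite mpoly set set" where
  "grassmannian r d = {\<Lambda>. mp.subspace \<Lambda> \<and> \<Lambda> \<subseteq> forms d \<and> mp.dim \<Lambda> = r}"

text \<open>Ordered bases of the \<open>CARD('r)\<close>-dimensional subspaces of \<open>S\<^sub>d\<close>.\<close>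

definition frames :: "nat \<Rightarrow> (('v::finite mpoly)^'r) set" where
  "frames d = {B. (\<forall>j. B $ j \<in> forms d) \<and> inj (($) B) \<and> mp.independent (range (($) B))}"

text \<open>The Zariski topology on the Grassmannian, as the quotient of the open set of frames in the
  affine space \<open>S\<^sub>d\<^sup>r\<close> by the general linear group. The coordinates of a frame are the coefficients
  of its members.\<close>

definition grassmannian_topology :: "'r::finite itself \<Rightarrow> nat \<Rightarrow> 'v::finite mpoly set topology" where
  "grassmannian_topology _ d =
     quotient_topology
       (zariski (frames d :: (('v mpoly)^'r) set) (\<lambda>B (j, m). Poly_Mapping.lookup (B $ j) m))
       (\<lambda>B. mp.span (range (($) B)))"

lemma topspace_grassmannian_topology:
  "topspace (grassmannian_topology TYPE('r::finite) d) =
     (grassmannian CARD('r) d :: 'v::finite mpoly set set)"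
proof (intro set_eqI iffI)
  have sub: "mp.subspace (forms d :: 'v mpoly set)"
  proof (rule mp.subspaceI)
    fix p q :: "'v mpoly"
    assume "p \<in> forms d" "q \<in> forms d"
    then show "p + q \<in> forms d" using Poly_Mapping.keys_add[of p q] by (auto simp: forms_def)
  qed (auto simp: forms_def in_keys_iff)
  fix L :: "'v mpoly set"
  {
    assume "L \<in> topspace (grassmannian_topology TYPE('r) d)"
    then obtain B :: "('v mpoly)^'r" where B: "B \<in> frames d" "L = mp.span (range (($) B))"
      by (auto simp: grassmannian_topology_def)
    moreover have "mp.span (range (($) B)) \<subseteq> forms d"
      using B sub by (intro mp.span_minimal) (auto simp: frames_def)
    ultimately show "L \<in> grassmannian CARD('r) d"
      by (auto simp: grassmannian_def frames_def mp.dim_eq_card_independent card_image)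
  next
    assume L: "L \<in> grassmannian CARD('r) d"
    obtain C where C: "C \<subseteq> L" "mp.independent C" "L \<subseteq> mp.span C" "card C = mp.dim L"
      using mp.basis_exists by blast
    then have "card C = CARD('r)" using L by (simp add: grassmannian_def)
    moreover from this have "finite C" by (metis card_ge_0_finite zero_less_card_finite)
    ultimately obtain b :: "'r \<Rightarrow> 'v mpoly" where b: "bij_betw b UNIV C"
      using finite_same_card_bij[of "UNIV :: 'r set" C] by auto
    define B where "B = (\<chi> j. b j)"
    have "range (($) B) = C" "inj (($) B)"
      using b by (auto simp: B_def bij_betw_def inj_on_def)
    moreover from this have "B \<in> frames d" using C L
      by (auto simp: frames_def grassmannian_def)
    moreover have "mp.span C \<subseteq> L"
      using C L by (intro mp.span_minimal) (auto simp: grassmannian_def)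
    then have "mp.span C = L" using C by blast
    ultimately show "L \<in> topspace (grassmannian_topology TYPE('r) d)"
      by (auto simp: grassmannian_topology_def intro!: image_eqI[of _ _ B])
  }
qed

text \<open>\<open>U\<^sub>s\<close>: linear independence of the powers forces the points to be distinct, so an
  unordered tuple in \<open>U\<^sub>s\<close> is a set of \<open>s\<close> points. The condition does not depend on the chosen
  representatives \<open>q\<close> of the points.\<close>

definition independent_tuples :: "nat \<Rightarrow> nat \<Rightarrow> 'v::finite mpoly set set set" where
  "independent_tuples s d = {X. X \<subseteq> points \<and> finite X \<and> card X = s \<and>
     (\<forall>q. (\<forall>P\<in>X. q P \<in> P - {0}) \<longrightarrow>
        inj_on (\<lambda>P. q P ^ d) X \<and> mp.independent ((\<lambda>P. q P ^ d) ` X))}"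

definition Sigma_locus :: "nat \<Rightarrow> nat \<Rightarrow> nat \<Rightarrow> 'v::finite mpoly set set" where
  "Sigma_locus r s d = {\<Lambda> \<in> grassmannian r d.
     \<exists>X\<in>independent_tuples s d. \<Lambda> \<subseteq> mp.span {q ^ d | q P. P \<in> X \<and> q \<in> P - {0}}}"


section \<open>The map \<open>\<eta>\<close> and its parameters\<close>

text \<open>\<open>\<eta>\<close> takes values in a product of quotient spaces, whose elements are cosets.\<close>

definition eta ::
  "nat \<Rightarrow> complex^'r^'s \<Rightarrow> ('s \<Rightarrow> 'v::finite mpoly set) \<Rightarrow> ('v mpoly)^'r \<Rightarrow> 's \<Rightarrow> 'v mpoly set" where
  "eta d A Q u = (\<lambda>i. (+) (\<Sum>j\<in>UNIV. pscale (A $ i $ j) (u $ j)) `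
                        (symbolic_square (vanishing_ideal {Q i}) \<inter> forms d))"

definition ker_eta ::
  "nat \<Rightarrow> complex^'r^'s \<Rightarrow> ('s \<Rightarrow> 'v::finite mpoly set) \<Rightarrow> (('v mpoly)^'r) set" where
  "ker_eta d A Q = {u. (\<forall>j. u $ j \<in> vanishing_ideal (range Q) \<inter> forms d) \<and>
     eta d A Q u = (\<lambda>i. symbolic_square (vanishing_ideal {Q i}) \<inter> forms d)}"

text \<open>Pairs of a tuple of distinct points of \<open>\<P>S\<^sub>1\<close> and a matrix, as the quotient of an open set in
  affine space by rescaling the representatives of the points. The points are ordered, as they
  label the rows of the matrix.\<close>

definition parameter_topology ::
  "(('s::finite \<Rightarrow> 'v::finite mpoly set) \<times> (complex^'r^'s)) topology" where
  "parameter_topology =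
     quotient_topology
       (zariski {(q, A). (\<forall>i. q i \<in> forms 1 - {0}) \<and> inj (\<lambda>i. line (q i))}
          (\<lambda>(q, A). case_sum (\<lambda>(i, v). Poly_Mapping.lookup (q i) (Poly_Mapping.single v 1))
                             (\<lambda>(i, j). A $ i $ j)))
       (\<lambda>(q, A). (\<lambda>i. line (q i), A))"

lemma topspace_parameter_topology:
  "topspace parameter_topology = {Q. (\<forall>i. Q i \<in> points) \<and> inj Q} \<times> UNIV"
proof (intro set_eqI iffI)
  fix x :: "('s::finite \<Rightarrow> 'v::finite mpoly set) \<times> (complex^'r^'s)"
  {
    assume "x \<in> topspace parameter_topology"
    then show "x \<in> {Q. (\<forall>i. Q i \<in> points) \<and> inj Q} \<times> UNIV"
      by (auto simp: parameter_topology_def points_def)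
  next
    assume x: "x \<in> {Q. (\<forall>i. Q i \<in> points) \<and> inj Q} \<times> UNIV"
    then obtain Q A where Q: "x = (Q, A)" "\<And>i. Q i \<in> points" "inj Q" by blast
    then have "\<forall>i. \<exists>q. q \<in> forms 1 - {0} \<and> Q i = line q" by (auto simp: points_def)
    then obtain q where q: "\<And>i. q i \<in> forms 1 - {0}" "\<And>i. Q i = line (q i)" by metis
    then have "Q = (\<lambda>i. line (q i))" by blast
    with Q q show "x \<in> topspace parameter_topology"
      by (auto simp: parameter_topology_def intro!: image_eqI[of _ _ "(q, A)"])
  }
qed

end

theory Submission
  imports Defs
begin

text \<open>
  Let \<open>\<Phi>\<close> send \<open>(q, A)\<close> to the tuple of the forms \<open>\<Sum>i. A\<^sub>i\<^sub>j q\<^sub>i\<^sup>d\<close>. Modulo the linear group,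
  the image of \<open>\<Phi>\<close> is dense in \<open>\<Sigma>\<close>, and by apolarity \<open>ker \<eta>\<close> is the annihilator of the image of the
  differential of \<open>\<Phi>\<close>. So the claim is that the codimension of the closure of the image is the
  generic corank of the Jacobian matrix.

  Codimension, defined through chains of irreducible closed sets, is related to this rank by
  algebraic independence. For the upper bound, independent gradients give algebraically independent
  coordinates on the closure, each step of a chain adds a further independent function, and \<open>m\<close>
  coordinates admit at most \<open>m\<close> algebraically independent polynomials. For the lower bound, a stable
  parametrized locus that is not everything is enlarged by a one-parameter family of maps
  \<open>f \<mapsto> f + t u(f) a\<close> of the space of forms, which raises the rank by at most one, until it is dense
  and the rank is full.
\<close>

section \<open>Linear algebra of finite families\<close>

text \<open>The quotient by the linear group is never given coordinates of its own. Loci in the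
  Grassmannian are studied through their preimages among frames, inside the affine space of all
  tuples of forms; the fibres contribute to the locus and to the whole space alike, so the dimension
  of the group never enters. The price is that irreducibility has to pass from closed sets of
  subspaces to their preimages. Transvections are suitable enlargements for three reasons: they
  commute with the matrices acting on tuples, so the enlarged locus is again stable; a closed locus
  stable under all of them that contains an independent tuple is everything; and the new parameter
  is attached to a map that is the identity at \<open>t = 0\<close>, so the old locus stays inside
  the new one. Apolarity comes with weights: the coefficients of a \<open>d\<close>-th power are
  multinomial coefficients times monomials, and dividing by them turns the relations among the
  gradients into the conditions that define the kernel. Independence is stated for indexed families,
  because gradients at a special point may coincide.\<close>

definition lin_indep :: "'k set \<Rightarrow> ('c \<Rightarrow> 'k \<Rightarrow> complex) \<Rightarrow> 'c set \<Rightarrow> bool" where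
  "lin_indep I v C \<longleftrightarrow>
     (\<forall>l. (\<forall>k\<in>I. (\<Sum>c\<in>C. l c * v c k) = 0) \<longrightarrow> (\<forall>c\<in>C. l c = 0))"

lemma lin_indepD:
  "lin_indep I v C \<Longrightarrow> (\<And>k. k \<in> I \<Longrightarrow> (\<Sum>c\<in>C. l c * v c k) = 0) \<Longrightarrow> c \<in> C \<Longrightarrow> l c = 0"
  unfolding lin_indep_def by blast

lemma lin_indep_cong:
  assumes "\<And>c k. c \<in> C \<Longrightarrow> k \<in> I \<Longrightarrow> v c k = w c k"
  shows "lin_indep I v C \<longleftrightarrow> lin_indep I w C"
proof -
  have "(\<Sum>c\<in>C. l c * v c k) = (\<Sum>c\<in>C. l c * w c k)" if "k \<in> I" for l k
    using that assms by (intro sum.cong) auto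
  then show ?thesis unfolding lin_indep_def by simp
qed

lemma lin_indep_subset:
  assumes "lin_indep I v C" "D \<subseteq> C" "finite C"
  shows "lin_indep I v D"
  unfolding lin_indep_def
proof (intro allI impI ballI)
  fix l c assume l: "\<forall>k\<in>I. (\<Sum>c\<in>D. l c * v c k) = 0" and c: "c \<in> D"
  let ?l = "\<lambda>c. if c \<in> D then l c else 0"
  have "(\<Sum>c\<in>C. ?l c * v c k) = (\<Sum>c\<in>D. l c * v c k)" for k
    using assms by (intro sum.mono_neutral_cong_right) auto
  then have "?l c = 0" using l c assms by (intro lin_indepD[OF assms(1), of ?l]) auto
  then show "l c = 0" using c by simp
qed

text \<open>Gaussian elimination by induction on the equations: an equation with a nonzero
  coefficient removes itself and one unknown, which keeps the unknowns in the majority; an equation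
  with only zero coefficients is dropped.\<close>

lemma homogeneous_system_nontrivial:
  fixes M :: "'a \<Rightarrow> 'b \<Rightarrow> complex"
  assumes "finite B" "finite A" "card B < card A"
  shows "\<exists>x. (\<exists>a\<in>A. x a \<noteq> 0) \<and> (\<forall>b\<in>B. (\<Sum>a\<in>A. x a * M a b) = 0)"
  using assms
proof (induction B arbitrary: A M rule: finite_induct)
  case empty
  then have "A \<noteq> {}" by auto
  then show ?case by (intro exI[of _ "\<lambda>_. 1"]) auto
next
  case (insert b B)
  show ?case
  proof (cases "\<forall>a\<in>A. M a b = 0")
    case True
    have "card B < card A" using insert by simp
    from insert.IH[OF insert.prems(1) this, of M] True show ?thesis by auto
  next
    case False
    then obtain a0 where a0: "a0 \<in> A" "M a0 b \<noteq> 0" by blast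
    let ?M = "\<lambda>a c. M a c - M a b / M a0 b * M a0 c"
    have fin: "finite (A - {a0})" and card: "card B < card (A - {a0})"
      using insert a0 by auto
    obtain x where x: "\<exists>a\<in>A - {a0}. x a \<noteq> 0"
      "\<And>c. c \<in> B \<Longrightarrow> (\<Sum>a\<in>A - {a0}. x a * ?M a c) = 0"
      using insert.IH[OF fin card, of ?M] by blast
    \<comment> \<open>Back substitution: \<open>- s\<close> is the value of the eliminated unknown
      \<open>a0\<close> that solves equation \<open>b\<close>.\<close>
    define s where "s = (\<Sum>a\<in>A - {a0}. x a * M a b) / M a0 b"
    define y where "y = x(a0 := - s)"
    have eq: "(\<Sum>a\<in>A. y a * M a c) = (\<Sum>a\<in>A - {a0}. x a * M a c) - s * M a0 c" for c
    proof -
      have "(\<Sum>a\<in>A. y a * M a c) = y a0 * M a0 c + (\<Sum>a\<in>A - {a0}. y a * M a c)"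
        using a0 insert.prems(1) by (simp add: sum.remove)
      also have "(\<Sum>a\<in>A - {a0}. y a * M a c) = (\<Sum>a\<in>A - {a0}. x a * M a c)"
        by (intro sum.cong) (auto simp: y_def)
      finally show ?thesis by (simp add: y_def)
    qed
    have "(\<Sum>a\<in>A. y a * M a b) = 0" using a0 by (simp add: eq s_def)
    moreover have "(\<Sum>a\<in>A. y a * M a c) = 0" if "c \<in> B" for c
    proof -
      have "0 = (\<Sum>a\<in>A - {a0}. x a * M a c) - (\<Sum>a\<in>A - {a0}. x a * M a b * (M a0 c / M a0 b))"
        using x(2)[OF that] by (simp add: algebra_simps sum_subtractf)
      also have "(\<Sum>a\<in>A - {a0}. x a * M a b * (M a0 c / M a0 b)) = s * M a0 c"
        unfolding sum_distrib_right[symmetric] s_def by simp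
      finally show ?thesis by (simp add: eq)
    qed
    moreover have "\<exists>a\<in>A. y a \<noteq> 0" using x(1) by (auto simp: y_def)
    ultimately show ?thesis by blast
  qed
qed

text \<open>With more \<open>w\<close> than \<open>v\<close>, the coefficient rows
  \<open>T a\<close> would satisfy a nontrivial relation, and this relation would carry over to the
  \<open>w\<close>.\<close>

lemma card_lin_indep_le:
  assumes ind: "lin_indep I w A" and fin: "finite A" "finite B"
    and comb: "\<And>a k. a \<in> A \<Longrightarrow> k \<in> I \<Longrightarrow> w a k = (\<Sum>b\<in>B. T a b * v b k)"
  shows "card A \<le> card B"
proof (rule ccontr)
  assume "\<not> ?thesis"
  then obtain x where x: "\<exists>a\<in>A. x a \<noteq> 0" "\<And>b. b \<in> B \<Longrightarrow> (\<Sum>a\<in>A. x a * T a b) = 0"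
    using homogeneous_system_nontrivial[OF fin(2,1), of T] by (metis not_le)
  have "(\<Sum>a\<in>A. x a * w a k) = 0" if "k \<in> I" for k
  proof -
    have "(\<Sum>a\<in>A. x a * w a k) = (\<Sum>a\<in>A. \<Sum>b\<in>B. x a * T a b * v b k)"
      using that by (intro sum.cong) (auto simp: comb sum_distrib_left mult.assoc)
    also have "\<dots> = (\<Sum>b\<in>B. (\<Sum>a\<in>A. x a * T a b) * v b k)"
      by (subst sum.swap) (simp add: sum_distrib_right)
    also have "\<dots> = 0" using x(2) by simp
    finally show ?thesis .
  qed
  then have "\<forall>a\<in>A. x a = 0" using ind unfolding lin_indep_def by blast
  with x(1) show False by blast
qed

text \<open>The subfamily is chosen of maximal size, not just maximal under inclusion, so that its
  size can serve as the rank of the family.\<close>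

lemma maximal_lin_indep_spans:
  assumes "finite C"
  obtains D T where "D \<subseteq> C" "lin_indep I v D"
    "\<And>c k. c \<in> C \<Longrightarrow> k \<in> I \<Longrightarrow> v c k = (\<Sum>b\<in>D. T c b * v b k)"
    "\<And>D'. D' \<subseteq> C \<Longrightarrow> lin_indep I v D' \<Longrightarrow> card D' \<le> card D"
proof -
  have "lin_indep I v {}" by (simp add: lin_indep_def)
  then have ex: "\<exists>D. D \<subseteq> C \<and> lin_indep I v D" by blast
  have "\<exists>D. (D \<subseteq> C \<and> lin_indep I v D) \<and> (\<forall>D'. D' \<subseteq> C \<and> lin_indep I v D' \<longrightarrow> card D' \<le> card D)"
    by (rule ex_has_greatest_nat[OF _, of _ "{}" card "Suc (card C)"])
       (use assms \<open>lin_indep I v {}\<close> in \<open>auto intro!: card_mono le_imp_less_Suc\<close>)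
  then obtain D where D: "D \<subseteq> C" "lin_indep I v D"
    "\<And>D'. D' \<subseteq> C \<Longrightarrow> lin_indep I v D' \<Longrightarrow> card D' \<le> card D" by blast
  have fD: "finite D" using D(1) assms finite_subset by blast
  have "\<exists>t. \<forall>k\<in>I. v c k = (\<Sum>b\<in>D. t b * v b k)" if "c \<in> C" for c
  proof (cases "c \<in> D")
    case True
    have "v c k = (\<Sum>b\<in>D. (if b = c then 1 else 0) * v b k)" for k
      using True fD by (simp add: if_distrib[of "\<lambda>z. z * _"] sum.delta cong: if_cong)
    then show ?thesis by (intro exI[of _ "\<lambda>b. if b = c then 1 else 0"]) blast
  next
    case False
    have "\<not> lin_indep I v (insert c D)"
      using D(3)[of "insert c D"] D(1) that False fD by auto
    then obtain l where l: "\<forall>k\<in>I. (\<Sum>b\<in>insert c D. l b * v b k) = 0" "\<exists>b\<in>insert c D. l b \<noteq> 0"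
      unfolding lin_indep_def by blast
    have s: "l c * v c k + (\<Sum>b\<in>D. l b * v b k) = 0" if "k \<in> I" for k
      using l(1) that fD False by simp
    have "l c \<noteq> 0"
    proof
      assume "l c = 0"
      then have "\<forall>b\<in>D. l b = 0" using s D(2) unfolding lin_indep_def by simp
      with l(2) \<open>l c = 0\<close> show False by auto
    qed
    have "v c k = (\<Sum>b\<in>D. (- l b / l c) * v b k)" if "k \<in> I" for k
    proof -
      have "v c k = - (\<Sum>b\<in>D. l b * v b k) / l c"
        using s[OF that] \<open>l c \<noteq> 0\<close> by (simp add: field_simps add_eq_0_iff)
      also have "\<dots> = (\<Sum>b\<in>D. (- l b / l c) * v b k)"
        by (simp add: sum_divide_distrib sum_negf)
      finally show ?thesis .
    qed
    then show ?thesis by (intro exI[of _ "\<lambda>b. - l b / l c"]) blast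
  qed
  then obtain T where "\<And>c k. c \<in> C \<Longrightarrow> k \<in> I \<Longrightarrow> v c k = (\<Sum>b\<in>D. T c b * v b k)"
    by metis
  with D that show thesis by blast
qed


section \<open>Polynomial functions\<close>

text \<open>\<open>polyf I n\<close>: polynomial functions of degree at most \<open>n\<close> in the variables in \<open>I\<close>.\<close>

inductive polyf :: "'i set \<Rightarrow> nat \<Rightarrow> (('i \<Rightarrow> complex) \<Rightarrow> complex) \<Rightarrow> bool" for I where
  polyf_const: "polyf I n (\<lambda>x. c)"
| polyf_var_mult: "i \<in> I \<Longrightarrow> polyf I n g \<Longrightarrow> polyf I (Suc n) (\<lambda>x. x i * g x)"
| polyf_add: "polyf I n f \<Longrightarrow> polyf I n g \<Longrightarrow> polyf I n (\<lambda>x. f x + g x)"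

text \<open>Forgets the degree bound of \<open>polyf\<close>, which is kept only for counting
  monomials and for inductions on the degree.\<close>

definition pfn :: "'i set \<Rightarrow> (('i \<Rightarrow> complex) \<Rightarrow> complex) \<Rightarrow> bool" where
  "pfn I f \<longleftrightarrow> (\<exists>n. polyf I n f)"

lemma polyf_mono:
  assumes "polyf I n f" "n \<le> n'" "I \<subseteq> J" shows "polyf J n' f"
  using assms
proof (induction arbitrary: n')
  case (polyf_var_mult i n g)
  then obtain k where "n' = Suc k" "n \<le> k" by (cases n') auto
  with polyf_var_mult show ?case by (auto intro: polyf.intros)
qed (auto intro: polyf.intros)

lemma polyf_cmult: "polyf I n f \<Longrightarrow> polyf I n (\<lambda>x. c * f x)"
proof (induction rule: polyf.induct)
  case (polyf_var_mult i n g)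
  have "polyf I (Suc n) (\<lambda>x. x i * (c * g x))" by (intro polyf.intros polyf_var_mult)
  then show ?case by (simp add: mult.left_commute)
next
  case (polyf_add n f g)
  have "polyf I n (\<lambda>x. c * f x + c * g x)" by (intro polyf.intros polyf_add)
  then show ?case by (simp add: distrib_left)
qed (auto intro: polyf.intros)

lemma polyf_mult: "polyf I n f \<Longrightarrow> polyf I k g \<Longrightarrow> polyf I (n + k) (\<lambda>x. f x * g x)"
proof (induction rule: polyf.induct)
  case (polyf_const n c)
  then show ?case using polyf_cmult polyf_mono by (metis le_add2 subset_refl)
next
  case (polyf_var_mult i n f)
  have "polyf I (Suc (n + k)) (\<lambda>x. x i * (f x * g x))" by (intro polyf.intros polyf_var_mult)
  then show ?case by (simp add: mult.assoc)
next
  case (polyf_add n f f')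
  have "polyf I (n + k) (\<lambda>x. f x * g x + f' x * g x)" by (intro polyf.intros polyf_add)
  then show ?case by (simp add: distrib_right)
qed

lemma pfn_const [simp, intro]: "pfn I (\<lambda>x. c)"
  by (auto simp: pfn_def intro: polyf.intros)

lemma pfn_var [intro]: "i \<in> I \<Longrightarrow> pfn I (\<lambda>x. x i)"
  using polyf_var_mult[OF _ polyf_const[of I 0 1], of i] by (auto simp: pfn_def)

lemma pfn_add [intro]: "pfn I f \<Longrightarrow> pfn I g \<Longrightarrow> pfn I (\<lambda>x. f x + g x)"
proof -
  assume "pfn I f" "pfn I g"
  then obtain n k where "polyf I n f" "polyf I k g" by (auto simp: pfn_def)
  then have "polyf I (max n k) f" "polyf I (max n k) g" by (auto intro: polyf_mono)
  then show ?thesis unfolding pfn_def by (blast intro: polyf_add)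
qed

lemma pfn_mult [intro]: "pfn I f \<Longrightarrow> pfn I g \<Longrightarrow> pfn I (\<lambda>x. f x * g x)"
  unfolding pfn_def by (blast intro: polyf_mult)

lemma pfn_diff [intro]: "pfn I f \<Longrightarrow> pfn I g \<Longrightarrow> pfn I (\<lambda>x. f x - g x)"
  using pfn_add[of I f "\<lambda>x. (-1) * g x"] pfn_mult[of I "\<lambda>x. -1" g] by simp

lemma pfn_sum [intro]: "(\<And>a. a \<in> A \<Longrightarrow> pfn I (f a)) \<Longrightarrow> pfn I (\<lambda>x. \<Sum>a\<in>A. f a x)"
  by (induction A rule: infinite_finite_induct) auto

lemma pfn_prod [intro]: "(\<And>a. a \<in> A \<Longrightarrow> pfn I (f a)) \<Longrightarrow> pfn I (\<lambda>x. \<Prod>a\<in>A. f a x)"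
  by (induction A rule: infinite_finite_induct) auto

lemma pfn_power [intro]: "pfn I f \<Longrightarrow> pfn I (\<lambda>x. f x ^ k)"
  by (induction k) auto

lemma pfn_mono: "pfn I f \<Longrightarrow> I \<subseteq> J \<Longrightarrow> pfn J f"
  unfolding pfn_def using polyf_mono by blast

lemma pfn_induct [consumes 1, case_names const var_mult add]:
  assumes "pfn I f" "\<And>c. P (\<lambda>x. c)"
    "\<And>i g. i \<in> I \<Longrightarrow> pfn I g \<Longrightarrow> P g \<Longrightarrow> P (\<lambda>x. x i * g x)"
    "\<And>f g. pfn I f \<Longrightarrow> P f \<Longrightarrow> pfn I g \<Longrightarrow> P g \<Longrightarrow> P (\<lambda>x. f x + g x)"
  shows "P f"
proof -
  obtain n where "polyf I n f" using assms(1) by (auto simp: pfn_def)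
  then show ?thesis
  proof induction
    case (polyf_var_mult i n g)
    then show ?case using assms(3)[of i g] by (auto simp: pfn_def)
  next
    case (polyf_add n f g)
    then show ?case using assms(4)[of f g] by (auto simp: pfn_def)
  qed (rule assms(2))
qed

lemma pfn_compose:
  assumes "pfn I f" "\<And>i. i \<in> I \<Longrightarrow> pfn J (g i)"
  shows "pfn J (\<lambda>x. f (\<lambda>i. g i x))"
  using assms(1) by (induction rule: pfn_induct) (auto intro: assms(2))

lemma pfn_depends:
  assumes "pfn I f" "\<And>i. i \<in> I \<Longrightarrow> x i = y i" shows "f x = f y"
  using assms(1) by (induction rule: pfn_induct) (auto simp: assms(2))

section \<open>Restriction to curves and generic nonvanishing\<close>

lemma pfn_curve:
  assumes "pfn I f"
  shows "\<exists>p. \<forall>t. f (\<lambda>i. poly (g i) t) = poly p t"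
  using assms
proof (induction rule: pfn_induct)
  case (const c) show ?case by (intro exI[of _ "[:c:]"]) simp
next
  case (var_mult i h)
  then obtain p where "\<forall>t. h (\<lambda>i. poly (g i) t) = poly p t" by blast
  then show ?case by (intro exI[of _ "g i * p"]) simp
next
  case (add f h)
  then obtain p q where "\<forall>t. f (\<lambda>i. poly (g i) t) = poly p t" "\<forall>t. h (\<lambda>i. poly (g i) t) = poly q t"
    by blast
  then show ?case by (intro exI[of _ "p + q"]) simp
qed

lemma pfn_line:
  assumes "pfn I f"
  shows "\<exists>p. \<forall>t. f (\<lambda>i. x i + t * y i) = poly p t"
  using pfn_curve[OF assms, of "\<lambda>i. [:x i, y i:]"] by simp

lemma polys_common_nonroot:
  fixes ps :: "complex poly set"
  assumes "finite ps" "\<And>p. p \<in> ps \<Longrightarrow> p \<noteq> 0"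
  shows "\<exists>t. \<forall>p\<in>ps. poly p t \<noteq> 0"
proof -
  have "\<Prod>ps \<noteq> 0" using assms by auto
  then have "finite {t. poly (\<Prod>ps) t = 0}" by (rule poly_roots_finite)
  then obtain t where "poly (\<Prod>ps) t \<noteq> 0"
    using infinite_UNIV_char_0[where 'a=complex] by (metis (mono_tags) UNIV_eq_I mem_Collect_eq)
  then show ?thesis using assms(1) by (auto simp: poly_prod)
qed

text \<open>Irreducibility of affine space. On the line through \<open>x\<close> and
  \<open>y\<close> both functions become nonzero polynomials in \<open>t\<close>, as the values at
  \<open>t = 0\<close> and at \<open>t = 1\<close> show.\<close>

lemma pfn_common_nonzero:
  assumes "pfn I f" "pfn J g" "f x \<noteq> 0" "g y \<noteq> 0"
  obtains z where "f z \<noteq> 0" "g z \<noteq> 0"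
proof -
  let ?l = "\<lambda>t i. x i + t * (y i - x i)"
  obtain p where p: "\<forall>t. f (?l t) = poly p t"
    using pfn_line[OF assms(1), of x "\<lambda>i. y i - x i"] by blast
  obtain q where q: "\<forall>t. g (?l t) = poly q t"
    using pfn_line[OF assms(2), of x "\<lambda>i. y i - x i"] by blast
  have "poly p 0 \<noteq> 0" "poly q 1 \<noteq> 0" using p[rule_format, of 0] q[rule_format, of 1] assms by auto
  then have "p \<noteq> 0" "q \<noteq> 0" by auto
  then obtain t where "poly p t \<noteq> 0" "poly q t \<noteq> 0"
    using polys_common_nonroot[of "{p, q}"] by auto
  with p q that show thesis by metis
qed

text \<open>Density of a nonempty principal open set, in the form in which it is used: an identity
  of polynomial functions need only be checked where \<open>f\<close> does not vanish.\<close>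

lemma pfn_integral_domain:
  assumes "pfn I f" "pfn J g" "f x \<noteq> 0" "\<And>z. f z \<noteq> 0 \<Longrightarrow> g z = 0"
  shows "g y = 0"
  using pfn_common_nonzero[OF assms(1,2,3), of y] assms(4) by blast

lemma pfn_common_nonzero_family:
  assumes "finite A" "\<And>a. a \<in> A \<Longrightarrow> pfn I (f a)" "\<And>a. a \<in> A \<Longrightarrow> \<exists>x. f a x \<noteq> 0"
  shows "\<exists>x. \<forall>a\<in>A. f a x \<noteq> 0"
  using assms
proof (induction A rule: finite_induct)
  case (insert a A)
  then obtain x where x: "\<forall>a\<in>A. f a x \<noteq> 0" by blast
  obtain y where y: "f a y \<noteq> 0" using insert.prems by blast
  have "pfn I (\<lambda>x. \<Prod>a\<in>A. f a x)" using insert.prems by blast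
  moreover have "(\<Prod>a\<in>A. f a x) \<noteq> 0" using x insert by simp
  ultimately obtain z where "(\<Prod>a\<in>A. f a z) \<noteq> 0" "f a z \<noteq> 0"
    using y pfn_common_nonzero[of I "\<lambda>x. \<Prod>a\<in>A. f a x" I "f a"] insert.prems by blast
  then show ?case using insert.hyps by auto
qed auto

text \<open>Fraction-free Gaussian elimination produces the polynomial.\<close>

lemma lin_indep_open:
  fixes v :: "'c \<Rightarrow> 'k \<Rightarrow> ('p \<Rightarrow> complex) \<Rightarrow> complex"
  assumes "finite C" "\<And>c k. c \<in> C \<Longrightarrow> k \<in> I \<Longrightarrow> pfn J (v c k)" "lin_indep I (\<lambda>c k. v c k x0) C"
  obtains h where "pfn J h" "h x0 \<noteq> 0" "\<And>x. h x \<noteq> 0 \<Longrightarrow> lin_indep I (\<lambda>c k. v c k x) C"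
proof -
  have "\<exists>h. pfn J h \<and> h x0 \<noteq> 0 \<and> (\<forall>x. h x \<noteq> 0 \<longrightarrow> lin_indep I (\<lambda>c k. v c k x) C)"
    using assms
  proof (induction C arbitrary: v rule: finite_induct)
    case empty
    show ?case by (intro exI[of _ "\<lambda>_. 1"]) (simp add: lin_indep_def)
  next
    case (insert c C)
    have "\<exists>k0\<in>I. v c k0 x0 \<noteq> 0"
    proof (rule ccontr)
      assume *: "\<not> ?thesis"
      have "(\<Sum>b\<in>insert c C. (if b = c then 1 else 0) * v b k x0) = v c k x0" for k
        using insert.hyps by (simp add: if_distrib[of "\<lambda>z. z * _"] sum.delta cong: if_cong)
      then have "(if c = c then 1 else 0 :: complex) = 0"
        using lin_indepD[OF insert.prems(2), of "\<lambda>b. if b = c then 1 else 0" c] * by auto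
      then show False by simp
    qed
    then obtain k0 where k0: "k0 \<in> I" "v c k0 x0 \<noteq> 0" by blast
    \<comment> \<open>Clearing the pivot column \<open>k0\<close> by cross-multiplication instead of
      division keeps the entries polynomial in \<open>x\<close>.\<close>
    define w where "w = (\<lambda>b k x. v c k0 x * v b k x - v b k0 x * v c k x)"
    have sum_w: "(\<Sum>b\<in>C. l b * w b k x)
        = v c k0 x * (\<Sum>b\<in>C. l b * v b k x) - (\<Sum>b\<in>C. l b * v b k0 x) * v c k x" for l k x
      by (simp add: w_def algebra_simps sum_subtractf sum_distrib_left sum_distrib_right)
    have "lin_indep I (\<lambda>b k. w b k x0) C"
      unfolding lin_indep_def
    proof (intro allI impI ballI)
      fix l b assume l: "\<forall>k\<in>I. (\<Sum>b\<in>C. l b * w b k x0) = 0" and b: "b \<in> C"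
      \<comment> \<open>A relation among the cleared rows lifts to one among the original rows; the
        coefficient of the pivot row makes up for what was subtracted.\<close>
      define l' where "l' = (\<lambda>b. if b = c then - (\<Sum>b\<in>C. l b * v b k0 x0) else l b * v c k0 x0)"
      have "(\<Sum>b\<in>insert c C. l' b * v b k x0) = 0" if "k \<in> I" for k
      proof -
        have "(\<Sum>b\<in>C. l' b * v b k x0) = (\<Sum>b\<in>C. l b * v c k0 x0 * v b k x0)"
          using insert.hyps by (intro sum.cong) (auto simp: l'_def)
        also have "\<dots> = v c k0 x0 * (\<Sum>b\<in>C. l b * v b k x0)"
          by (simp add: sum_distrib_left algebra_simps)
        finally show ?thesis
          using insert.hyps l that by (simp add: sum_w l'_def)
      qed
      then have "l' b = 0" using lin_indepD[OF insert.prems(2), of l'] b by blast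
      then show "l b = 0" using b insert.hyps k0 by (auto simp: l'_def split: if_splits)
    qed
    moreover have "pfn J (w b k)" if "b \<in> C" "k \<in> I" for b k
      unfolding w_def using that k0 by (intro pfn_diff pfn_mult insert.prems) auto
    ultimately obtain h where h: "pfn J h" "h x0 \<noteq> 0"
        "\<And>x. h x \<noteq> 0 \<Longrightarrow> lin_indep I (\<lambda>c k. w c k x) C"
      using insert.IH[of w] by blast
    \<comment> \<open>Away from \<open>x0\<close> the pivot may vanish, so it becomes a factor of
      the polynomial.\<close>
    have "lin_indep I (\<lambda>c k. v c k x) (insert c C)" if "h x * v c k0 x \<noteq> 0" for x
      unfolding lin_indep_def
    proof (intro allI impI)
      fix l assume l: "\<forall>k\<in>I. (\<Sum>b\<in>insert c C. l b * v b k x) = 0"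
      have s: "(\<Sum>b\<in>C. l b * v b k x) = - (l c * v c k x)" if "k \<in> I" for k
        using l that insert.hyps by (simp add: add_eq_0_iff2)
      have "(\<Sum>b\<in>C. l b * w b k x) = 0" if "k \<in> I" for k
        using k0 that by (simp add: sum_w s)
      then have 0: "l b = 0" if "b \<in> C" for b
        using lin_indepD[OF h(3)[of x], of l] that \<open>h x * v c k0 x \<noteq> 0\<close> by auto
      then have "l c * v c k0 x = 0" using s[OF k0(1)] by simp
      then show "\<forall>c\<in>insert c C. l c = 0" using 0 that by auto
    qed
    moreover have "pfn J (\<lambda>x. h x * v c k0 x)" using h k0 insert.prems by blast
    ultimately show ?case using h k0 by (intro exI[of _ "\<lambda>x. h x * v c k0 x"]) auto
  qed
  with that show thesis by blast
qed


section \<open>Partial derivatives\<close>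

text \<open>The analytic derivative along a coordinate line, so that the rules of differentiation
  come from calculus in one variable; the differentiability that they require is provided by
  \<open>pfn\<close>.\<close>

definition pd :: "'i \<Rightarrow> (('i \<Rightarrow> complex) \<Rightarrow> complex) \<Rightarrow> ('i \<Rightarrow> complex) \<Rightarrow> complex" where
  "pd i f x = deriv (\<lambda>t. f (x(i := t))) (x i)"

lemma pfn_coordinate_line:
  assumes "pfn I f"
  obtains p where "\<And>t. f (x(i := t)) = poly p t" "\<And>t. pd i f (x(i := t)) = poly (pderiv p) t"
proof -
  have "(\<lambda>j. poly (if j = i then [:0, 1:] else [:x j:]) t) = x(i := t)" for t by auto
  then obtain p where p: "\<forall>t. f (x(i := t)) = poly p t"
    using pfn_curve[OF assms, of "\<lambda>j. if j = i then [:0, 1:] else [:x j:]"] by auto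
  have "pd i f (x(i := t)) = poly (pderiv p) t" for t
    unfolding pd_def using p by (auto intro!: DERIV_imp_deriv poly_DERIV)
  with p that show thesis by blast
qed

lemma pfn_has_pd:
  assumes "pfn I f"
  shows "((\<lambda>t. f (x(i := t))) has_field_derivative pd i f x) (at (x i))"
proof -
  obtain p where p: "\<And>t. f (x(i := t)) = poly p t" "\<And>t. pd i f (x(i := t)) = poly (pderiv p) t"
    using pfn_coordinate_line[OF assms] by blast
  have "pd i f x = poly (pderiv p) (x i)" using p(2)[of "x i"] by simp
  then show ?thesis using p(1) poly_DERIV[of p "x i"] by simp
qed

lemma pd_const [simp]: "pd i (\<lambda>x. c) x = 0"
  by (simp add: pd_def)

lemma pd_var [simp]: "pd i (\<lambda>x. x j) x = (if i = j then 1 else 0)"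
  by (cases "i = j") (simp_all add: pd_def)

lemma pd_add:
  assumes "pfn I f" "pfn J g"
  shows "pd i (\<lambda>x. f x + g x) x = pd i f x + pd i g x"
  unfolding pd_def[of i "\<lambda>x. f x + g x"]
  by (intro DERIV_imp_deriv DERIV_add pfn_has_pd[OF assms(1)] pfn_has_pd[OF assms(2)])

lemma pd_mult:
  assumes "pfn I f" "pfn J g"
  shows "pd i (\<lambda>x. f x * g x) x = pd i f x * g x + f x * pd i g x"
  unfolding pd_def[of i "\<lambda>x. f x * g x"]
  using DERIV_mult[OF pfn_has_pd[OF assms(1), of x i] pfn_has_pd[OF assms(2), of x i]]
  by (intro DERIV_imp_deriv) (simp add: algebra_simps)

lemma pd_sum:
  assumes "\<And>a. a \<in> A \<Longrightarrow> pfn I (f a)"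
  shows "pd i (\<lambda>x. \<Sum>a\<in>A. f a x) x = (\<Sum>a\<in>A. pd i (f a) x)"
  unfolding pd_def[of i "\<lambda>x. \<Sum>a\<in>A. f a x"]
  by (intro DERIV_imp_deriv DERIV_sum pfn_has_pd[of I] assms)

text \<open>At \<open>n = 0\<close> truncated subtraction makes the degree bound \<open>0\<close>
  again; the second conjunct records that the derivative is then zero, which is where inductions on
  the degree end.\<close>

lemma polyf_pd: "polyf I n f \<Longrightarrow> polyf I (n - 1) (pd i f) \<and> (n = 0 \<longrightarrow> (\<forall>x. pd i f x = 0))"
proof (induction rule: polyf.induct)
  case (polyf_const n c)
  have "pd i (\<lambda>x. c) = (\<lambda>x. 0)" by auto
  then show ?case by (auto intro: polyf.intros)
next
  case (polyf_var_mult j n g)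
  have g: "pfn I g" using polyf_var_mult by (auto simp: pfn_def)
  have eq: "pd i (\<lambda>x. x j * g x) = (\<lambda>x. (if i = j then 1 else 0) * g x + x j * pd i g x)"
    using polyf_var_mult by (intro ext) (subst pd_mult[OF pfn_var[of j I] g], auto)
  have "polyf I n (\<lambda>x. x j * pd i g x)"
  proof (cases n)
    case 0
    then show ?thesis using polyf_var_mult by (auto intro: polyf.intros)
  next
    case (Suc k)
    then show ?thesis using polyf_var_mult by (auto intro: polyf.intros)
  qed
  moreover have "polyf I n (\<lambda>x. (if i = j then 1 else 0) * g x)"
    using polyf_var_mult by (intro polyf_cmult)
  ultimately show ?case unfolding eq by (simp add: polyf.polyf_add)
next
  case (polyf_add n f g)
  then have "pfn I f" "pfn I g" by (auto simp: pfn_def)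
  then have eq: "pd i (\<lambda>x. f x + g x) = (\<lambda>x. pd i f x + pd i g x)"
    by (intro ext) (rule pd_add)
  show ?case unfolding eq using polyf_add by (auto intro: polyf.intros)
qed

lemma pfn_pd: "pfn I f \<Longrightarrow> pfn I (pd i f)"
  unfolding pfn_def by (auto dest: polyf_pd[where i = i])

lemma pfn_chain_rule:
  assumes "pfn I f" "finite I"
    and "\<And>i. i \<in> I \<Longrightarrow> ((\<lambda>t. y t i) has_field_derivative y' i) (at t)"
  shows "((\<lambda>t. f (y t)) has_field_derivative (\<Sum>i\<in>I. pd i f (y t) * y' i)) (at t)"
  using assms(1)
proof (induction rule: pfn_induct)
  case (var_mult j g)
  have "(\<Sum>i\<in>I. pd i (\<lambda>x. x j * g x) (y t) * y' i)
      = (\<Sum>i\<in>I. (if i = j then g (y t) * y' i else 0) + y t j * (pd i g (y t) * y' i))"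
    by (intro sum.cong refl) (subst pd_mult[OF pfn_var[of j I] var_mult(2)], use var_mult in \<open>auto
        simp: algebra_simps\<close>)
  also have "\<dots> = y' j * g (y t) + (\<Sum>i\<in>I. pd i g (y t) * y' i) * y t j"
    using assms(2) var_mult(1) by (simp add: sum.distrib sum_distrib_left sum_distrib_right mult_ac)
  finally show ?case using DERIV_mult[OF assms(3)[OF var_mult(1)] var_mult(3)] by simp
next
  case (add f g)
  have "(\<Sum>i\<in>I. pd i (\<lambda>x. f x + g x) (y t) * y' i)
      = (\<Sum>i\<in>I. pd i f (y t) * y' i) + (\<Sum>i\<in>I. pd i g (y t) * y' i)"
    by (simp add: pd_add[OF add(1,2)] distrib_right sum.distrib)
  then show ?case using DERIV_add[OF add(3,4)] by simp
qed simp

lemma pd_compose: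
  assumes "pfn I f" "finite I" "\<And>i. i \<in> I \<Longrightarrow> pfn J (g i)"
  shows "pd k (\<lambda>x. f (\<lambda>i. g i x)) x = (\<Sum>i\<in>I. pd i f (\<lambda>i. g i x) * pd k (g i) x)"
proof -
  have "((\<lambda>t. f (\<lambda>i. g i (x(k := t)))) has_field_derivative
      (\<Sum>i\<in>I. pd i f (\<lambda>i. g i (x(k := x k))) * pd k (g i) x)) (at (x k))"
    by (rule pfn_chain_rule[OF assms(1,2)]) (rule pfn_has_pd[OF assms(3)])
  then show ?thesis unfolding pd_def[of k "\<lambda>x. f (\<lambda>i. g i x)"]
    by (intro DERIV_imp_deriv) simp
qed

lemma pd_eq_0_imp_update:
  assumes "pfn I f" "\<And>x. pd i f x = 0"
  shows "f (x(i := t)) = f x"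
proof -
  obtain p where p: "\<And>t. f (x(i := t)) = poly p t" "\<And>t. pd i f (x(i := t)) = poly (pderiv p) t"
    using pfn_coordinate_line[OF assms(1)] by blast
  then have "pderiv p = 0" using assms(2) by (metis poly_all_0_iff_0)
  then obtain c where "p = [:c:]" by (metis pderiv_eq_0_iff degree_eq_zeroE)
  then show ?thesis using p(1)[of t] p(1)[of "x i"] by simp
qed

text \<open>The coordinates of \<open>y\<close> are replaced by those of \<open>x\<close> one at a
  time. Characteristic zero enters through \<open>pd_eq_0_imp_update\<close>.\<close>

lemma pd_all_0_imp_const:
  assumes "pfn I f" "finite I" "\<And>i x. i \<in> I \<Longrightarrow> pd i f x = 0"
  shows "f x = f y"
proof -
  have "f (\<lambda>i. if i \<in> J then x i else y i) = f y" if "finite J" "J \<subseteq> I" for J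
    using that
  proof (induction J)
    case (insert i J)
    have "f (\<lambda>k. if k \<in> insert i J then x k else y k) = f ((\<lambda>k. if k \<in> J then x k else y k)(i := x i))"
      by (rule arg_cong[of _ _ f]) auto
    also have "\<dots> = f (\<lambda>k. if k \<in> J then x k else y k)"
      using pd_eq_0_imp_update[OF assms(1), of i] assms(3) insert by auto
    finally show ?case using insert by simp
  qed simp
  from this[OF assms(2) subset_refl] show ?thesis
    using pfn_depends[OF assms(1), of x "\<lambda>i. if i \<in> I then x i else y i"] by simp
qed


section \<open>Algebraic independence\<close>

text \<open>A sum that vanishes identically is the zero polynomial in the variable \<open>j\<close>;
  its coefficient at the exponent of \<open>s0\<close> is a sum of the same kind in fewer variables.
  Terms are indexed by \<open>S\<close> rather than by their exponents, so the terms that are kept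
  need no renaming.\<close>

lemma monomials_independent:
  assumes "finite A" "finite S" "\<And>s s'. s \<in> S \<Longrightarrow> s' \<in> S \<Longrightarrow> (\<And>i. i \<in> A \<Longrightarrow> e s i = e s' i) \<Longrightarrow> s = s'"
    and "\<And>y :: 'i \<Rightarrow> complex. (\<Sum>s\<in>S. a s * (\<Prod>i\<in>A. y i ^ e s i)) = 0" and "s0 \<in> S"
  shows "a s0 = 0"
  using assms
proof (induction A arbitrary: S rule: finite_induct)
  case empty
  then have "S = {s0}" by auto
  with empty(3) show ?case by simp
next
  case (insert j A)
  define S' where "S' = {s\<in>S. e s j = e s0 j}"
  have "(\<Sum>s\<in>S'. a s * (\<Prod>i\<in>A. y i ^ e s i)) = 0" for y
  proof -
    define p where "p = (\<Sum>s\<in>S. Polynomial.monom (a s * (\<Prod>i\<in>A. y i ^ e s i)) (e s j))"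
    have "poly p t = 0" for t
    proof -
      have "(\<Prod>i\<in>insert j A. (y(j := t)) i ^ e s i) = t ^ e s j * (\<Prod>i\<in>A. y i ^ e s i)" for s
      proof -
        have "(\<Prod>i\<in>A. (y(j := t)) i ^ e s i) = (\<Prod>i\<in>A. y i ^ e s i)"
          using insert.hyps by (intro prod.cong) auto
        then show ?thesis using insert.hyps by simp
      qed
      then show ?thesis using insert.prems(3)[of "y(j := t)"]
        by (simp add: p_def poly_sum poly_monom mult_ac)
    qed
    then have "coeff p (e s0 j) = 0" by (metis poly_all_0_iff_0 coeff_0)
    moreover have "coeff p (e s0 j) = (\<Sum>s\<in>S'. a s * (\<Prod>i\<in>A. y i ^ e s i))"
      unfolding p_def S'_def coeff_sum
      by (rule sum.mono_neutral_cong_right) (use insert.prems in auto)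
    ultimately show ?thesis by simp
  qed
  moreover have "finite S'" "s0 \<in> S'" using insert.prems by (auto simp: S'_def)
  moreover have "s = s'" if "s \<in> S'" "s' \<in> S'" "\<And>i. i \<in> A \<Longrightarrow> e s i = e s' i" for s s'
    by (rule insert.prems(2)) (use that in \<open>auto simp: S'_def\<close>)
  ultimately show ?case using insert.IH[of S'] by blast
qed

text \<open>Bounding each exponent by \<open>n\<close>, instead of their sum, admits more monomials
  but makes the exponents a product set, whose size is immediate.\<close>

lemma polyf_expand:
  assumes "polyf I n f" "finite I"
  shows "\<exists>a. \<forall>x. f x = (\<Sum>e\<in>I \<rightarrow>\<^sub>E {..n}. a e * (\<Prod>i\<in>I. x i ^ e i))"
  using assms(1)
proof induction
  case (polyf_const n c)
  let ?z = "\<lambda>i\<in>I. 0 :: nat"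
  have "?z \<in> I \<rightarrow>\<^sub>E {..n}" by auto
  moreover have "finite (I \<rightarrow>\<^sub>E {..n})" using assms(2) by (auto intro: finite_PiE)
  ultimately have "(\<Sum>e\<in>I \<rightarrow>\<^sub>E {..n}. (if e = ?z then c else 0) * (\<Prod>i\<in>I. x i ^ e i)) = c" for x
    by (simp add: if_distrib[of "\<lambda>z. z * _"] sum.delta cong: if_cong)
  then show ?case by (intro exI[of _ "\<lambda>e. if e = ?z then c else 0"]) simp
next
  case (polyf_var_mult j n g)
  then obtain a where a: "\<And>x. g x = (\<Sum>e\<in>I \<rightarrow>\<^sub>E {..n}. a e * (\<Prod>i\<in>I. x i ^ e i))" by blast
  \<comment> \<open>Multiplication by the variable \<open>j\<close> shifts exponents by
    \<open>up\<close>; the new coefficients are sums over the fibres of \<open>up\<close>.\<close>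
  define up where "up = (\<lambda>e :: 'a \<Rightarrow> nat. e(j := Suc (e j)))"
  have fin: "finite (I \<rightarrow>\<^sub>E {..k :: nat})" for k using assms(2) by (auto intro: finite_PiE)
  have up: "up ` (I \<rightarrow>\<^sub>E {..n}) \<subseteq> I \<rightarrow>\<^sub>E {..Suc n}"
    using polyf_var_mult(1) by (fastforce simp: up_def PiE_iff extensional_def)
  have mon: "x j * (\<Prod>i\<in>I. x i ^ e i) = (\<Prod>i\<in>I. x i ^ up e i)" for x e
  proof -
    have "(\<Prod>i\<in>I - {j}. x i ^ e i) = (\<Prod>i\<in>I - {j}. x i ^ up e i)"
      by (intro prod.cong) (auto simp: up_def)
    then show ?thesis using assms(2) polyf_var_mult(1)
      by (simp add: prod.remove[of I j] up_def mult.assoc)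
  qed
  have "x j * g x = (\<Sum>e\<in>I \<rightarrow>\<^sub>E {..Suc n}. (\<Sum>e'\<in>{e' \<in> I \<rightarrow>\<^sub>E {..n}. up e' = e}. a e') * (\<Prod>i\<in>I. x i ^ e
      i))" for x
  proof -
    have "x j * g x = (\<Sum>e\<in>I \<rightarrow>\<^sub>E {..n}. a e * (\<Prod>i\<in>I. x i ^ up e i))"
      by (simp add: a sum_distrib_left mult.left_commute mon)
    also have "\<dots> = (\<Sum>e\<in>I \<rightarrow>\<^sub>E {..Suc n}. \<Sum>e'\<in>{e' \<in> I \<rightarrow>\<^sub>E {..n}. up e' = e}. a e' * (\<Prod>i\<in>I. x i ^ up e'
        i))"
      by (rule sum.group[symmetric]) (use fin up in auto)
    also have "\<dots> = (\<Sum>e\<in>I \<rightarrow>\<^sub>E {..Suc n}. (\<Sum>e'\<in>{e' \<in> I \<rightarrow>\<^sub>E {..n}. up e' = e}. a e') * (\<Prod>i\<in>I. x i ^ e i))"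
      by (simp add: sum_distrib_right)
    finally show ?thesis .
  qed
  then show ?case
    by (intro exI[of _ "\<lambda>e. \<Sum>e'\<in>{e' \<in> I \<rightarrow>\<^sub>E {..n}. up e' = e}. a e'"]) blast
next
  case (polyf_add n f g)
  then obtain a b where "\<And>x. f x = (\<Sum>e\<in>I \<rightarrow>\<^sub>E {..n}. a e * (\<Prod>i\<in>I. x i ^ e i))"
    "\<And>x. g x = (\<Sum>e\<in>I \<rightarrow>\<^sub>E {..n}. b e * (\<Prod>i\<in>I. x i ^ e i))" by blast
  then have "\<And>x. f x + g x = (\<Sum>e\<in>I \<rightarrow>\<^sub>E {..n}. (a e + b e) * (\<Prod>i\<in>I. x i ^ e i))"
    by (simp add: sum.distrib distrib_right)
  then show ?case by (intro exI[of _ "\<lambda>e. a e + b e"]) blast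
qed

text \<open>There are \<open>T ^ card A\<close> monomials in the \<open>g a\<close> with exponents below \<open>T\<close>, but they lie in a
  space of dimension \<open>O(T ^ card I)\<close>.\<close>

lemma algebraically_dependent:
  assumes "finite I" "finite A" "card I < card A" "\<And>a. a \<in> A \<Longrightarrow> pfn I (g a)"
  obtains P y where "pfn A P" "P y \<noteq> 0" "\<And>x. P (\<lambda>a. g a x) = 0"
proof -
  have "\<forall>a\<in>A. \<exists>n. polyf I n (g a)" using assms(4) by (simp add: pfn_def)
  then obtain N where N: "\<And>a. a \<in> A \<Longrightarrow> polyf I (N a) (g a)" by metis
  define E where "E = (\<Sum>a\<in>A. N a)"
  have E: "polyf I E (g a)" if "a \<in> A" for a
    using that assms(2) by (intro polyf_mono[OF N[OF that]]) (auto intro: member_le_sum simp: E_def)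
  \<comment> \<open>Products of powers with exponents below \<open>T\<close> have degree at most
    \<open>D\<close>, and \<open>D + 1 \<le> K * T\<close>. So at most
    \<open>K ^ card I * T ^ card I\<close> monomials occur in them, and the choice of
    \<open>T\<close> keeps this below \<open>T ^ Suc (card I)\<close>.\<close>
  define K where "K = E * card A + 1"
  define T where "T = K ^ card I + 1"
  have "T > 0" by (simp add: T_def)
  define D where "D = E * card A * T"
  have pow: "polyf I (E * k) (\<lambda>x. g a x ^ k)" if "a \<in> A" for a k
  proof (induction k)
    case (Suc k)
    from polyf_mult[OF E[OF that] Suc] show ?case by simp
  qed (auto intro: polyf.intros)
  have prod: "polyf I (E * sum e B) (\<lambda>x. \<Prod>a\<in>B. g a x ^ e a)" if "finite B" "B \<subseteq> A" for B e
    using that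
  proof (induction B rule: finite_induct)
    case (insert b B)
    then show ?case using polyf_mult[OF pow[of b "e b"] insert.IH] by (simp add: distrib_left)
  qed (auto intro: polyf.intros)
  have mon: "polyf I D (\<lambda>x. \<Prod>a\<in>A. g a x ^ e a)" if "e \<in> A \<rightarrow>\<^sub>E {..<T}" for e
  proof -
    have "sum e A \<le> card A * T" using that by (intro sum_bounded_above[of A e T, simplified]) (auto
        dest: PiE_mem less_imp_le)
    then have "E * sum e A \<le> D" by (simp add: D_def mult.assoc)
    then show ?thesis using prod[OF assms(2) subset_refl, of e] by (auto intro: polyf_mono)
  qed
  have "\<forall>e\<in>A \<rightarrow>\<^sub>E {..<T}. \<exists>a. \<forall>x. (\<Prod>b\<in>A. g b x ^ e b) = (\<Sum>f\<in>I \<rightarrow>\<^sub>E {..D}. a f * (\<Prod>i\<in>I. x i ^ f i))"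
    by (intro ballI polyf_expand[OF mon assms(1)])
  from bchoice[OF this] obtain M where M: "\<forall>e\<in>A \<rightarrow>\<^sub>E {..<T}. \<forall>x.
      (\<Prod>b\<in>A. g b x ^ e b) = (\<Sum>f\<in>I \<rightarrow>\<^sub>E {..D}. M e f * (\<Prod>i\<in>I. x i ^ f i))"
    by (rule exE)
  have "D + 1 \<le> K * T" using \<open>T > 0\<close> by (simp add: D_def K_def add_mult_distrib)
  then have "(D + 1) ^ card I \<le> (K * T) ^ card I" by (rule power_mono) simp
  also have "\<dots> = K ^ card I * T ^ card I" by (rule power_mult_distrib)
  also have "\<dots> < T * T ^ card I" using \<open>T > 0\<close> by (intro mult_strict_right_mono) (auto simp: T_def)
  also have "\<dots> = T ^ Suc (card I)" by simp
  also have "\<dots> \<le> T ^ card A" using assms(3) \<open>T > 0\<close> by (intro power_increasing) auto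
  finally have "card (I \<rightarrow>\<^sub>E {..D}) < card (A \<rightarrow>\<^sub>E {..<T})"
    using assms by (simp add: card_PiE)
  moreover have fin: "finite (I \<rightarrow>\<^sub>E {..D})" "finite (A \<rightarrow>\<^sub>E {..<T})"
    using assms by (auto intro: finite_PiE)
  ultimately have "\<exists>c. (\<exists>e\<in>A \<rightarrow>\<^sub>E {..<T}. c e \<noteq> 0) \<and>
      (\<forall>f\<in>I \<rightarrow>\<^sub>E {..D}. (\<Sum>e\<in>A \<rightarrow>\<^sub>E {..<T}. c e * M e f) = 0)"
    by (intro homogeneous_system_nontrivial)
  then obtain c where c: "(\<exists>e\<in>A \<rightarrow>\<^sub>E {..<T}. c e \<noteq> 0) \<and>
      (\<forall>f\<in>I \<rightarrow>\<^sub>E {..D}. (\<Sum>e\<in>A \<rightarrow>\<^sub>E {..<T}. c e * M e f) = 0)"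
    by (rule exE)
  define P where "P = (\<lambda>y. \<Sum>e\<in>A \<rightarrow>\<^sub>E {..<T}. c e * (\<Prod>a\<in>A. y a ^ e a))"
  have "pfn A P" unfolding P_def by (auto intro!: pfn_sum pfn_mult pfn_prod pfn_power)
  moreover have "\<exists>y. P y \<noteq> 0"
  proof (rule ccontr)
    assume "\<nexists>y. P y \<noteq> 0"
    then have P0: "(\<Sum>e\<in>A \<rightarrow>\<^sub>E {..<T}. c e * (\<Prod>a\<in>A. y a ^ e a)) = 0" for y
      by (simp add: P_def)
    have "c e = 0" if "e \<in> A \<rightarrow>\<^sub>E {..<T}" for e
      by (rule monomials_independent[where e = "\<lambda>e. e", OF assms(2) fin(2) _ P0 that])
         (rule PiE_ext)
    with c show False by blast
  qed
  moreover have "P (\<lambda>a. g a x) = 0" for x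
  proof -
    have "P (\<lambda>a. g a x) = (\<Sum>e\<in>A \<rightarrow>\<^sub>E {..<T}. \<Sum>f\<in>I \<rightarrow>\<^sub>E {..D}. c e * M e f * (\<Prod>i\<in>I. x i ^ f i))"
      unfolding P_def by (intro sum.cong refl) (simp add: M sum_distrib_left mult.assoc)
    also have "\<dots> = (\<Sum>f\<in>I \<rightarrow>\<^sub>E {..D}. (\<Sum>e\<in>A \<rightarrow>\<^sub>E {..<T}. c e * M e f) * (\<Prod>i\<in>I. x i ^ f i))"
      by (subst sum.swap) (simp add: sum_distrib_right)
    finally show ?thesis using c by simp
  qed
  ultimately show thesis using that by blast
qed

text \<open>Independence of the restrictions of the \<open>g a\<close> to \<open>Y\<close>; for
  polynomial functions and \<open>Y = UNIV\<close> this is the usual notion. A relation is trivial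
  if it is zero as a function, which over the complex numbers means that it is the zero
  polynomial.\<close>

definition alg_indep :: "'a set \<Rightarrow> ('a \<Rightarrow> 'y \<Rightarrow> complex) \<Rightarrow> 'y set \<Rightarrow> bool" where
  "alg_indep A g Y \<longleftrightarrow>
     (\<forall>P. pfn A P \<longrightarrow> (\<forall>y\<in>Y. P (\<lambda>a. g a y) = 0) \<longrightarrow> (\<forall>z. P z = 0))"

lemma alg_indepD:
  "alg_indep A g Y \<Longrightarrow> pfn A P \<Longrightarrow> (\<And>y. y \<in> Y \<Longrightarrow> P (\<lambda>a. g a y) = 0) \<Longrightarrow> P z = 0"
  unfolding alg_indep_def by blast

lemma card_alg_indep_le:
  assumes "alg_indep A g UNIV" "finite I" "finite A" "\<And>a. a \<in> A \<Longrightarrow> pfn I (g a)"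
  shows "card A \<le> card I"
  using assms algebraically_dependent[of I A g] unfolding alg_indep_def by (metis not_le)

text \<open>By the chain rule, a relation \<open>P\<close> among the \<open>f c\<close> yields a
  linear relation among their gradients, whose coefficients are the partial derivatives of
  \<open>P\<close> at \<open>f\<close>. Where the gradients are independent these coefficients
  vanish, hence everywhere by density. So the derivatives of \<open>P\<close> are relations of
  smaller degree, and are zero by induction; then \<open>P\<close> is constant.\<close>

lemma alg_indep_if_gradients_indep:
  assumes "finite I" "finite C" "\<And>c. c \<in> C \<Longrightarrow> pfn I (f c)"
    and "lin_indep I (\<lambda>c k. pd k (f c) x0) C"
  shows "alg_indep C f UNIV"
proof -
  obtain h where h: "pfn I h" "h x0 \<noteq> 0"
    "\<And>x. h x \<noteq> 0 \<Longrightarrow> lin_indep I (\<lambda>c k. pd k (f c) x) C"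
    by (rule lin_indep_open[where v = "\<lambda>c k. pd k (f c)", OF assms(2) _ assms(4)])
       (auto intro: pfn_pd assms(3))
  have "P z = 0" if "polyf C n P" "\<And>x. P (\<lambda>c. f c x) = 0" for P n z
    using that
  proof (induction n arbitrary: P z)
    case 0
    then have "pfn C P" by (auto simp: pfn_def)
    moreover have "pd c P x = 0" for c x using polyf_pd[OF 0(1)] by blast
    ultimately show ?case using pd_all_0_imp_const[OF _ assms(2), of P z] 0(2) by metis
  next
    case (Suc n)
    have P: "pfn C P" using Suc.prems by (auto simp: pfn_def)
    have dP: "pd c P z = 0" if c: "c \<in> C" for c z
    proof -
      have "pd c P (\<lambda>c. f c x) = 0" for x
      proof (rule pfn_integral_domain[where g = "\<lambda>x. pd c P (\<lambda>c. f c x)", OF h(1) _ h(2)])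
        show "pfn I (\<lambda>x. pd c P (\<lambda>c. f c x))" using pfn_pd[OF P] assms(3) by (rule pfn_compose)
        fix x assume "h x \<noteq> 0"
        have "(\<Sum>c\<in>C. pd c P (\<lambda>c. f c x) * pd k (f c) x) = 0" for k
        proof -
          have "(\<Sum>c\<in>C. pd c P (\<lambda>c. f c x) * pd k (f c) x) = pd k (\<lambda>x. P (\<lambda>c. f c x)) x"
            by (rule pd_compose[OF P assms(2,3), symmetric])
          then show ?thesis by (simp add: Suc.prems(2))
        qed
        then show "pd c P (\<lambda>c. f c x) = 0"
          using lin_indepD[OF h(3)[OF \<open>h x \<noteq> 0\<close>], of "\<lambda>c. pd c P (\<lambda>c. f c x)"] c by simp
      qed
      moreover have "polyf C n (pd c P)" using polyf_pd[OF Suc.prems(1), of c] by simp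
      ultimately show ?thesis using Suc.IH by blast
    qed
    have "P z = P (\<lambda>c. f c undefined)"
      by (rule pd_all_0_imp_const[OF P assms(2)]) (rule dP)
    then show ?case by (simp add: Suc.prems(2))
  qed
  then show ?thesis unfolding alg_indep_def pfn_def by auto
qed

text \<open>Complete the \<open>f c\<close> by coordinates \<open>x\<^sub>j\<close>, \<open>j \<in> J\<close>, to a maximal algebraically independent family.
  Differentiating relations of minimal degree for the other coordinates shows that the gradients of
  this family span the whole space.\<close>

lemma gradients_indep_if_alg_indep:
  fixes I :: "'k set" and C :: "'c set"
  assumes "finite I" "finite C" "\<And>c. c \<in> C \<Longrightarrow> pfn I (f c)" "alg_indep C f UNIV"
  shows "\<exists>x. lin_indep I (\<lambda>c k. pd k (f c) x) C"
proof -
  \<comment> \<open>The index type \<open>'c + 'k\<close> holds the given functions on the left and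
    the coordinate functions on the right.\<close>
  define F where "F = case_sum f (\<lambda>i x. x i)"
  define S :: "'k set \<Rightarrow> ('c + 'k) set" where "S = (\<lambda>J. Inl ` C \<union> Inr ` J)"
  have pfn_F: "pfn I (F a)" if "a \<in> S J" "J \<subseteq> I" for a J
    using that assms(3) pfn_var[of _ I] by (auto simp: F_def S_def)
  have fin_S: "finite (S J)" if "J \<subseteq> I" for J
    using that assms(1,2) finite_subset by (auto simp: S_def)
  have "alg_indep (S {}) F UNIV"
    unfolding alg_indep_def
  proof (intro allI impI)
    fix P and z :: "'c + 'k \<Rightarrow> complex" assume P: "pfn (S {}) P" "\<forall>y\<in>UNIV. P (\<lambda>a. F a y) = 0"
    have "pfn C (\<lambda>y. P (\<lambda>a. case a of Inl c \<Rightarrow> y c | Inr i \<Rightarrow> 0))"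
      by (rule pfn_compose[OF P(1)]) (auto simp: S_def)
    moreover have "P (\<lambda>a. case a of Inl c \<Rightarrow> f c y | Inr i \<Rightarrow> 0) = P (\<lambda>a. F a y)" for y
      by (rule pfn_depends[OF P(1)]) (auto simp: S_def F_def)
    ultimately have "P (\<lambda>a. case a of Inl c \<Rightarrow> z (Inl c) | Inr i \<Rightarrow> 0) = 0"
      using alg_indepD[OF assms(4), of "\<lambda>y. P (\<lambda>a. case a of Inl c \<Rightarrow> y c | Inr i \<Rightarrow> 0)" "\<lambda>c. z (Inl
          c)"] P(2)
      by simp
    also have "P (\<lambda>a. case a of Inl c \<Rightarrow> z (Inl c) | Inr i \<Rightarrow> 0) = P z"
      by (rule pfn_depends[OF P(1)]) (auto simp: S_def)
    finally show "P z = 0" .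
  qed
  then have ex: "{} \<subseteq> I \<and> alg_indep (S {}) F UNIV" by simp
  have "\<exists>J. (J \<subseteq> I \<and> alg_indep (S J) F UNIV) \<and>
      (\<forall>J'. J' \<subseteq> I \<and> alg_indep (S J') F UNIV \<longrightarrow> card J' \<le> card J)"
    by (rule ex_has_greatest_nat[where P = "\<lambda>J. J \<subseteq> I \<and> alg_indep (S J) F UNIV" and b = "Suc (card
        I)", OF ex])
       (use assms(1) in \<open>auto intro!: card_mono le_imp_less_Suc\<close>)
  then obtain J where J: "J \<subseteq> I" "alg_indep (S J) F UNIV"
    "\<And>J'. J' \<subseteq> I \<Longrightarrow> alg_indep (S J') F UNIV \<Longrightarrow> card J' \<le> card J" by blast
  have fJ: "finite J" using J(1) assms(1) finite_subset by blast
  have card_SJ: "card (S J) \<le> card I"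
    using card_alg_indep_le[OF J(2) assms(1) fin_S[OF J(1)]] pfn_F J(1) by blast
  \<comment> \<open>The pair \<open>p\<close> comes from a differentiated relation: its first part
    is the coefficient of the \<open>i\<close>-th unit vector, its second part the coefficients of
    the gradients of the family.\<close>
  have "\<forall>i\<in>I - J. \<exists>p. pfn I (fst p) \<and> (\<exists>x. fst p x \<noteq> 0) \<and> (\<forall>x. \<forall>k\<in>I.
      (\<Sum>a\<in>S J. snd p a x * pd k (F a) x) + (if k = i then fst p x else 0) = 0)"
  proof
    fix i assume i: "i \<in> I - J"
    let ?S = "S (insert i J)"
    have sub: "insert i J \<subseteq> I" using i J by auto
    have "\<not> alg_indep ?S F UNIV"
      using J(3)[OF sub] i fJ by auto
    then have "\<exists>n P. polyf ?S n P \<and> (\<forall>x. P (\<lambda>a. F a x) = 0) \<and> (\<exists>z. P z \<noteq> 0)"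
      by (auto simp: alg_indep_def pfn_def)
    \<comment> \<open>The derivative of \<open>P\<close> by the new variable has smaller degree; by
      minimality of \<open>n\<close> it cannot vanish on the family without being zero.\<close>
    then obtain n where "\<exists>P. polyf ?S n P \<and> (\<forall>x. P (\<lambda>a. F a x) = 0) \<and> (\<exists>z. P z \<noteq> 0)"
      and min: "\<And>n'. n' < n \<Longrightarrow> \<not> (\<exists>P. polyf ?S n' P \<and> (\<forall>x. P (\<lambda>a. F a x) = 0) \<and> (\<exists>z. P z \<noteq> 0))"
      using exists_least_iff[of "\<lambda>n. \<exists>P. polyf ?S n P \<and> (\<forall>x. P (\<lambda>a. F a x) = 0) \<and> (\<exists>z. P z \<noteq> 0)"]
      by blast
    then obtain P z where P: "polyf ?S n P" "\<And>x. P (\<lambda>a. F a x) = 0" "P z \<noteq> 0" by blast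
    have pP: "pfn ?S P" using P(1) by (auto simp: pfn_def)
    have nz: "\<exists>y. pd (Inr i) P y \<noteq> 0"
    proof (rule ccontr)
      assume "\<not> ?thesis"
      then have upd: "P (y(Inr i := 0)) = P y" for y
        using pd_eq_0_imp_update[OF pP] by blast
      \<comment> \<open>A relation that does not involve the new variable would be one among the
        family indexed by \<open>S J\<close>, which is independent.\<close>
      have "pfn (S J) (\<lambda>y. P (\<lambda>a. (if a = Inr i then (\<lambda>y. 0) else (\<lambda>y. y a)) y))"
        by (rule pfn_compose[OF pP]) (auto simp: S_def)
      moreover have "(\<lambda>y. P (\<lambda>a. (if a = Inr i then (\<lambda>y. 0) else (\<lambda>y. y a)) y)) = P"
      proof
        fix y :: "'c + 'k \<Rightarrow> complex"
        have "(\<lambda>a. (if a = Inr i then (\<lambda>y. 0) else (\<lambda>y. y a)) y) = y(Inr i := 0)" by auto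
        then show "P (\<lambda>a. (if a = Inr i then (\<lambda>y. 0) else (\<lambda>y. y a)) y) = P y"
          by (simp only: upd)
      qed
      ultimately have "pfn (S J) P" by (simp only:)
      then show False using alg_indepD[OF J(2), of P z] P by blast
    qed
    then have "n \<noteq> 0" using polyf_pd[OF P(1)] by auto
    then have nz': "\<exists>x. pd (Inr i) P (\<lambda>a. F a x) \<noteq> 0"
      using min[of "n - 1"] polyf_pd[OF P(1)] nz by auto
    have "(\<Sum>a\<in>S J. pd a P (\<lambda>a. F a x) * pd k (F a) x) + (if k = i then pd (Inr i) P (\<lambda>a. F a x) else
        0) = 0" for x k
    proof -
      have "0 = pd k (\<lambda>x. P (\<lambda>a. F a x)) x" using P(2) by simp
      also have "\<dots> = (\<Sum>a\<in>?S. pd a P (\<lambda>a. F a x) * pd k (F a) x)"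
        by (rule pd_compose[OF pP fin_S[OF sub]]) (use pfn_F sub in blast)
      also have "?S = insert (Inr i) (S J)" by (auto simp: S_def)
      also have "(\<Sum>a\<in>insert (Inr i) (S J). pd a P (\<lambda>a. F a x) * pd k (F a) x)
          = pd (Inr i) P (\<lambda>a. F a x) * pd k (F (Inr i)) x + (\<Sum>a\<in>S J. pd a P (\<lambda>a. F a x) * pd k (F a) x)"
        using i fin_S[OF J(1)] by (intro sum.insert) (auto simp: S_def)
      finally show ?thesis by (simp add: F_def add.commute split: if_splits)
    qed
    moreover have "pfn I (\<lambda>x. pd (Inr i) P (\<lambda>a. F a x))"
      by (rule pfn_compose[OF pfn_pd[OF pP]]) (use pfn_F sub in blast)
    ultimately show "\<exists>p. pfn I (fst p) \<and> (\<exists>x. fst p x \<noteq> 0) \<and> (\<forall>x. \<forall>k\<in>I.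
        (\<Sum>a\<in>S J. snd p a x * pd k (F a) x) + (if k = i then fst p x else 0) = 0)" using nz'
      by (intro exI[of _ "(\<lambda>x. pd (Inr i) P (\<lambda>a. F a x), \<lambda>a x. pd a P (\<lambda>a. F a x))"])
         (simp only: fst_conv snd_conv, blast)
  qed
  from bchoice[OF this] obtain p where p: "\<forall>i\<in>I - J. pfn I (fst (p i)) \<and> (\<exists>x. fst (p i) x \<noteq> 0) \<and>
      (\<forall>x. \<forall>k\<in>I. (\<Sum>a\<in>S J. snd (p i) a x * pd k (F a) x) + (if k = i then fst (p i) x else 0) = 0)"
    by (rule exE)
  define G where "G = (\<lambda>i. fst (p i))"
  define T where "T = (\<lambda>i. snd (p i))"
  have G: "\<And>i. i \<in> I - J \<Longrightarrow> pfn I (G i)" "\<And>i. i \<in> I - J \<Longrightarrow> \<exists>x. G i x \<noteq> 0"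
    and T: "\<And>i x k. i \<in> I - J \<Longrightarrow> k \<in> I \<Longrightarrow> (\<Sum>a\<in>S J. T i a x * pd k (F a) x) + (if k = i then G i x else
        0) = 0"
    using p unfolding G_def T_def by blast+
  obtain x where x: "\<And>i. i \<in> I - J \<Longrightarrow> G i x \<noteq> 0"
    using pfn_common_nonzero_family[of "I - J" I G] G assms(1) by blast
  have units: "(if k = i then 1 else 0) = (\<Sum>a\<in>S J. (if i \<in> J then if a = Inr i then 1 else 0 else -
      T i a x / G i x) * pd k (F a) x)"
    if "i \<in> I" "k \<in> I" for i k
  proof (cases "i \<in> J")
    case True
    then have "Inr i \<in> S J" by (simp add: S_def)
    then show ?thesis using True fin_S[OF J(1)]
      by (simp add: if_distrib[of "\<lambda>z. z * _"] sum.delta F_def cong: if_cong)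
  next
    case False
    with that have i: "i \<in> I - J" by simp
    have "(\<Sum>a\<in>S J. - T i a x / G i x * pd k (F a) x) = - (\<Sum>a\<in>S J. T i a x * pd k (F a) x) / G i x"
      by (simp add: sum_negf sum_divide_distrib)
    also have "(\<Sum>a\<in>S J. T i a x * pd k (F a) x) = - (if k = i then G i x else 0)"
      using T[OF i that(2), of x] by (simp add: add_eq_0_iff2)
    finally show ?thesis using False x[OF i] by simp
  qed
  \<comment> \<open>The gradients of the family at \<open>x\<close> span all unit vectors, so at
    least \<open>card I\<close> of them are independent; as \<open>S J\<close> has at most
    \<open>card I\<close> elements, all of them are.\<close>
  have "lin_indep I (\<lambda>a k. pd k (F a) x) (S J)"
  proof -
    obtain D U where D: "D \<subseteq> S J" "lin_indep I (\<lambda>a k. pd k (F a) x) D"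
      "\<And>a k. a \<in> S J \<Longrightarrow> k \<in> I \<Longrightarrow> pd k (F a) x = (\<Sum>b\<in>D. U a b * pd k (F b) x)"
      by (rule maximal_lin_indep_spans[OF fin_S[OF J(1)], of I "\<lambda>a k. pd k (F a) x"]) (rule that)
    have fD: "finite D" using D(1) fin_S[OF J(1)] finite_subset by blast
    let ?t = "\<lambda>i a. if i \<in> J then if a = Inr i then 1 else 0 else - T i a x / G i x"
    have "card I \<le> card D"
    proof (rule card_lin_indep_le[of I "\<lambda>i k. if k = i then 1 else 0"])
      show "lin_indep I (\<lambda>i k. if k = i then 1 else 0) I"
        using assms(1) by (simp add: lin_indep_def if_distrib[of "\<lambda>z. _ * z"] sum.delta cong: if_cong)
      fix i k assume "i \<in> I" "k \<in> I"
      then have "(if k = i then 1 else 0) = (\<Sum>a\<in>S J. \<Sum>b\<in>D. ?t i a * U a b * pd k (F b) x)"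
        by (subst units) (auto intro!: sum.cong simp: D(3) sum_distrib_left mult.assoc)
      also have "\<dots> = (\<Sum>b\<in>D. (\<Sum>a\<in>S J. ?t i a * U a b) * pd k (F b) x)"
        by (subst sum.swap) (simp add: sum_distrib_right)
      finally show "(if k = i then 1 else 0) = \<dots>" .
    qed (use assms fD in auto)
    then have "D = S J" using D(1) card_SJ fin_S[OF J(1)] by (intro card_seteq) auto
    with D(2) show ?thesis by simp
  qed
  then have L: "lin_indep I (\<lambda>a k. pd k (F a) x) (Inl ` C)"
    by (rule lin_indep_subset) (use fin_S J in \<open>auto simp: S_def\<close>)
  have "lin_indep I (\<lambda>c k. pd k (f c) x) C"
    unfolding lin_indep_def
  proof (intro allI impI ballI)
    fix l c assume l: "\<forall>k\<in>I. (\<Sum>c\<in>C. l c * pd k (f c) x) = 0" and c: "c \<in> C"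
    have "(\<Sum>c\<in>Inl ` C. case_sum l (\<lambda>_. 0) c * pd k (F c) x) = (\<Sum>c\<in>C. l c * pd k (f c) x)" for k
      by (subst sum.reindex) (auto simp: F_def)
    then show "l c = 0"
      using lin_indepD[OF L, of "case_sum l (\<lambda>_. 0)" "Inl c"] l c by simp
  qed
  then show ?thesis by blast
qed

text \<open>A relation between the \<open>g a\<close> and \<open>f\<close> on \<open>Y'\<close> yields one between the \<open>g a\<close> on \<open>Y\<close> by setting
  \<open>f = 0\<close>. So it is divisible by \<open>f\<close>, which can be cancelled on \<open>Y'\<close>.\<close>

lemma alg_indep_insert:
  assumes "alg_indep A g Y" "a \<notin> A" "Y \<subseteq> Y'" "\<And>y. y \<in> Y \<Longrightarrow> f y = 0"
    and "\<And>P. pfn (insert a A) P \<Longrightarrow> (\<And>y. y \<in> Y' \<Longrightarrow> f y * P (\<lambda>b. (g(a := f)) b y) = 0) \<Longrightarrow>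
      (\<And>y. y \<in> Y' \<Longrightarrow> P (\<lambda>b. (g(a := f)) b y) = 0)"
  shows "alg_indep (insert a A) (g(a := f)) Y'"
proof -
  \<comment> \<open>Division of \<open>P\<close> by the variable \<open>a\<close>: the remainder
    does not involve \<open>a\<close>, and the quotient loses one degree. At \<open>n = 0\<close>
    the quotient is zero, which ends the descent.\<close>
  have split: "\<exists>P'. polyf (insert a A) (n - 1) P' \<and> (\<forall>z. P z = P (z(a := 0)) + z a * P' z) \<and>
      (n = 0 \<longrightarrow> (\<forall>z. P' z = 0))" if "polyf (insert a A) n P" for n P
    using that
  proof induction
    case (polyf_const n c)
    show ?case by (intro exI[of _ "\<lambda>_. 0"]) (auto intro: polyf.intros)
  next
    case (polyf_var_mult i n h)
    then obtain P' where P': "polyf (insert a A) (n - 1) P'" "\<And>z. h z = h (z(a := 0)) + z a * P' z"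
      "n = 0 \<longrightarrow> (\<forall>z. P' z = 0)" by blast
    show ?case
    proof (cases "i = a")
      case True
      with polyf_var_mult show ?thesis by (intro exI[of _ h]) auto
    next
      case False
      have "polyf (insert a A) n (\<lambda>z. z i * P' z)"
      proof (cases n)
        case 0
        with P'(3) show ?thesis by (auto intro: polyf.intros)
      next
        case (Suc k)
        with P'(1) polyf_var_mult(1) show ?thesis by (auto intro: polyf.intros)
      qed
      then have 1: "polyf (insert a A) (Suc n - 1) (\<lambda>z. z i * P' z)" by simp
      have 2: "z i * h z = (z(a := 0)) i * h (z(a := 0)) + z a * (z i * P' z)" for z
        using False by (subst P'(2)) (simp add: algebra_simps)
      show ?thesis by (intro exI[of _ "\<lambda>z. z i * P' z"] conjI allI impI 1 2) simp
    qed
  next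
    case (polyf_add n h k)
    then obtain P' Q' where P': "polyf (insert a A) (n - 1) P'" "\<And>z. h z = h (z(a := 0)) + z a * P' z"
      "n = 0 \<longrightarrow> (\<forall>z. P' z = 0)"
      and Q': "polyf (insert a A) (n - 1) Q'" "\<And>z. k z = k (z(a := 0)) + z a * Q' z"
      "n = 0 \<longrightarrow> (\<forall>z. Q' z = 0)" by blast
    have "h z + k z = h (z(a := 0)) + k (z(a := 0)) + z a * (P' z + Q' z)" for z
      by (subst P'(2), subst Q'(2)) (simp add: algebra_simps)
    note 2 = this
    have 1: "polyf (insert a A) (n - 1) (\<lambda>z. P' z + Q' z)"
      using P'(1) Q'(1) by (rule polyf.polyf_add)
    show ?case
      by (intro exI[of _ "\<lambda>z. P' z + Q' z"] conjI allI impI 1 2) (use P'(3) Q'(3) in simp)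
  qed
  have "P z = 0" if "polyf (insert a A) n P" "\<And>y. y \<in> Y' \<Longrightarrow> P (\<lambda>b. (g(a := f)) b y) = 0" for n P z
    using that
  proof (induction n arbitrary: P z rule: less_induct)
    case (less n)
    obtain P' where P': "polyf (insert a A) (n - 1) P'" "\<And>z. P z = P (z(a := 0)) + z a * P' z"
      "n = 0 \<Longrightarrow> P' z = 0" using split[OF less.prems(1)] by blast
    have 0: "P (z(a := 0)) = 0" for z
    proof -
      have pP: "pfn (insert a A) P" using less.prems by (auto simp: pfn_def)
      have eq: "(\<lambda>b. (if b = a then (\<lambda>y. 0) else (\<lambda>y. y b)) y) = y(a := 0)" for y :: "_ \<Rightarrow> complex"
          by auto
      have "pfn A (\<lambda>y. P (\<lambda>b. (if b = a then (\<lambda>y. 0) else (\<lambda>y. y b)) y))"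
        by (rule pfn_compose[OF pP]) auto
      then have "pfn A (\<lambda>y. P (y(a := 0)))" unfolding eq .
      moreover have "P ((\<lambda>b. g b y)(a := 0)) = 0" if "y \<in> Y" for y
      proof -
        have "(\<lambda>b. g b y)(a := 0) = (\<lambda>b. (g(a := f)) b y)" using assms(4)[OF that] by auto
        then show ?thesis using less.prems(2) that assms(3) by auto
      qed
      ultimately show ?thesis by (rule alg_indepD[OF assms(1)])
    qed
    have "P' z = 0"
    proof (cases "n = 0")
      case False
      have "f y * P' (\<lambda>b. (g(a := f)) b y) = 0" if "y \<in> Y'" for y
        using P'(2)[of "\<lambda>b. (g(a := f)) b y"] less.prems(2)[OF that] 0 by simp
      then have "P' (\<lambda>b. (g(a := f)) b y) = 0" if "y \<in> Y'" for y
        using assms(5)[of P'] P'(1) that by (auto simp: pfn_def)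
      then show ?thesis using less.IH[of "n - 1" P'] P'(1) False by simp
    qed (use P'(3) in simp)
    then show ?case using P'(2)[of z] 0 by simp
  qed
  then show ?thesis unfolding alg_indep_def pfn_def by blast
qed


section \<open>Evaluation of polynomials\<close>

abbreviation lookup :: "('a \<Rightarrow>\<^sub>0 'b::zero) \<Rightarrow> 'a \<Rightarrow> 'b" where
  "lookup \<equiv> Poly_Mapping.lookup"

abbreviation keys :: "('a \<Rightarrow>\<^sub>0 'b::zero) \<Rightarrow> 'a set" where
  "keys \<equiv> Poly_Mapping.keys"

abbreviation single :: "'a \<Rightarrow> 'b::zero \<Rightarrow> 'a \<Rightarrow>\<^sub>0 'b" where
  "single \<equiv> Poly_Mapping.single"

definition monom_eval :: "('i \<Rightarrow>\<^sub>0 nat) \<Rightarrow> ('i \<Rightarrow> complex) \<Rightarrow> complex" where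
  "monom_eval m x = (\<Prod>v\<in>keys m. x v ^ lookup m v)"

lemma monom_eval_superset:
  assumes "finite V" "keys m \<subseteq> V"
  shows "monom_eval m x = (\<Prod>v\<in>V. x v ^ lookup m v)"
  unfolding monom_eval_def using assms
  by (intro prod.mono_neutral_left) (auto simp: in_keys_iff)

lemma monom_eval_add: "monom_eval (m + m') x = monom_eval m x * monom_eval m' x"
proof -
  let ?V = "keys m \<union> keys m'"
  have "keys (m + m') \<subseteq> ?V" by (rule Poly_Mapping.keys_add)
  then show ?thesis
    by (simp add: monom_eval_superset[of ?V] lookup_add power_add prod.distrib)
qed

lemma monom_eval_0 [simp]: "monom_eval 0 x = 1"
  by (simp add: monom_eval_def)

lemma monom_eval_single [simp]: "monom_eval (single v k) x = x v ^ k"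
  by (cases "k = 0") (simp_all add: monom_eval_def)

lemma monom_eval_UNIV: "monom_eval m x = (\<Prod>v\<in>UNIV. x v ^ lookup m v)"
  for m :: "'v::finite \<Rightarrow>\<^sub>0 nat"
  by (rule monom_eval_superset) auto

lemma peval_superset:
  assumes "finite S" "keys p \<subseteq> S"
  shows "peval p x = (\<Sum>m\<in>S. lookup p m * monom_eval m x)"
  unfolding peval_def monom_eval_def using assms
  by (intro sum.mono_neutral_left) (auto simp: in_keys_iff)

lemma peval_0 [simp]: "peval 0 x = 0"
  by (simp add: peval_def)

lemma peval_single [simp]: "peval (single m c) x = c * monom_eval m x"
  by (cases "c = 0") (simp_all add: peval_def monom_eval_def)

lemma peval_1 [simp]: "peval 1 x = 1"
  using peval_single[of 0 1 x] by (simp del: peval_single)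

lemma peval_add: "peval (p + q) x = peval p x + peval q x"
proof -
  let ?S = "keys p \<union> keys q"
  have "keys (p + q) \<subseteq> ?S" by (rule Poly_Mapping.keys_add)
  then show ?thesis
    by (simp add: peval_superset[of ?S] lookup_add distrib_right sum.distrib)
qed

lemma peval_sum: "peval (\<Sum>a\<in>A. p a) x = (\<Sum>a\<in>A. peval (p a) x)"
  by (induction A rule: infinite_finite_induct) (auto simp: peval_add)

lemma peval_pscale: "peval (pscale c p) x = c * peval p x"
proof -
  have "keys (pscale c p) \<subseteq> keys p" by (auto simp: in_keys_iff)
  then show ?thesis
    by (simp add: peval_superset[of "keys p"] sum_distrib_left mult.assoc)
qed

lemma sum_single_lookup:
  assumes "finite S" "keys p \<subseteq> S"
  shows "(\<Sum>m\<in>S. single m (lookup p m)) = p"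
proof (rule poly_mapping_eqI)
  fix k
  have "(\<Sum>m\<in>S. lookup (single m (lookup p m)) k)
      = (\<Sum>m\<in>S. if m = k then lookup p k else 0)"
    by (intro sum.cong) (auto simp: lookup_single when_def)
  then show "lookup (\<Sum>m\<in>S. single m (lookup p m)) k
      = lookup p k"
    using assms by (auto simp: lookup_sum in_keys_iff)
qed

lemma peval_mult: "peval (p * q) x = peval p x * peval q x"
proof -
  have "peval (p * q) x = peval ((\<Sum>m\<in>keys p. single m (lookup p m)) *
      (\<Sum>m\<in>keys q. single m (lookup q m))) x"
    by (simp add: sum_single_lookup)
  also have "\<dots> = (\<Sum>m\<in>keys p. \<Sum>m'\<in>keys q.
      (lookup p m * monom_eval m x) * (lookup q m' * monom_eval m' x))"
    by (simp add: sum_product peval_sum mult_single monom_eval_add mult_ac)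
  also have "\<dots> = peval p x * peval q x"
    by (simp add: sum_product[symmetric] peval_superset[OF finite_keys subset_refl])
  finally show ?thesis .
qed

lemma pfn_peval: "pfn UNIV (peval p)"
proof -
  have "peval p = (\<lambda>x. \<Sum>m\<in>keys p. lookup p m *
      (\<Prod>v\<in>keys m. x v ^ lookup m v))" (is "_ = ?f")
    by (intro ext) (simp add: peval_def)
  moreover have "pfn UNIV ?f" by (intro pfn_sum pfn_mult pfn_prod pfn_power pfn_const pfn_var UNIV_I)
  ultimately show ?thesis by (simp only:)
qed

text \<open>Together with \<open>pfn_peval\<close> this matches polynomial functions with the
  elements of \<open>mpoly\<close> that define the Zariski topology.\<close>

lemma pfn_imp_peval: "pfn I f \<Longrightarrow> \<exists>p. \<forall>x. f x = peval p x"
proof (induction rule: pfn_induct)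
  case (const c)
  show ?case by (intro exI[of _ "single 0 c"]) simp
next
  case (var_mult i g)
  then obtain p where "\<forall>x. g x = peval p x" by blast
  then show ?case
    by (intro exI[of _ "single (single i 1) 1 * p"]) (simp add: peval_mult)
next
  case (add f g)
  then obtain p q where "\<forall>x. f x = peval p x" "\<forall>x. g x = peval q x" by blast
  then show ?case by (intro exI[of _ "p + q"]) (simp add: peval_add)
qed

lemma openin_zariski_principal:
  assumes "pfn I f" shows "openin (zariski X c) {x \<in> X. f (c x) \<noteq> 0}"
proof -
  obtain p where "\<forall>x. f x = peval p x" using pfn_imp_peval[OF assms] by blast
  then show ?thesis unfolding zariski_def by (auto intro!: topology_generated_by_Basis)
qed

text \<open>Multiplying polynomials intersects their principal open sets, so the generating sets
  already form a base.\<close>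

lemma openin_zariski_base:
  assumes "openin (zariski X c) W" "b \<in> W"
  shows "\<exists>p. peval p (c b) \<noteq> 0 \<and> (\<forall>x\<in>X. peval p (c x) \<noteq> 0 \<longrightarrow> x \<in> W)"
proof -
  have "generate_topology_on (range (\<lambda>f. {x \<in> X. peval f (c x) \<noteq> 0})) W"
    using assms(1) unfolding zariski_def by (rule openin_topology_generated_by)
  then show ?thesis using assms(2)
  proof induction
    case (Int V W)
    then obtain p q where "peval p (c b) \<noteq> 0" "\<forall>x\<in>X. peval p (c x) \<noteq> 0 \<longrightarrow> x \<in> V"
      "peval q (c b) \<noteq> 0" "\<forall>x\<in>X. peval q (c x) \<noteq> 0 \<longrightarrow> x \<in> W" by blast
    then show ?case by (intro exI[of _ "p * q"]) (auto simp: peval_mult)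
  next
    case (UN K)
    then obtain V where "V \<in> K" "b \<in> V" by blast
    with UN.IH[of V] show ?case by blast
  next
    case (Basis V)
    then show ?case by auto
  qed auto
qed


section \<open>Forms and frames\<close>

definition monomials :: "nat \<Rightarrow> ('v::finite \<Rightarrow>\<^sub>0 nat) set" where
  "monomials d = {m. (\<Sum>v\<in>UNIV. lookup m v) = d}"

lemma finite_monomials [simp]: "finite (monomials d :: ('v::finite \<Rightarrow>\<^sub>0 nat) set)"
proof -
  have "lookup ` (monomials d :: ('v \<Rightarrow>\<^sub>0 nat) set) \<subseteq> UNIV \<rightarrow>\<^sub>E {..d}"
    by (auto simp: monomials_def intro!: member_le_sum)
  moreover have "finite (UNIV \<rightarrow>\<^sub>E {..d} :: ('v \<Rightarrow> nat) set)" by (intro finite_PiE) auto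
  ultimately have "finite (lookup ` (monomials d :: ('v \<Rightarrow>\<^sub>0 nat) set))"
    by (rule finite_subset)
  then show ?thesis
    by (rule finite_imageD) (rule inj_onI, rule poly_mapping_eqI, rule fun_cong)
qed

lemma forms_iff: "p \<in> forms d \<longleftrightarrow> keys p \<subseteq> monomials d"
  by (auto simp: forms_def monomials_def)

lemma lookup_form_eq_0: "p \<in> forms d \<Longrightarrow> m \<notin> monomials d \<Longrightarrow> lookup p m = 0"
  by (meson forms_iff in_keys_iff subsetD)

lemma form_eqI:
  assumes "p \<in> forms d" "q \<in> forms d"
    "\<And>m. m \<in> monomials d \<Longrightarrow> lookup p m = lookup q m"
  shows "p = q"
  by (rule poly_mapping_eqI) (metis assms lookup_form_eq_0)

lemma subspace_forms: "mp.subspace (forms d :: 'v::finite mpoly set)"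
proof (rule mp.subspaceI)
  fix p q :: "'v mpoly"
  assume "p \<in> forms d" "q \<in> forms d"
  then show "p + q \<in> forms d" using Poly_Mapping.keys_add[of p q] by (auto simp: forms_def)
qed (auto simp: forms_def in_keys_iff)

lemma single_in_forms: "m \<in> monomials d \<Longrightarrow> single m c \<in> forms d"
  by (auto simp: forms_iff)

text \<open>\<open>mp.independent\<close> speaks about sets and does not see repetitions; for a
  family, injectivity has to be added.\<close>

lemma lin_indep_lookup_iff:
  fixes b :: "'c \<Rightarrow> 'v::finite mpoly"
  assumes "finite C" "\<And>c. c \<in> C \<Longrightarrow> b c \<in> forms d"
  shows "lin_indep (monomials d) (\<lambda>c. lookup (b c)) C \<longleftrightarrow>
    inj_on b C \<and> mp.independent (b ` C)"
proof
  assume L: "lin_indep (monomials d) (\<lambda>c. lookup (b c)) C"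
  have inj: "inj_on b C"
  proof (rule inj_onI, rule ccontr)
    fix c c' assume c: "c \<in> C" "c' \<in> C" "b c = b c'" "c \<noteq> c'"
    let ?l = "\<lambda>a. if a = c then 1 else if a = c' then - 1 else 0"
    have "(\<Sum>a\<in>C. ?l a * lookup (b a) m) =
        (\<Sum>a\<in>{c, c'}. ?l a * lookup (b a) m)" for m
      using c assms(1) by (intro sum.mono_neutral_right) auto
    then have "(\<Sum>a\<in>C. ?l a * lookup (b a) m) = 0" for m
      using c by simp
    then show False using lin_indepD[OF L, of ?l c] c by simp
  qed
  moreover have "mp.independent (b ` C)"
  proof
    assume "mp.dependent (b ` C)"
    then obtain u where u: "\<exists>v\<in>b ` C. u v \<noteq> 0" "(\<Sum>v\<in>b ` C. pscale (u v) v) = 0"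
      using mp.dependent_finite[of "b ` C"] assms(1) by auto
    have "(\<Sum>c\<in>C. u (b c) * lookup (b c) m) = 0" for m
    proof -
      have "0 = lookup (\<Sum>v\<in>b ` C. pscale (u v) v) m" using u by simp
      also have "\<dots> = (\<Sum>c\<in>C. u (b c) * lookup (b c) m)"
        by (subst sum.reindex[OF inj]) (simp add: lookup_sum)
      finally show ?thesis by simp
    qed
    then show False using lin_indepD[OF L, of "\<lambda>c. u (b c)"] u(1) by auto
  qed
  ultimately show "inj_on b C \<and> mp.independent (b ` C)" by blast
next
  assume ind: "inj_on b C \<and> mp.independent (b ` C)"
  show "lin_indep (monomials d) (\<lambda>c. lookup (b c)) C"
    unfolding lin_indep_def
  proof (intro allI impI ballI)
    fix l c assume l: "\<forall>m\<in>monomials d. (\<Sum>c\<in>C. l c * lookup (b c) m) = 0" and c: "c \<in> C"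
    have "(\<Sum>v\<in>b ` C. pscale (l (inv_into C b v)) v) = 0"
    proof (rule form_eqI)
      show "(\<Sum>v\<in>b ` C. pscale (l (inv_into C b v)) v) \<in> forms d"
        using assms by (auto intro!: mp.subspace_sum subspace_forms mp.subspace_scale)
      show "0 \<in> forms d" by (rule mp.subspace_0[OF subspace_forms])
      fix m :: "'v \<Rightarrow>\<^sub>0 nat" assume m: "m \<in> monomials d"
      show "lookup (\<Sum>v\<in>b ` C. pscale (l (inv_into C b v)) v) m = lookup 0 m"
        using ind l m by (subst sum.reindex) (auto simp: lookup_sum)
    qed
    then have "l (inv_into C b (b c)) = 0"
      using mp.independentD[of "b ` C" "b ` C" "\<lambda>v. l (inv_into C b v)" "b c"] ind c assms(1) by auto
    then show "l c = 0" using ind c by simp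
  qed
qed

lemma dim_forms: "mp.dim (forms d :: 'v::finite mpoly set) = card (monomials d :: ('v \<Rightarrow>\<^sub>0 nat) set)"
proof -
  let ?b = "\<lambda>m :: 'v \<Rightarrow>\<^sub>0 nat. single m (1 :: complex)"
  have "lin_indep (monomials d) (\<lambda>m. lookup (?b m)) (monomials d)"
    by (auto simp: lin_indep_def lookup_single when_def if_distrib[of "\<lambda>z. _ * z"] cong: if_cong)
  then have ind: "inj_on ?b (monomials d)" "mp.independent (?b ` monomials d)"
    using lin_indep_lookup_iff[of "monomials d" ?b d] by (auto intro: single_in_forms)
  show ?thesis
  proof (rule mp.dim_unique[of "?b ` monomials d"])
    show "forms d \<subseteq> mp.span (?b ` monomials d)"
    proof
      fix p :: "'v mpoly" assume "p \<in> forms d"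
      then have "p = (\<Sum>m\<in>monomials d. single m (lookup p m))"
        by (intro sum_single_lookup[symmetric]) (auto simp: forms_iff)
      also have "\<dots> = (\<Sum>m\<in>monomials d. pscale (lookup p m) (?b m))"
        by (intro sum.cong refl poly_mapping_eqI) (auto simp: lookup_single when_def)
      also have "\<dots> \<in> mp.span (?b ` monomials d)"
        by (intro mp.span_sum mp.span_scale mp.span_base) auto
      finally show "p \<in> mp.span (?b ` monomials d)" .
    qed
    show "card (?b ` monomials d) = card (monomials d :: ('v \<Rightarrow>\<^sub>0 nat) set)"
      by (rule card_image) (rule ind)
  qed (use ind in \<open>auto intro: single_in_forms\<close>)
qed

section \<open>Coordinates of tuples of forms and changes of frame\<close>

definition coord :: "('v::finite mpoly)^'r \<Rightarrow> 'r \<times> ('v \<Rightarrow>\<^sub>0 nat) \<Rightarrow> complex" where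
  "coord B = (\<lambda>(j, m). lookup (B $ j) m)"

definition coord_inds :: "nat \<Rightarrow> ('r::finite \<times> ('v::finite \<Rightarrow>\<^sub>0 nat)) set" where
  "coord_inds d = UNIV \<times> monomials d"

lemma finite_coord_inds [simp]: "finite (coord_inds d)"
  by (simp add: coord_inds_def)

text \<open>Coordinates outside degree \<open>d\<close> are dropped, so that every point of the
  coordinate space gives a tuple of forms.\<close>

definition of_coord :: "nat \<Rightarrow> ('r::finite \<times> ('v::finite \<Rightarrow>\<^sub>0 nat) \<Rightarrow> complex) \<Rightarrow> ('v mpoly)^'r" where
  "of_coord d y = (\<chi> j. \<Sum>m\<in>monomials d. single m (y (j, m)))"

lemma coord_of_coord: "coord (of_coord d y) (j, m) = (if m \<in> monomials d then y (j, m) else 0)"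
proof -
  have "coord (of_coord d y) (j, m) = (\<Sum>m'\<in>monomials d. if m' = m then y (j, m) else 0)"
    by (auto simp: coord_def of_coord_def lookup_sum lookup_single when_def intro!: sum.cong)
  then show ?thesis by simp
qed

lemma of_coord_forms: "of_coord d y $ j \<in> forms d"
  by (auto simp: of_coord_def intro!: mp.subspace_sum subspace_forms single_in_forms)

lemma frames_iff:
  "B \<in> frames d \<longleftrightarrow> (\<forall>j. B $ j \<in> forms d) \<and> lin_indep (monomials d) (\<lambda>j m. coord B (j, m)) UNIV"
proof (cases "\<forall>j. B $ j \<in> forms d")
  case True
  then have "lin_indep (monomials d) (\<lambda>j. lookup (B $ j)) UNIV \<longleftrightarrow>
      inj (($) B) \<and> mp.independent (range (($) B))"
    by (intro lin_indep_lookup_iff) simp_all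
  with True show ?thesis unfolding frames_def coord_def by simp
next
  case False
  then show ?thesis unfolding frames_def by blast
qed

lemma of_coord_frames_iff:
  "of_coord d y \<in> frames d \<longleftrightarrow> lin_indep (monomials d) (\<lambda>j m. y (j, m)) UNIV"
proof -
  have "lin_indep (monomials d) (\<lambda>j m. coord (of_coord d y) (j, m)) UNIV \<longleftrightarrow>
      lin_indep (monomials d) (\<lambda>j m. y (j, m)) UNIV"
    by (rule lin_indep_cong) (simp add: coord_of_coord)
  then show ?thesis by (simp add: frames_iff of_coord_forms)
qed

lemma pfn_coord_of_coord: "pfn (coord_inds d) f \<Longrightarrow> f (coord (of_coord d y)) = f y"
  by (rule pfn_depends[of "coord_inds d" f]) (auto simp: coord_inds_def coord_of_coord)

definition gspan :: "('v::finite mpoly)^'r \<Rightarrow> 'v mpoly set" where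
  "gspan B = mp.span (range (($) B))"

text \<open>The matrix may be singular; invertibility is expressed, where it matters, as
  independence of the columns \<open>\<lambda>l. g l j\<close>.\<close>

definition act :: "('v::finite mpoly)^'r \<Rightarrow> ('r \<Rightarrow> 'r \<Rightarrow> complex) \<Rightarrow> ('v mpoly)^'r::finite" where
  "act B g = (\<chi> j. \<Sum>l\<in>UNIV. pscale (g l j) (B $ l))"

lemma gspan_iff: "p \<in> gspan B \<longleftrightarrow> (\<exists>a. p = (\<Sum>l\<in>UNIV. pscale (a l) (B $ l)))"
  for B :: "('v::finite mpoly)^'r::finite"
proof
  assume "p \<in> gspan B"
  then show "\<exists>a. p = (\<Sum>l\<in>UNIV. pscale (a l) (B $ l))"
    unfolding gspan_def
  proof (induction rule: mp.span_induct_alt)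
    case base
    show ?case by (intro exI[of _ "\<lambda>_. 0"]) simp
  next
    case (step c x y)
    then obtain l a where "x = B $ l" "y = (\<Sum>l\<in>UNIV. pscale (a l) (B $ l))" by auto
    moreover have "(\<Sum>k\<in>UNIV. pscale (if k = l then c else 0) (B $ k)) = pscale c (B $ l)"
      by (subst sum.mono_neutral_right[of UNIV "{l}"]) auto
    ultimately show ?case
      by (intro exI[of _ "\<lambda>k. (if k = l then c else 0) + a k"])
         (simp add: mp.scale_left_distrib sum.distrib)
  qed
next
  assume "\<exists>a. p = (\<Sum>l\<in>UNIV. pscale (a l) (B $ l))"
  then show "p \<in> gspan B"
    unfolding gspan_def by (auto intro!: mp.span_sum mp.span_scale intro: mp.span_base)
qed

lemma coord_act: "coord (act B g) (j, m) = (\<Sum>l\<in>UNIV. g l j * coord B (l, m))"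
  by (simp add: coord_def act_def lookup_sum)

lemma act_forms: "(\<And>j. B $ j \<in> forms d) \<Longrightarrow> act B g $ j \<in> forms d"
  by (auto simp: act_def intro!: mp.subspace_sum subspace_forms mp.subspace_scale)

lemma act_frames_iff:
  assumes "B \<in> frames d"
  shows "act B g \<in> frames d \<longleftrightarrow> lin_indep UNIV (\<lambda>j l. g l j) UNIV"
proof -
  have sum: "(\<Sum>j\<in>UNIV. c j * coord (act B g) (j, m)) = (\<Sum>l\<in>UNIV. (\<Sum>j\<in>UNIV. c j * g l j) * coord B
      (l, m))" for c m
    unfolding coord_act sum_distrib_left sum_distrib_right mult.assoc by (rule sum.swap)
  have B: "lin_indep (monomials d) (\<lambda>j m. coord B (j, m)) UNIV" using assms by (simp add: frames_iff)
  have "lin_indep (monomials d) (\<lambda>j m. coord (act B g) (j, m)) UNIV \<longleftrightarrow> lin_indep UNIV (\<lambda>j l. g l j) UNIV"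
  proof
    assume L: "lin_indep (monomials d) (\<lambda>j m. coord (act B g) (j, m)) UNIV"
    show "lin_indep UNIV (\<lambda>j l. g l j) UNIV"
      unfolding lin_indep_def
    proof (intro allI impI ballI)
      fix c j assume "\<forall>l\<in>UNIV. (\<Sum>j\<in>UNIV. c j * g l j) = 0"
      then show "c j = 0" using lin_indepD[OF L, of c j] by (simp add: sum)
    qed
  next
    assume L: "lin_indep UNIV (\<lambda>j l. g l j) UNIV"
    show "lin_indep (monomials d) (\<lambda>j m. coord (act B g) (j, m)) UNIV"
      unfolding lin_indep_def
    proof (intro allI impI ballI)
      fix c j assume c: "\<forall>m\<in>monomials d. (\<Sum>j\<in>UNIV. c j * coord (act B g) (j, m)) = 0"
      have "(\<Sum>j\<in>UNIV. c j * g l j) = 0" for l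
        using lin_indepD[OF B, of "\<lambda>l. \<Sum>j\<in>UNIV. c j * g l j" l] c by (simp add: sum)
      then show "c j = 0" using lin_indepD[OF L, of c j] by simp
    qed
  qed
  then show ?thesis using assms act_forms[of B d g] by (simp add: frames_iff)
qed

text \<open>Both subspaces have dimension \<open>CARD('r)\<close>; a vector outside the smaller one
  would produce too many independent vectors.\<close>

lemma gspan_eq_if_subset:
  fixes B B' :: "('v::finite mpoly)^'r::finite"
  assumes "B \<in> frames d" "B' \<in> frames d" "gspan B \<subseteq> gspan B'"
  shows "gspan B = gspan B'"
proof (rule ccontr)
  assume "gspan B \<noteq> gspan B'"
  then obtain p where p: "p \<in> gspan B'" "p \<notin> gspan B" using assms(3) by blast
  have ind: "mp.independent (insert p (range (($) B)))"
    using p(2) assms(1) by (intro mp.independent_insertI) (auto simp: frames_def gspan_def)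
  have "range (($) B) \<subseteq> gspan B" unfolding gspan_def by (rule mp.span_superset)
  then have "insert p (range (($) B)) \<subseteq> mp.span (range (($) B'))"
    using p(1) assms(3) by (auto simp: gspan_def)
  then have "card (insert p (range (($) B))) \<le> card (range (($) B'))"
    using mp.independent_span_bound[OF _ ind] by auto
  moreover have "p \<notin> range (($) B)" using p(2) \<open>range (($) B) \<subseteq> gspan B\<close> by blast
  ultimately show False using assms(1,2) by (simp add: frames_def card_image)
qed

lemma gspan_act:
  assumes "B \<in> frames d" "act B g \<in> frames d"
  shows "gspan (act B g) = gspan B"
proof (rule gspan_eq_if_subset[OF assms(2,1)])
  have "act B g $ j \<in> gspan B" for j by (auto simp: gspan_iff act_def)
  then show "gspan (act B g) \<subseteq> gspan B"
    unfolding gspan_def[of "act B g"] by (intro mp.span_minimal) (auto simp: gspan_def)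
qed

lemma gspan_eq_imp_act:
  assumes "gspan B = gspan B'"
  obtains g where "B' = act B g"
proof -
  have "\<forall>j. \<exists>a. B' $ j = (\<Sum>l\<in>UNIV. pscale (a l) (B $ l))"
    using assms by (simp add: gspan_iff[symmetric]) (simp add: gspan_def mp.span_base)
  from choice[OF this] obtain a where "\<forall>j. B' $ j = (\<Sum>l\<in>UNIV. pscale (a j l) (B $ l))"
    by (rule exE)
  then have "B' = act B (\<lambda>l j. a j l)" by (simp add: act_def vec_eq_iff)
  then show thesis by (rule that)
qed


section \<open>The topology of the Grassmannian\<close>

lemma openin_grassmannian_iff:
  fixes W :: "'v::finite mpoly set set"
  shows "openin (grassmannian_topology TYPE('r::finite) d) W \<longleftrightarrow>
     W \<subseteq> grassmannian CARD('r) d \<and>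
     openin (zariski (frames d :: (('v mpoly)^'r) set) coord) {B \<in> frames d. gspan B \<in> W}"
proof -
  have eq: "(\<lambda>B (j, m). lookup (B $ j) m) = (coord :: ('v mpoly)^'r \<Rightarrow> _)"
    by (intro ext) (simp add: coord_def)
  have "(\<lambda>B. mp.span (range (($) B))) ` (frames d :: (('v mpoly)^'r) set) =
      (grassmannian CARD('r) d :: 'v mpoly set set)"
    using topspace_grassmannian_topology[where 'r='r and 'v='v and d=d]
    by (simp add: grassmannian_topology_def)
  then show ?thesis
    by (simp add: grassmannian_topology_def openin_quotient_topology eq gspan_def[symmetric])
qed

lemma grassmannian_eq_image:
  "(grassmannian CARD('r::finite) d :: 'v::finite mpoly set set) = gspan ` (frames d :: (('v
      mpoly)^'r) set)"
  using topspace_grassmannian_topology[where 'r='r and 'v='v and d=d]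
  by (simp add: grassmannian_topology_def gspan_def)

text \<open>The quotient map is open: the preimage of the image is the union of the translates of a
  principal open set by invertible matrices, and every translate is again principal.\<close>

lemma openin_grassmannian_principal:
  fixes f :: "('r::finite \<times> ('v::finite \<Rightarrow>\<^sub>0 nat) \<Rightarrow> complex) \<Rightarrow> complex"
  assumes "pfn I f"
  shows "openin (grassmannian_topology TYPE('r) d) (gspan ` {B \<in> frames d :: (('v mpoly)^'r) set. f
      (coord B) \<noteq> 0})"
    (is "openin _ ?W")
proof -
  let ?Z = "zariski (frames d :: (('v mpoly)^'r) set) coord"
  have "{B \<in> frames d. gspan B \<in> ?W} =
      (\<Union>g\<in>{g. lin_indep UNIV (\<lambda>j l. g l j) UNIV}. {B \<in> frames d. f (coord (act B g)) \<noteq> 0})" (is "?L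
          = ?R")
  proof (intro equalityI subsetI)
    fix B assume "B \<in> ?L"
    then obtain B' where B: "B \<in> frames d" "B' \<in> frames d" "f (coord B') \<noteq> 0" "gspan B = gspan B'"
      by auto
    obtain g where "B' = act B g" using gspan_eq_imp_act[OF B(4)] .
    with B act_frames_iff[OF B(1), of g] show "B \<in> ?R" by auto
  next
    fix B assume "B \<in> ?R"
    then obtain g where B: "B \<in> frames d" "lin_indep UNIV (\<lambda>j l. g l j) UNIV" "f (coord (act B g)) \<noteq> 0"
      by auto
    then have "act B g \<in> frames d" by (simp add: act_frames_iff)
    with B gspan_act[OF B(1) this] show "B \<in> ?L" by auto
  qed
  also have "openin ?Z \<dots>"
  proof (rule openin_Union, clarify)
    fix g :: "'r \<Rightarrow> 'r \<Rightarrow> complex"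
    let ?f = "\<lambda>y. f (\<lambda>c. (\<lambda>y. \<Sum>l\<in>UNIV. g l (fst c) * y (l, snd c)) y)"
    have "pfn UNIV ?f" by (rule pfn_compose[OF assms]) (intro pfn_sum pfn_mult pfn_const pfn_var UNIV_I)
    moreover have "?f (coord B) = f (coord (act B g))" for B
      by (rule arg_cong[of _ _ f]) (auto simp: coord_act)
    ultimately show "openin ?Z {B \<in> frames d. f (coord (act B g)) \<noteq> 0}"
      using openin_zariski_principal[of UNIV ?f "frames d" coord] by simp
  qed
  finally show ?thesis unfolding openin_grassmannian_iff grassmannian_eq_image[where 'r='r] by auto
qed

text \<open>The polynomial of a principal open set may involve coordinates of any degree. On frames
  those outside degree \<open>d\<close> are zero; replacing them by \<open>0\<close> leaves finitely
  many variables.\<close>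

lemma openin_grassmannian_base:
  fixes B :: "('v::finite mpoly)^'r::finite"
  assumes "openin (grassmannian_topology TYPE('r) d) W" "B \<in> frames d" "gspan B \<in> W"
  obtains f where "pfn (coord_inds d) f" "f (coord B) \<noteq> 0"
    "\<And>B' :: ('v mpoly)^'r. B' \<in> frames d \<Longrightarrow> f (coord B') \<noteq> 0 \<Longrightarrow> gspan B' \<in> W"
proof -
  obtain p where p: "peval p (coord B) \<noteq> 0"
    "\<And>B' :: ('v mpoly)^'r. B' \<in> frames d \<Longrightarrow> peval p (coord B') \<noteq> 0 \<Longrightarrow> gspan B' \<in> W"
    using openin_zariski_base[of "frames d" coord "{B \<in> frames d. gspan B \<in> W}" B] assms
    unfolding openin_grassmannian_iff by auto
  let ?f = "\<lambda>y. peval p (\<lambda>c. (if c \<in> coord_inds d then (\<lambda>y. y c) else (\<lambda>y. 0)) y)"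
  have "pfn (coord_inds d) ?f" by (rule pfn_compose[OF pfn_peval]) auto
  moreover have "?f (coord B') = peval p (coord B')" if "B' \<in> frames d" for B' :: "('v mpoly)^'r"
  proof (rule arg_cong[of _ _ "peval p"], rule ext)
    fix c show "(if c \<in> coord_inds d then \<lambda>y. y c else (\<lambda>y. 0)) (coord B') = coord B' c"
      using that by (cases c) (auto simp: coord_def coord_inds_def frames_def intro!: lookup_form_eq_0)
  qed
  ultimately show thesis using that[of ?f] p assms(2) by simp
qed

text \<open>Two frames of the same subspace are joined by the line through them, and nonvanishing of
  polynomials is generic on it.\<close>

lemma irreducible_closed_preimage:
  fixes F :: "'v::finite mpoly set set" and B1 B2 :: "('v mpoly)^'r::finite"
  assumes F: "irreducible_closed (grassmannian_topology TYPE('r) d) F"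
    and f: "pfn (coord_inds d) f" "B1 \<in> frames d" "gspan B1 \<in> F" "f (coord B1) \<noteq> 0"
    and h: "pfn (coord_inds d) h" "B2 \<in> frames d" "gspan B2 \<in> F" "h (coord B2) \<noteq> 0"
  obtains B :: "('v mpoly)^'r" where "B \<in> frames d" "gspan B \<in> F" "f (coord B) \<noteq> 0" "h (coord B) \<noteq> 0"
proof -
  let ?G = "grassmannian_topology TYPE('r) d :: 'v mpoly set topology"
  let ?W = "\<lambda>f. gspan ` {B \<in> frames d :: (('v mpoly)^'r) set. f (coord B) \<noteq> 0}"
  have closed: "closedin ?G (topspace ?G - ?W f)" if "pfn (coord_inds d) f" for f
    using openin_grassmannian_principal[OF that] by (rule openin_closedin_eq[THEN iffD1, THEN
        conjunct2])
  have sub: "F \<subseteq> topspace ?G" using F by (simp add: irreducible_closed_def closedin_subset)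
  have "\<not> F \<subseteq> topspace ?G - ?W f" "\<not> F \<subseteq> topspace ?G - ?W h"
    using f h by auto
  then have "\<not> F \<subseteq> (topspace ?G - ?W f) \<union> (topspace ?G - ?W h)"
    using F closed[OF f(1)] closed[OF h(1)] unfolding irreducible_closed_def by blast
  then obtain L where L: "L \<in> F" "L \<in> ?W f" "L \<in> ?W h" using sub by blast
  then obtain B B' where B: "B \<in> frames d" "f (coord B) \<noteq> 0" "gspan B = L"
    "B' \<in> frames d" "h (coord B') \<noteq> 0" "gspan B' = L" by blast
  have ind: "lin_indep (monomials d) (\<lambda>j m. coord B (j, m)) UNIV" using B(1) by (simp add: frames_iff)
  \<comment> \<open>A third condition on the line: the chosen point has to be a frame again.\<close>
  obtain k where k: "pfn (coord_inds d) k" "k (coord B) \<noteq> 0"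
    "\<And>y. k y \<noteq> 0 \<Longrightarrow> lin_indep (monomials d) (\<lambda>j m. y (j, m)) UNIV"
    using lin_indep_open[where v = "\<lambda>j m y. y (j, m)" and J = "coord_inds d" and C = UNIV, OF _ _ ind]
    by (auto simp: coord_inds_def)
  let ?y = "\<lambda>t c. coord B c + t * (coord B' c - coord B c)"
  obtain p where p: "\<forall>t. f (?y t) = poly p t"
    using pfn_line[OF f(1), of "coord B" "\<lambda>c. coord B' c - coord B c"] by (rule exE)
  obtain q where q: "\<forall>t. h (?y t) = poly q t"
    using pfn_line[OF h(1), of "coord B" "\<lambda>c. coord B' c - coord B c"] by (rule exE)
  obtain w where w: "\<forall>t. k (?y t) = poly w t"
    using pfn_line[OF k(1), of "coord B" "\<lambda>c. coord B' c - coord B c"] by (rule exE)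
  have "poly p 0 \<noteq> 0" "poly q 1 \<noteq> 0" "poly w 0 \<noteq> 0"
    using p[THEN spec, of 0] q[THEN spec, of 1] w[THEN spec, of 0] B k(2) by simp_all
  then have "p \<noteq> 0" "q \<noteq> 0" "w \<noteq> 0" by auto
  then obtain t where t: "poly p t \<noteq> 0" "poly q t \<noteq> 0" "poly w t \<noteq> 0"
    using polys_common_nonroot[of "{p, q, w}"] by auto
  define D :: "('v mpoly)^'r" where "D = (\<chi> j. pscale (1 - t) (B $ j) + pscale t (B' $ j))"
  have y: "coord D = ?y t"
  proof
    fix c show "coord D c = ?y t c"
      by (cases c) (simp add: D_def coord_def lookup_add algebra_simps del: mp.scale_left_diff_distrib)
  qed
  have D: "D \<in> frames d"
    unfolding frames_iff
  proof
    show "\<forall>j. D $ j \<in> forms d"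
      using B by (auto simp: D_def frames_def
          intro!: mp.subspace_add[OF subspace_forms] mp.subspace_scale[OF subspace_forms])
    show "lin_indep (monomials d) (\<lambda>j m. coord D (j, m)) UNIV"
      by (rule k(3)) (use w t y in simp)
  qed
  \<comment> \<open>Both ends are frames of \<open>L\<close>, so the whole line consists of tuples
    in \<open>L\<close>.\<close>
  have "D $ j \<in> gspan B" for j
  proof -
    have "B' $ j \<in> gspan B" "B $ j \<in> gspan B"
      using B(3) B(6)[symmetric] by (auto simp: gspan_def intro: mp.span_base)
    then show ?thesis by (auto simp: D_def gspan_def intro!: mp.span_add mp.span_scale)
  qed
  then have "gspan D \<subseteq> gspan B"
    unfolding gspan_def[of D] by (intro mp.span_minimal) (auto simp: gspan_def)
  then have "gspan D = L" using gspan_eq_if_subset[OF D B(1)] B(3) by simp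
  then show thesis using that[OF D] L(1) p q t y by simp
qed


section \<open>Codimension of parametrized loci\<close>

definition chain_above :: "'a topology \<Rightarrow> 'a set \<Rightarrow> nat \<Rightarrow> bool" where
  "chain_above X Z k \<longleftrightarrow>
     (\<exists>F. F 0 = Z \<and> (\<forall>i\<le>k. irreducible_closed X (F i)) \<and> (\<forall>i<k. F i \<subset> F (Suc i)))"

lemma codim_irreducible_eq: "codim_irreducible X Z = (SUP k \<in> {k. chain_above X Z k}. enat k)"
  by (simp add: codim_irreducible_def chain_above_def)

lemma chain_above_Suc:
  assumes "irreducible_closed X Z" "Z \<subset> Z'" "chain_above X Z' k"
  shows "chain_above X Z (Suc k)"
proof -
  obtain F where F: "F 0 = Z'" "\<forall>i\<le>k. irreducible_closed X (F i)" "\<forall>i<k. F i \<subset> F (Suc i)"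
    using assms(3) by (auto simp: chain_above_def)
  let ?F = "case_nat Z F"
  have "\<forall>i\<le>Suc k. irreducible_closed X (?F i)"
    using F(2) assms(1) by (auto split: nat.split)
  moreover have "\<forall>i<Suc k. ?F i \<subset> ?F (Suc i)"
    using F(1,3) assms(2) by (auto split: nat.split)
  ultimately show ?thesis unfolding chain_above_def by (intro exI[of _ ?F]) simp
qed

text \<open>A chain above \<open>Z'\<close> is prolonged downwards by \<open>Z\<close>. So if a
  closure is itself irreducible, the infimum in \<open>codim\<close> is attained at it.\<close>

lemma codim_irreducible_antimono:
  assumes "irreducible_closed X Z" "Z \<subseteq> Z'"
  shows "codim_irreducible X Z' \<le> codim_irreducible X Z"
proof (cases "Z = Z'")
  case False
  show ?thesis unfolding codim_irreducible_eq
  proof (rule SUP_mono)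
    fix k assume "k \<in> {k. chain_above X Z' k}"
    then have "chain_above X Z (Suc k)" using chain_above_Suc[OF assms(1), of Z'] False assms(2) by auto
    then show "\<exists>k'\<in>{k. chain_above X Z k}. enat k \<le> enat k'"
      by (intro bexI[of _ "Suc k"]) auto
  qed
qed simp

text \<open>A locus of tuples parametrized by the variables in \<open>I\<close>. Stability under all
  matrices makes it a locus of subspaces, and an independent tuple in the image makes that locus
  nonempty. The type \<open>'k\<close> may be larger than \<open>I\<close>, to make room for further
  parameters.\<close>

definition param ::
  "nat \<Rightarrow> 'k set \<Rightarrow> ('r::finite \<times> ('v::finite \<Rightarrow>\<^sub>0 nat) \<Rightarrow> ('k \<Rightarrow> complex) \<Rightarrow> complex) \<Rightarrow> bool" where
  "param d I \<Psi> \<longleftrightarrow> finite I \<and> (\<forall>c\<in>coord_inds d. pfn I (\<Psi> c)) \<and>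
     (\<forall>x g. \<exists>x'. \<forall>j. \<forall>m\<in>monomials d. \<Psi> (j, m) x' = (\<Sum>l\<in>UNIV. g l j * \<Psi> (l, m) x)) \<and>
     (\<exists>x. lin_indep (monomials d) (\<lambda>j m. \<Psi> (j, m) x) UNIV)"

definition vanishing ::
  "nat \<Rightarrow> ('r::finite \<times> ('v::finite \<Rightarrow>\<^sub>0 nat) \<Rightarrow> ('k \<Rightarrow> complex) \<Rightarrow> complex) \<Rightarrow>
    (('r \<times> ('v \<Rightarrow>\<^sub>0 nat) \<Rightarrow> complex) \<Rightarrow> complex) set" where
  "vanishing d \<Psi> = {P. pfn (coord_inds d) P \<and> (\<forall>x. P (\<lambda>c. \<Psi> c x) = 0)}"

text \<open>The closure is formed among tuples and only then passed to subspaces; that the choice of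
  frame does not matter is \<open>param_closure_iff\<close>.\<close>

definition param_closure ::
  "nat \<Rightarrow> ('r::finite \<times> ('v::finite \<Rightarrow>\<^sub>0 nat) \<Rightarrow> ('k \<Rightarrow> complex) \<Rightarrow> complex) \<Rightarrow> 'v mpoly set set" where
  "param_closure d \<Psi> =
     gspan ` {B \<in> frames d :: (('v mpoly)^'r) set. \<forall>P\<in>vanishing d \<Psi>. P (coord B) = 0}"

lemma paramD:
  assumes "param d I \<Psi>"
  shows "finite I" "c \<in> coord_inds d \<Longrightarrow> pfn I (\<Psi> c)"
  using assms unfolding param_def by blast+

lemma param_equivariant:
  assumes "param d I \<Psi>"
  obtains x' where "\<And>j m. m \<in> monomials d \<Longrightarrow> \<Psi> (j, m) x' = (\<Sum>l\<in>UNIV. g l j * \<Psi> (l, m) x)"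
proof -
  have "\<exists>x'. \<forall>j. \<forall>m\<in>monomials d. \<Psi> (j, m) x' = (\<Sum>l\<in>UNIV. g l j * \<Psi> (l, m) x)"
    using assms unfolding param_def by simp
  then obtain x' where "\<forall>j. \<forall>m\<in>monomials d. \<Psi> (j, m) x' = (\<Sum>l\<in>UNIV. g l j * \<Psi> (l, m) x)"
    by (rule exE)
  then show thesis by (intro that[of x']) blast
qed

lemma param_generic_frame:
  assumes "param d I \<Psi>"
  obtains h x where "pfn I h" "h x \<noteq> 0" "\<And>x. h x \<noteq> 0 \<Longrightarrow> of_coord d (\<lambda>c. \<Psi> c x) \<in> frames d"
proof -
  obtain x where x: "lin_indep (monomials d) (\<lambda>j m. \<Psi> (j, m) x) UNIV"
    using assms unfolding param_def by blast
  obtain h where "pfn I h" "h x \<noteq> 0" "\<And>x. h x \<noteq> 0 \<Longrightarrow> lin_indep (monomials d) (\<lambda>j m. \<Psi> (j, m) x) UNIV"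
    by (rule lin_indep_open[where v = "\<lambda>j m. \<Psi> (j, m)" and J = I, OF _ _ x])
       (auto intro: paramD[OF assms] simp: coord_inds_def)
  then show thesis by (intro that[of h x]) (auto simp: of_coord_frames_iff)
qed

text \<open>Composing an element of \<open>vanishing d \<Psi>\<close> with a change of frame gives
  another element, because the image of \<open>\<Psi>\<close> is stable under matrices.\<close>

lemma param_closure_iff:
  fixes B :: "('v::finite mpoly)^'r::finite"
  assumes "param d I \<Psi>" "B \<in> frames d"
  shows "gspan B \<in> param_closure d \<Psi> \<longleftrightarrow> (\<forall>P\<in>vanishing d \<Psi>. P (coord B) = 0)"
proof
  assume "gspan B \<in> param_closure d \<Psi>"
  then obtain B' :: "('v mpoly)^'r" where B': "B' \<in> frames d" "gspan B' = gspan B"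
    "\<And>P. P \<in> vanishing d \<Psi> \<Longrightarrow> P (coord B') = 0"
    unfolding param_closure_def by auto
  obtain g where g: "B = act B' g" using gspan_eq_imp_act[OF B'(2)] .
  show "\<forall>P\<in>vanishing d \<Psi>. P (coord B) = 0"
  proof
    fix P assume "P \<in> vanishing d \<Psi>"
    then have P: "pfn (coord_inds d) P" "\<And>x. P (\<lambda>c. \<Psi> c x) = 0" by (auto simp: vanishing_def)
    let ?Q = "\<lambda>y. P (\<lambda>c. (\<lambda>y. \<Sum>l\<in>UNIV. g l (fst c) * y (l, snd c)) y)"
    have "pfn (coord_inds d) ?Q"
      by (rule pfn_compose[OF P(1)]) (intro pfn_sum pfn_mult pfn_const pfn_var, auto simp:
          coord_inds_def)
    moreover have "?Q (\<lambda>c. \<Psi> c x) = 0" for x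
    proof -
      obtain x' where x': "\<And>j m. m \<in> monomials d \<Longrightarrow> \<Psi> (j, m) x' = (\<Sum>l\<in>UNIV. g l j * \<Psi> (l, m) x)"
        by (rule param_equivariant[OF assms(1), of g x]) (rule that)
      have "?Q (\<lambda>c. \<Psi> c x) = P (\<lambda>c. \<Psi> c x')"
        by (rule pfn_depends[OF P(1)]) (auto simp: x' coord_inds_def)
      then show ?thesis using P(2) by simp
    qed
    ultimately have "?Q (coord B') = 0" using B'(3)[of ?Q] by (simp add: vanishing_def)
    moreover have "?Q (coord B') = P (coord B)"
      by (rule arg_cong[of _ _ P]) (auto simp: g coord_act)
    ultimately show "P (coord B) = 0" by simp
  qed
qed (use assms(2) in \<open>auto simp: param_closure_def\<close>)

lemma param_image_in_closure:
  assumes "param d I \<Psi>" "of_coord d (\<lambda>c. \<Psi> c x) \<in> frames d"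
  shows "gspan (of_coord d (\<lambda>c. \<Psi> c x)) \<in> param_closure d \<Psi>"
  using assms by (auto simp: param_closure_iff vanishing_def pfn_coord_of_coord)

lemma param_closure_dense:
  fixes B :: "('v::finite mpoly)^'r::finite"
  assumes "param d I \<Psi>" "B \<in> frames d" "gspan B \<in> param_closure d \<Psi>"
    and "pfn (coord_inds d) f" "f (coord B) \<noteq> 0"
  obtains x where "f (\<lambda>c. \<Psi> c x) \<noteq> 0"
  using assms by (auto simp: param_closure_iff vanishing_def)

lemma param_compose_pfn:
  assumes "param d I \<Psi>" "pfn (coord_inds d) f"
  shows "pfn I (\<lambda>x. f (\<lambda>c. \<Psi> c x))"
  by (rule pfn_compose[OF assms(2)]) (rule paramD[OF assms(1)])

text \<open>The complement is the union of the principal open sets of the elements of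
  \<open>vanishing d \<Psi>\<close>. Irreducibility is inherited from the affine space of
  parameters: open sets that meet the closure pull back to nonempty open sets, which meet each other
  and the set of parameters that give frames.\<close>

lemma irreducible_param_closure:
  fixes \<Psi> :: "'r::finite \<times> ('v::finite \<Rightarrow>\<^sub>0 nat) \<Rightarrow> ('k \<Rightarrow> complex) \<Rightarrow> complex"
  assumes par: "param d I \<Psi>"
  shows "irreducible_closed (grassmannian_topology TYPE('r) d) (param_closure d \<Psi>)"
proof -
  let ?G = "grassmannian_topology TYPE('r) d :: 'v mpoly set topology"
  let ?F = "frames d :: (('v mpoly)^'r) set"
  have top: "topspace ?G = gspan ` ?F"
    by (simp add: topspace_grassmannian_topology grassmannian_eq_image)
  have "topspace ?G - param_closure d \<Psi> = (\<Union>P\<in>vanishing d \<Psi>. gspan ` {B \<in> ?F. P (coord B) \<noteq> 0})"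
  proof (intro equalityI subsetI)
    fix L assume "L \<in> topspace ?G - param_closure d \<Psi>"
    then obtain B where "B \<in> ?F" "L = gspan B" "gspan B \<notin> param_closure d \<Psi>" unfolding top by auto
    then show "L \<in> (\<Union>P\<in>vanishing d \<Psi>. gspan ` {B \<in> ?F. P (coord B) \<noteq> 0})"
      using param_closure_iff[OF par, of B] by auto
  next
    fix L assume "L \<in> (\<Union>P\<in>vanishing d \<Psi>. gspan ` {B \<in> ?F. P (coord B) \<noteq> 0})"
    then obtain P B where "P \<in> vanishing d \<Psi>" "B \<in> ?F" "P (coord B) \<noteq> 0" "L = gspan B" by auto
    then show "L \<in> topspace ?G - param_closure d \<Psi>"
      unfolding top using param_closure_iff[OF par, of B] by auto
  qed
  also have "openin ?G \<dots>"
    by (rule openin_Union) (auto simp: vanishing_def intro: openin_grassmannian_principal)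
  finally have "closedin ?G (param_closure d \<Psi>)"
    unfolding closedin_def top by (auto simp: param_closure_def)
  moreover obtain h x where h: "pfn I h" "h x \<noteq> 0"
    "\<And>x. h x \<noteq> 0 \<Longrightarrow> of_coord d (\<lambda>c. \<Psi> c x) \<in> frames d"
    by (rule param_generic_frame[OF par]) (rule that)
  then have "param_closure d \<Psi> \<noteq> {}" using param_image_in_closure[OF par, of x] by auto
  moreover have "param_closure d \<Psi> \<subseteq> C \<or> param_closure d \<Psi> \<subseteq> D"
    if CD: "closedin ?G C" "closedin ?G D" "param_closure d \<Psi> \<subseteq> C \<union> D" for C D
  proof (rule ccontr)
    assume "\<not> ?thesis"
    then obtain L M where L: "L \<in> param_closure d \<Psi>" "L \<notin> C" and M: "M \<in> param_closure d \<Psi>" "M \<notin> D"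
      by blast
    have "\<exists>f x. pfn (coord_inds d) f \<and> f (\<lambda>c. \<Psi> c x) \<noteq> 0 \<and>
        (\<forall>B\<in>?F. f (coord B) \<noteq> 0 \<longrightarrow> gspan B \<notin> E)"
      if E: "closedin ?G E" "N \<in> param_closure d \<Psi>" "N \<notin> E" for E N
    proof -
      obtain B where B: "B \<in> ?F" "N = gspan B" using E(2) by (auto simp: param_closure_def)
      have op: "openin ?G (topspace ?G - E)" using E(1) by auto
      have "gspan B \<in> topspace ?G - E" using B E top by auto
      then obtain f where f: "pfn (coord_inds d) f" "f (coord B) \<noteq> 0"
        "\<And>B'. B' \<in> ?F \<Longrightarrow> f (coord B') \<noteq> 0 \<Longrightarrow> gspan B' \<in> topspace ?G - E"
        using openin_grassmannian_base[OF op B(1)] by metis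
      obtain x where "f (\<lambda>c. \<Psi> c x) \<noteq> 0"
        using param_closure_dense[OF par B(1) _ f(1,2)] E(2) B(2) by blast
      with f show ?thesis by (intro exI[of _ f] exI[of _ x]) auto
    qed
    from this[OF CD(1) L] this[OF CD(2) M] obtain f1 f2 x1 x2
      where f: "pfn (coord_inds d) f1" "f1 (\<lambda>c. \<Psi> c x1) \<noteq> 0" "\<forall>B\<in>?F. f1 (coord B) \<noteq> 0 \<longrightarrow> gspan B \<notin> C"
        "pfn (coord_inds d) f2" "f2 (\<lambda>c. \<Psi> c x2) \<noteq> 0" "\<forall>B\<in>?F. f2 (coord B) \<noteq> 0 \<longrightarrow> gspan B \<notin> D"
      by (elim exE conjE)
    let ?f1 = "\<lambda>x. f1 (\<lambda>c. \<Psi> c x)" and ?f2 = "\<lambda>x. f2 (\<lambda>c. \<Psi> c x)"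
    obtain z where z: "?f1 z \<noteq> 0" "h z \<noteq> 0"
      using pfn_common_nonzero[OF param_compose_pfn[OF par f(1)] h(1), of x1 x] f(2) h(2) by blast
    then have "?f1 z * h z \<noteq> 0" by simp
    then obtain y where y: "?f1 y * h y \<noteq> 0" "?f2 y \<noteq> 0"
      using pfn_common_nonzero[OF pfn_mult[OF param_compose_pfn[OF par f(1)] h(1)]
          param_compose_pfn[OF par f(4)], of z x2] f(5) by blast
    let ?B = "of_coord d (\<lambda>c. \<Psi> c y)"
    have B: "?B \<in> ?F" using h(3) y by auto
    have "gspan ?B \<in> C \<union> D" using param_image_in_closure[OF par B] CD(3) by blast
    moreover have "f1 (coord ?B) \<noteq> 0" "f2 (coord ?B) \<noteq> 0"
      using y f(1,4) by (auto simp: pfn_coord_of_coord)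
    ultimately show False using f(3,6) B by blast
  qed
  ultimately show ?thesis unfolding irreducible_closed_def by blast
qed

text \<open>\<open>S\<close> has to contain only the subspaces of general parameters. This suits
  \<open>Sigma_locus\<close>, where the required independence of powers excludes special
  parameters.\<close>

lemma closure_of_eq_param_closure:
  fixes \<Psi> :: "'r::finite \<times> ('v::finite \<Rightarrow>\<^sub>0 nat) \<Rightarrow> ('k \<Rightarrow> complex) \<Rightarrow> complex"
  assumes par: "param d I \<Psi>" and sub: "S \<subseteq> param_closure d \<Psi>"
    and h: "pfn I h" "h x0 \<noteq> 0" "\<And>x. h x \<noteq> 0 \<Longrightarrow> of_coord d (\<lambda>c. \<Psi> c x) \<in> frames d"
    "\<And>x. h x \<noteq> 0 \<Longrightarrow> gspan (of_coord d (\<lambda>c. \<Psi> c x)) \<in> S"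
  shows "grassmannian_topology TYPE('r) d closure_of S = param_closure d \<Psi>"
proof
  let ?G = "grassmannian_topology TYPE('r) d :: 'v mpoly set topology"
  have cl: "closedin ?G (param_closure d \<Psi>)"
    using irreducible_param_closure[OF par] by (simp add: irreducible_closed_def)
  then show "?G closure_of S \<subseteq> param_closure d \<Psi>" by (rule closure_of_minimal[OF sub])
  show "param_closure d \<Psi> \<subseteq> ?G closure_of S"
  proof
    fix L assume L: "L \<in> param_closure d \<Psi>"
    then obtain B :: "('v mpoly)^'r" where B: "B \<in> frames d" "L = gspan B"
      by (auto simp: param_closure_def)
    have "\<exists>M. M \<in> S \<and> M \<in> T" if T: "L \<in> T" "openin ?G T" for T
    proof -
      obtain f where f: "pfn (coord_inds d) f" "f (coord B) \<noteq> 0"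
        "\<And>B' :: ('v mpoly)^'r. B' \<in> frames d \<Longrightarrow> f (coord B') \<noteq> 0 \<Longrightarrow> gspan B' \<in> T"
        using openin_grassmannian_base[OF T(2) B(1)] T(1) B(2) by metis
      obtain x where "f (\<lambda>c. \<Psi> c x) \<noteq> 0"
        using param_closure_dense[OF par B(1) _ f(1,2)] L B(2) by blast
      then obtain y where y: "f (\<lambda>c. \<Psi> c y) \<noteq> 0" "h y \<noteq> 0"
        using pfn_common_nonzero[OF param_compose_pfn[OF par f(1)] h(1), of x x0] h(2) by blast
      have "gspan (of_coord d (\<lambda>c. \<Psi> c y)) \<in> T"
        using f(3)[OF h(3)[OF y(2)]] y(1) f(1) by (simp add: pfn_coord_of_coord)
      with h(4)[OF y(2)] show ?thesis by blast
    qed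
    moreover have "L \<in> topspace ?G" using L cl closedin_subset by blast
    ultimately show "L \<in> ?G closure_of S" by (auto simp: in_closure_of)
  qed
qed

text \<open>Along a chain, the coordinates with independent gradients on \<open>F 0\<close> and, for each \<open>i\<close>,
  a polynomial vanishing on \<open>F i\<close> but not on \<open>F (i + 1)\<close> are algebraically independent.\<close>

lemma chain_above_param_closure_le:
  fixes \<Psi> :: "'r::finite \<times> ('v::finite \<Rightarrow>\<^sub>0 nat) \<Rightarrow> ('k \<Rightarrow> complex) \<Rightarrow> complex"
  assumes par: "param d I \<Psi>" and C: "C \<subseteq> coord_inds d" "lin_indep I (\<lambda>c k. pd k (\<Psi> c) x0) C"
    and chain: "chain_above (grassmannian_topology TYPE('r) d :: 'v mpoly set topology)
        (param_closure d \<Psi>) n"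
  shows "card C + n \<le> card (coord_inds d :: ('r \<times> ('v \<Rightarrow>\<^sub>0 nat)) set)"
proof -
  let ?G = "grassmannian_topology TYPE('r) d :: 'v mpoly set topology"
  let ?fr = "frames d :: (('v mpoly)^'r) set"
  let ?I = "coord_inds d :: ('r \<times> ('v \<Rightarrow>\<^sub>0 nat)) set"
  have finC: "finite C" using C(1) finite_coord_inds finite_subset by blast
  obtain F where F: "F 0 = param_closure d \<Psi>" "\<And>i. i \<le> n \<Longrightarrow> irreducible_closed ?G (F i)"
    "\<And>i. i < n \<Longrightarrow> F i \<subset> F (Suc i)"
    using chain unfolding chain_above_def by blast
  \<comment> \<open>The chain is lifted to frames, where polynomials in the coordinates can be
    evaluated.\<close>
  define Y where "Y = (\<lambda>i. {B \<in> ?fr. gspan B \<in> F i})"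
  have top: "topspace ?G = gspan ` ?fr"
    by (simp add: topspace_grassmannian_topology grassmannian_eq_image)
  have "\<forall>i\<in>{..<n}. \<exists>f. pfn ?I f \<and> (\<forall>B\<in>Y i. f (coord B) = 0) \<and> (\<exists>B\<in>Y (Suc i). f (coord B) \<noteq> 0)"
  proof
    fix i assume i: "i \<in> {..<n}"
    have cl: "closedin ?G (F i)" "closedin ?G (F (Suc i))"
      using F(2)[of i] F(2)[of "Suc i"] i by (auto simp: irreducible_closed_def)
    obtain L where L: "L \<in> F (Suc i)" "L \<notin> F i" using F(3)[of i] i by auto
    then have "L \<in> topspace ?G" using cl(2) closedin_subset by blast
    then obtain B where B: "B \<in> ?fr" "L = gspan B" unfolding top by auto
    have op: "openin ?G (topspace ?G - F i)" using cl(1) by auto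
    have "gspan B \<in> topspace ?G - F i" using B L top by auto
    then obtain f where f: "pfn (coord_inds d) f" "f (coord B) \<noteq> 0"
      "\<And>B'. B' \<in> ?fr \<Longrightarrow> f (coord B') \<noteq> 0 \<Longrightarrow> gspan B' \<in> topspace ?G - F i"
      using openin_grassmannian_base[OF op B(1)] by metis
    have "\<forall>B\<in>Y i. f (coord B) = 0" using f(3) by (auto simp: Y_def)
    moreover have "\<exists>B\<in>Y (Suc i). f (coord B) \<noteq> 0" using B L(1) f(2) by (auto simp: Y_def)
    ultimately show "\<exists>f. pfn ?I f \<and> (\<forall>B\<in>Y i. f (coord B) = 0) \<and> (\<exists>B\<in>Y (Suc i). f (coord B) \<noteq> 0)"
      using f(1) by blast
  qed
  from bchoice[OF this] obtain f where f: "\<forall>i\<in>{..<n}. pfn ?I (f i) \<and>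
      (\<forall>B\<in>Y i. f i (coord B) = 0) \<and> (\<exists>B\<in>Y (Suc i). f i (coord B) \<noteq> 0)"
    by (rule exE)
  \<comment> \<open>\<open>Inl\<close> carries the coordinates in \<open>C\<close>,
    \<open>Inr\<close> the functions chosen along the chain; \<open>A i\<close> contains those with
    number below \<open>i\<close>.\<close>
  define A where "A = (\<lambda>i. Inl ` C \<union> Inr ` {..<i :: nat})"
  define g where "g = case_sum (\<lambda>c y. y c) f"
  have g: "pfn ?I (g a)" if "a \<in> A i" "i \<le> n" for a i
    using that f C(1) by (auto simp: A_def g_def intro!: pfn_var)
  have "alg_indep (A i) (\<lambda>a B. g a (coord B)) (Y i)" if "i \<le> n" for i
    using that
  proof (induction i)
    case 0
    show ?case unfolding alg_indep_def
    proof (intro allI impI)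
      fix P and z :: "('r \<times> ('v \<Rightarrow>\<^sub>0 nat)) + nat \<Rightarrow> complex"
      assume P: "pfn (A 0) P" "\<forall>B\<in>Y 0. P (\<lambda>a. g a (coord B)) = 0"
      obtain h x where h: "pfn I h" "h x \<noteq> 0"
        "\<And>x. h x \<noteq> 0 \<Longrightarrow> of_coord d (\<lambda>c. \<Psi> c x) \<in> frames d"
        by (rule param_generic_frame[OF par]) (rule that)
      let ?Q = "\<lambda>z. P (\<lambda>a. (case a of Inl c \<Rightarrow> (\<lambda>z. z c) | Inr i \<Rightarrow> (\<lambda>z. 0)) z)"
      have Q: "pfn C ?Q" by (rule pfn_compose[OF P(1)]) (auto simp: A_def)
      \<comment> \<open>The relation is known at parameters that give frames, and extends to all
        others by density.\<close>
      have "?Q (\<lambda>c. \<Psi> c y) = 0" for y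
      proof (rule pfn_integral_domain[where f = h and g = "\<lambda>y. ?Q (\<lambda>c. \<Psi> c y)", OF h(1) _ h(2)])
        show "pfn I (\<lambda>y. ?Q (\<lambda>c. \<Psi> c y))"
          by (rule pfn_compose[OF Q]) (use C(1) paramD[OF par] in blast)
        fix y assume y: "h y \<noteq> 0"
        let ?B = "of_coord d (\<lambda>c. \<Psi> c y)"
        have "?B \<in> Y 0"
          unfolding Y_def F(1) using h(3)[OF y] param_image_in_closure[OF par] by auto
        then have "P (\<lambda>a. g a (coord ?B)) = 0" using P(2) by blast
        moreover have "P (\<lambda>a. g a (coord ?B)) = ?Q (\<lambda>c. \<Psi> c y)"
          by (rule pfn_depends[OF P(1)]) (use C(1) in \<open>auto simp: A_def g_def coord_of_coord
              coord_inds_def\<close>)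
        ultimately show "?Q (\<lambda>c. \<Psi> c y) = 0" by simp
      qed
      then have "?Q (\<lambda>c. z (Inl c)) = 0"
        using alg_indepD[OF alg_indep_if_gradients_indep[OF paramD(1)[OF par] finC _ C(2)] Q]
          paramD(2)[OF par] C(1) by blast
      moreover have "?Q (\<lambda>c. z (Inl c)) = P z"
        by (rule pfn_depends[OF P(1)]) (auto simp: A_def)
      ultimately show "P z = 0" by simp
    qed
  next
    case (Suc i)
    let ?g = "\<lambda>a B. g a (coord B)"
    have i: "i \<in> {..<n}" using Suc.prems by simp
    have upd: "?g(Inr i := ?g (Inr i)) = ?g" by (intro ext) simp
    have "alg_indep (insert (Inr i) (A i)) (?g(Inr i := ?g (Inr i))) (Y (Suc i))"
    proof (rule alg_indep_insert)
      show "alg_indep (A i) ?g (Y i)" using Suc by simp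
      show "Inr i \<notin> A i" by (auto simp: A_def)
      show "Y i \<subseteq> Y (Suc i)" using F(3)[of i] i by (auto simp: Y_def)
      show "?g (Inr i) B = 0" if "B \<in> Y i" for B using f i that by (auto simp: g_def)
      fix P B assume P: "pfn (insert (Inr i) (A i)) P"
        "\<And>B. B \<in> Y (Suc i) \<Longrightarrow> ?g (Inr i) B * P (\<lambda>a. (?g(Inr i := ?g (Inr i))) a B) = 0"
        and B: "B \<in> Y (Suc i)"
      let ?P = "\<lambda>y. P (\<lambda>a. g a y)"
      have "insert (Inr i) (A i) = A (Suc i)" by (auto simp: A_def)
      then have pP: "pfn ?I ?P" using g[of _ "Suc i"] Suc.prems by (intro pfn_compose[OF P(1)]) auto
      obtain B0 where B0: "B0 \<in> Y (Suc i)" "f i (coord B0) \<noteq> 0" using f i by blast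
      \<comment> \<open>Cancellation of \<open>f i\<close>: if \<open>?P\<close> were nonzero
        somewhere on \<open>Y (Suc i)\<close>, irreducibility would give a frame where both factors
        are nonzero, although their product is zero.\<close>
      have "?P (coord B) = 0"
      proof (rule ccontr)
        assume "?P (coord B) \<noteq> 0"
        note nz = this
        have fi: "pfn ?I (f i)" using f i by blast
        have Y: "B0 \<in> ?fr" "gspan B0 \<in> F (Suc i)" "B \<in> ?fr" "gspan B \<in> F (Suc i)"
          using B B0(1) by (auto simp: Y_def)
        obtain B' where B': "B' \<in> ?fr" "gspan B' \<in> F (Suc i)" "f i (coord B') \<noteq> 0" "?P (coord B') \<noteq> 0"
          by (rule irreducible_closed_preimage[where f = "f i" and h = ?P,
              OF F(2)[OF Suc.prems] fi Y(1,2) B0(2) pP Y(3,4) nz]) (rule that)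
        then have "B' \<in> Y (Suc i)" by (simp add: Y_def)
        from P(2)[OF this] B'(3,4) show False unfolding upd by (simp add: g_def)
      qed
      then show "P (\<lambda>a. (?g(Inr i := ?g (Inr i))) a B) = 0" unfolding upd by simp
    qed
    moreover have "insert (Inr i) (A i) = A (Suc i)" by (auto simp: A_def)
    ultimately show ?case unfolding upd by simp
  qed
  then have ind: "alg_indep (A n) (\<lambda>a B. g a (coord B)) (Y n)" by simp
  have "alg_indep (A n) g UNIV"
    unfolding alg_indep_def
  proof (intro allI impI)
    fix P z assume "pfn (A n) P" "\<forall>y\<in>UNIV. P (\<lambda>a. g a y) = 0"
    then show "P z = 0" using alg_indepD[OF ind, of P z] by simp
  qed
  then have "card (A n) \<le> card ?I"
    by (rule card_alg_indep_le) (use finC g in \<open>auto simp: A_def\<close>)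
  also have "card (A n) = card C + n"
    unfolding A_def using finC by (subst card_Un_disjoint) (auto simp: card_image)
  finally show ?thesis .
qed

text \<open>Row rank equals column rank: a maximal independent set \<open>D\<close> of columns has
  at least \<open>card C\<close> elements. Together with the \<open>j\<close>-th unit vector these
  are more vectors than entries, and the resulting relation involves the unit vector because
  \<open>D\<close> is independent. For \<open>j\<close> in \<open>C\<close>, the solution
  \<open>u\<close> is a linear function with value one on the \<open>j\<close>-th member and zero on
  the others.\<close>

lemma lin_indep_dual:
  assumes "finite I" "finite C" "lin_indep I v C"
  shows "\<exists>u. \<forall>l\<in>C. (\<Sum>k\<in>I. u k * v l k) = (if l = j then 1 else 0)"
proof -
  obtain D T where D: "D \<subseteq> I" "lin_indep C (\<lambda>k c. v c k) D"
    "\<And>k c. k \<in> I \<Longrightarrow> c \<in> C \<Longrightarrow> v c k = (\<Sum>b\<in>D. T k b * v c b)"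
    by (rule maximal_lin_indep_spans[OF assms(1), of C "\<lambda>k c. v c k"]) (rule that)
  have fD: "finite D" using D(1) assms(1) finite_subset by blast
  have "card C \<le> card D"
    by (rule card_lin_indep_le[OF assms(3,2) fD, of "\<lambda>c b. v c b" "\<lambda>b k. T k b"])
       (simp add: D(3) mult.commute)
  \<comment> \<open>\<open>None\<close> stands for the unit vector, \<open>Some b\<close> for the
    column \<open>b\<close>.\<close>
  then have "card C < card (insert None (Some ` D))"
    using fD by (simp add: card_image)
  then have "\<exists>x. (\<exists>a\<in>insert None (Some ` D). x a \<noteq> 0) \<and>
      (\<forall>c\<in>C. (\<Sum>a\<in>insert None (Some ` D). x a * (case a of None \<Rightarrow> if c = j then 1 else 0 | Some b \<Rightarrow> v
          c b)) = 0)"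
    using assms(2) fD by (intro homogeneous_system_nontrivial) auto
  then obtain x where x: "(\<exists>a\<in>insert None (Some ` D). x a \<noteq> 0) \<and>
      (\<forall>c\<in>C. (\<Sum>a\<in>insert None (Some ` D). x a * (case a of None \<Rightarrow> if c = j then 1 else 0 | Some b \<Rightarrow> v
          c b)) = 0)"
    by (rule exE)
  have eq: "x None * (if c = j then 1 else 0) + (\<Sum>b\<in>D. x (Some b) * v c b) = 0" if "c \<in> C" for c
  proof -
    have "(\<Sum>a\<in>Some ` D. x a * (case a of None \<Rightarrow> if c = j then 1 else 0 | Some b \<Rightarrow> v c b))
        = (\<Sum>b\<in>D. x (Some b) * v c b)"
      by (subst sum.reindex) auto
    then show ?thesis using x that fD by (auto simp: sum.insert)
  qed
  have "x None \<noteq> 0"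
  proof
    assume 0: "x None = 0"
    then have "x (Some b) = 0" if "b \<in> D" for b
      using lin_indepD[OF D(2), of "\<lambda>b. x (Some b)" b] eq that by simp
    then show False using x 0 by auto
  qed
  define u where "u = (\<lambda>k. if k \<in> D then - x (Some k) / x None else 0)"
  have "(\<Sum>k\<in>I. u k * v l k) = (if l = j then 1 else 0)" if "l \<in> C" for l
  proof -
    have "(\<Sum>k\<in>I. u k * v l k) = (\<Sum>k\<in>D. - x (Some k) / x None * v l k)"
      unfolding u_def using D(1) assms(1) by (intro sum.mono_neutral_cong_right) auto
    also have "\<dots> = - (\<Sum>k\<in>D. x (Some k) * v l k) / x None"
      by (simp add: sum_negf sum_divide_distrib)
    also have "(\<Sum>k\<in>D. x (Some k) * v l k) = - (x None * (if l = j then 1 else 0))"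
      using eq[OF that] by (simp add: add_eq_0_iff2 add.commute)
    finally show ?thesis using \<open>x None \<noteq> 0\<close> by simp
  qed
  then show ?thesis by blast
qed

text \<open>The maps \<open>f \<mapsto> f + u(f) a\<close> of the space of forms, applied to the members of a tuple, and closedness
  allow one to change an independent tuple into any other tuple, one member at a time.\<close>

lemma transvection_stable_imp_all:
  fixes Ps :: "(('r::finite \<times> ('v::finite \<Rightarrow>\<^sub>0 nat) \<Rightarrow> complex) \<Rightarrow> complex) set"
  assumes pfn: "\<And>P. P \<in> Ps \<Longrightarrow> pfn (coord_inds d) P"
    and y0: "\<And>P. P \<in> Ps \<Longrightarrow> P y0 = 0" "lin_indep (monomials d) (\<lambda>j m. y0 (j, m)) UNIV"
    and stable: "\<And>P y a u. (\<And>P. P \<in> Ps \<Longrightarrow> P y = 0) \<Longrightarrow> P \<in> Ps \<Longrightarrow>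
      P (\<lambda>(j, m). y (j, m) + a m * (\<Sum>m'\<in>monomials d. u m' * y (j, m'))) = 0"
    and P: "P \<in> Ps"
  shows "P z = 0"
proof -
  obtain h where h: "pfn (coord_inds d) h" "h y0 \<noteq> 0"
    "\<And>y. h y \<noteq> 0 \<Longrightarrow> lin_indep (monomials d) (\<lambda>j m. y (j, m)) UNIV"
    by (rule lin_indep_open[where v = "\<lambda>j m y. y (j, m)" and J = "coord_inds d", OF _ _ y0(2)])
       (auto simp: coord_inds_def)
  have "\<forall>P\<in>Ps. P (\<lambda>(j, m). if j \<in> J then z (j, m) else y0 (j, m)) = 0" if "finite J" for J z
    using that
  proof (induction J arbitrary: z rule: finite_induct)
    case empty
    then show ?case using y0(1) by simp
  next
    case (insert j J)
    \<comment> \<open>\<open>w t\<close> moves the members in \<open>J\<close> from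
      \<open>y0\<close>, at \<open>t = 0\<close>, to \<open>z\<close>, at \<open>t = 1\<close>; in
      \<open>u t\<close> the member \<open>j\<close> is moreover replaced by that of
      \<open>z\<close>. For general \<open>t\<close> the tuple \<open>w t\<close> is independent,
      and a transvection along the dual function replaces just that member. At \<open>t = 1\<close>,
      where independence may fail, the claim follows by density.\<close>
    define w where "w = (\<lambda>t (l, m). if l \<in> J then y0 (l, m) + t * (z (l, m) - y0 (l, m)) else y0 (l,
        m))"
    define u where "u = (\<lambda>t (l, m). if l = j then z (l, m) else w t (l, m))"
    show ?case
    proof
      fix P assume P: "P \<in> Ps"
      have w0: "w 0 = y0" by (auto simp: w_def)
      have "u t = (\<lambda>c. poly (if fst c = j then [:z c:] else if fst c \<in> J then [:y0 c, z c - y0 c:]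
          else [:y0 c:]) t)" for t
        by (auto simp: u_def w_def)
      then obtain p where p: "\<And>t. P (u t) = poly p t"
        using pfn_curve[OF pfn[OF P], of "\<lambda>c. if fst c = j then [:z c:] else if fst c \<in> J then [:y0
            c, z c - y0 c:] else [:y0 c:]"]
        by auto
      have "w t = (\<lambda>c. poly (if fst c \<in> J then [:y0 c, z c - y0 c:] else [:y0 c:]) t)" for t
        by (auto simp: w_def)
      then obtain q where q: "\<And>t. h (w t) = poly q t"
        using pfn_curve[OF h(1), of "\<lambda>c. if fst c \<in> J then [:y0 c, z c - y0 c:] else [:y0 c:]"]
        by auto
      have "poly p t = 0" if "poly q t \<noteq> 0" for t
      proof -
        have ind: "lin_indep (monomials d) (\<lambda>l m. w t (l, m)) UNIV" using h(3) q that by simp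
        obtain v where v: "\<forall>l\<in>UNIV. (\<Sum>m\<in>monomials d. v m * w t (l, m)) = (if l = j then 1 else 0)"
          using lin_indep_dual[OF finite_monomials finite ind, of j] by (rule exE)
        have "P (\<lambda>(l, m). w t (l, m) + (z (j, m) - w t (j, m)) * (\<Sum>m'\<in>monomials d. v m' * w t (l,
            m'))) = 0"
        proof (rule stable[where y = "w t" and a = "\<lambda>m. z (j, m) - w t (j, m)", OF _ P])
          fix P assume P: "P \<in> Ps"
          have "w t = (\<lambda>(l, m). if l \<in> J then (\<lambda>c. y0 c + t * (z c - y0 c)) (l, m) else y0 (l, m))"
            by (auto simp: w_def)
          then show "P (w t) = 0" using insert.IH[of "\<lambda>c. y0 c + t * (z c - y0 c)"] P by simp
        qed
        also have "(\<lambda>(l, m). w t (l, m) + (z (j, m) - w t (j, m)) * (\<Sum>m'\<in>monomials d. v m' * w t (l,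
            m'))) = u t"
          using v by (auto simp: u_def)
        finally show ?thesis using p by simp
      qed
      then have "poly (p * q) t = 0" for t by (cases "poly q t = 0") auto
      then have "p * q = 0" using poly_all_0_iff_0 by blast
      moreover have "q \<noteq> 0" using q[of 0] h(2) w0 by auto
      ultimately have "P (u 1) = 0" using p by simp
      moreover have "u 1 = (\<lambda>(l, m). if l \<in> insert j J then z (l, m) else y0 (l, m))"
        by (auto simp: u_def w_def)
      ultimately show "P (\<lambda>(l, m). if l \<in> insert j J then z (l, m) else y0 (l, m)) = 0" by simp
    qed
  qed
  from this[of UNIV z] P show ?thesis by simp
qed

section \<open>Enlarging a parametrized locus by one parameter\<close>

lemma pd_outside:
  assumes "pfn I f" "i \<notin> I"
  shows "pd i f x = 0"
proof -
  have "f (x(i := t)) = f x" for t by (rule pfn_depends[OF assms(1)]) (use assms(2) in auto)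
  then show ?thesis by (simp add: pd_def)
qed

text \<open>The parameter \<open>x e\<close> scales a transvection of the space of forms. Linear
  maps of forms commute with matrices acting on tuples, which preserves stability;
  \<open>x e = 0\<close> recovers \<open>\<Psi>\<close>; and every gradient of
  \<open>\<Psi>'\<close> is a combination of gradients of \<open>\<Psi>\<close> and of the unit
  vector of \<open>e\<close>, so the rank grows by at most one.\<close>

lemma param_transvection:
  fixes \<Psi> :: "'r::finite \<times> ('v::finite \<Rightarrow>\<^sub>0 nat) \<Rightarrow> ('k \<Rightarrow> complex) \<Rightarrow> complex"
    and a u :: "('v \<Rightarrow>\<^sub>0 nat) \<Rightarrow> complex"
  assumes par: "param d I \<Psi>" and e: "e \<notin> I"
  defines "\<Psi>' \<equiv> \<lambda>(j, m) x. \<Psi> (j, m) x + x e * (a m * (\<Sum>m'\<in>monomials d. u m' * \<Psi> (j, m') x))"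
  shows "param d (insert e I) \<Psi>'"
    and "vanishing d \<Psi>' \<subseteq> vanishing d \<Psi>"
    and "D \<subseteq> coord_inds d \<Longrightarrow> lin_indep (insert e I) (\<lambda>c k. pd k (\<Psi>' c) x) D \<Longrightarrow>
      \<exists>C\<subseteq>coord_inds d. lin_indep I (\<lambda>c k. pd k (\<Psi> c) x) C \<and> card D \<le> Suc (card C)"
proof -
  have dep: "\<Psi> c (x(e := t)) = \<Psi> c x" if "c \<in> coord_inds d" for c x t
    by (rule pfn_depends[OF paramD(2)[OF par that]]) (use e in auto)
  have pfn: "pfn (insert e I) (\<Psi> c)" if "c \<in> coord_inds d" for c
    by (rule pfn_mono[OF paramD(2)[OF par that]]) auto
  have pfnS: "pfn (insert e I) (\<lambda>x. a m * (\<Sum>m'\<in>monomials d. u m' * \<Psi> (j, m') x))" for j m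
    by (intro pfn_mult pfn_sum pfn_const pfn) (auto simp: coord_inds_def)
  show "param d (insert e I) \<Psi>'"
    unfolding param_def
  proof (intro conjI ballI allI)
    show "finite (insert e I)" using paramD(1)[OF par] by simp
    fix c :: "'r \<times> ('v \<Rightarrow>\<^sub>0 nat)" assume "c \<in> coord_inds d"
    then show "pfn (insert e I) (\<Psi>' c)"
      unfolding \<Psi>'_def by (cases c) (simp, intro pfn_add pfn pfn_mult[OF pfn_var pfnS], auto)
  next
    fix x and g :: "'r \<Rightarrow> 'r \<Rightarrow> complex"
    obtain x' where x': "\<And>j m. m \<in> monomials d \<Longrightarrow> \<Psi> (j, m) x' = (\<Sum>l\<in>UNIV. g l j * \<Psi> (l, m) x)"
      by (rule param_equivariant[OF par, of g x]) (rule that)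
    have x'': "\<Psi> (j, m) (x'(e := x e)) = (\<Sum>l\<in>UNIV. g l j * \<Psi> (l, m) x)" if "m \<in> monomials d" for j m
      using dep[of "(j, m)"] x'[OF that] that by (simp add: coord_inds_def)
    show "\<exists>x'. \<forall>j. \<forall>m\<in>monomials d. \<Psi>' (j, m) x' = (\<Sum>l\<in>UNIV. g l j * \<Psi>' (l, m) x)"
    proof (intro exI[of _ "x'(e := x e)"] allI ballI)
      fix j m assume m: "m \<in> (monomials d :: ('v \<Rightarrow>\<^sub>0 nat) set)"
      define s where "s = (\<lambda>l. \<Sum>m'\<in>monomials d. u m' * \<Psi> (l, m') x)"
      have "(\<Sum>m'\<in>monomials d. u m' * \<Psi> (j, m') (x'(e := x e)))
          = (\<Sum>m'\<in>monomials d. \<Sum>l\<in>UNIV. g l j * (u m' * \<Psi> (l, m') x))"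
        by (intro sum.cong refl) (simp add: x'' sum_distrib_left mult_ac)
      also have "\<dots> = (\<Sum>l\<in>UNIV. g l j * s l)"
        unfolding s_def by (subst sum.swap) (simp add: sum_distrib_left)
      finally have "\<Psi>' (j, m) (x'(e := x e)) =
          (\<Sum>l\<in>UNIV. g l j * \<Psi> (l, m) x) + x e * (a m * (\<Sum>l\<in>UNIV. g l j * s l))"
        by (simp add: \<Psi>'_def x''[OF m])
      moreover have "\<Psi>' (l, m) x = \<Psi> (l, m) x + x e * (a m * s l)" for l
        by (simp add: \<Psi>'_def s_def)
      ultimately show "\<Psi>' (j, m) (x'(e := x e)) = (\<Sum>l\<in>UNIV. g l j * \<Psi>' (l, m) x)"
        by (simp add: sum.distrib distrib_left sum_distrib_left mult_ac)
    qed
  next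
    obtain x where x: "lin_indep (monomials d) (\<lambda>j m. \<Psi> (j, m) x) UNIV"
      using par unfolding param_def by blast
    have "lin_indep (monomials d) (\<lambda>j m. \<Psi>' (j, m) (x(e := 0))) UNIV \<longleftrightarrow>
        lin_indep (monomials d) (\<lambda>j m. \<Psi> (j, m) x) UNIV"
      by (rule lin_indep_cong) (simp add: \<Psi>'_def dep coord_inds_def)
    with x show "\<exists>x. lin_indep (monomials d) (\<lambda>j m. \<Psi>' (j, m) x) UNIV" by blast
  qed
  show "vanishing d \<Psi>' \<subseteq> vanishing d \<Psi>"
  proof
    fix P assume "P \<in> vanishing d \<Psi>'"
    then have P: "pfn (coord_inds d) P" "\<And>x. P (\<lambda>c. \<Psi>' c x) = 0" by (auto simp: vanishing_def)
    have "P (\<lambda>c. \<Psi> c x) = P (\<lambda>c. \<Psi>' c (x(e := 0)))" for x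
      by (rule pfn_depends[OF P(1)]) (auto simp: \<Psi>'_def dep)
    with P show "P \<in> vanishing d \<Psi>" by (simp add: vanishing_def)
  qed
  assume D: "D \<subseteq> coord_inds d" "lin_indep (insert e I) (\<lambda>c k. pd k (\<Psi>' c) x) D"
  obtain C T where C: "C \<subseteq> coord_inds d" "lin_indep I (\<lambda>c k. pd k (\<Psi> c) x) C"
    "\<And>c k. c \<in> coord_inds d \<Longrightarrow> k \<in> I \<Longrightarrow> pd k (\<Psi> c) x = (\<Sum>b\<in>C. T c b * pd k (\<Psi> b) x)"
    by (rule maximal_lin_indep_spans[OF finite_coord_inds[of d], of I "\<lambda>c k. pd k (\<Psi> c) x"]) (rule that)
  have finC: "finite C" using C(1) finite_coord_inds finite_subset by blast
  have comb: "pd k (\<Psi> c) x = (\<Sum>b\<in>C. T c b * pd k (\<Psi> b) x)" if "c \<in> coord_inds d" "k \<in> insert e I"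
      for c k
  proof (cases "k = e")
    case True
    have 0: "pd e (\<Psi> b) x = 0" if "b \<in> coord_inds d" for b
      by (rule pd_outside[OF paramD(2)[OF par that] e])
    have "(\<Sum>b\<in>C. T c b * pd e (\<Psi> b) x) = 0"
      by (rule sum.neutral) (use 0 C(1) in auto)
    then show ?thesis using True 0 that by simp
  qed (use C(3) that in auto)
  \<comment> \<open>\<open>?s j m\<close> is the derivative in the direction \<open>e\<close>, and
    \<open>?t j m b\<close> are the coefficients at the gradients of \<open>\<Psi>\<close>. In the
    count, \<open>None\<close> labels the unit vector of \<open>e\<close>.\<close>
  let ?s = "\<lambda>j m. a m * (\<Sum>m'\<in>monomials d. u m' * \<Psi> (j, m') x)"
  let ?t = "\<lambda>j m b. T (j, m) b + x e * (a m * (\<Sum>m'\<in>monomials d. u m' * T (j, m') b))"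
  have "card D \<le> card (insert None (Some ` C))"
  proof (rule card_lin_indep_le[OF D(2), where
        T = "\<lambda>(j, m). case_option (?s j m) (?t j m)" and
        v = "\<lambda>b k. case b of None \<Rightarrow> if k = e then 1 else 0 | Some b \<Rightarrow> pd k (\<Psi> b) x"])
    show "finite D" using D(1) finite_coord_inds finite_subset by blast
    show "finite (insert None (Some ` C))" using finC by simp
    fix c k assume ck: "c \<in> D" "k \<in> insert e I"
    obtain j m where c: "c = (j, m)" by (cases c)
    have jm: "m \<in> monomials d" using ck c D(1) by (auto simp: coord_inds_def)
    have jm': "(j, m') \<in> coord_inds d" if "m' \<in> monomials d" for m' using that by (simp add:
        coord_inds_def)
    have "pd k (\<Psi>' c) x = pd k (\<Psi> (j, m)) x + pd k (\<lambda>x. x e * (a m * (\<Sum>m'\<in>monomials d. u m' * \<Psi> (j,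
        m') x))) x"
      unfolding c \<Psi>'_def by (simp, rule pd_add[OF pfn[OF jm'[OF jm]] pfn_mult[OF pfn_var pfnS]]) simp
    also have "pd k (\<lambda>x. x e * (a m * (\<Sum>m'\<in>monomials d. u m' * \<Psi> (j, m') x))) x
        = (if k = e then 1 else 0) * ?s j m + x e * pd k (\<lambda>x. a m * (\<Sum>m'\<in>monomials d. u m' * \<Psi> (j,
            m') x)) x"
      by (subst pd_mult[OF pfn_var pfnS]) auto
    also have "pd k (\<lambda>x. a m * (\<Sum>m'\<in>monomials d. u m' * \<Psi> (j, m') x)) x
        = a m * pd k (\<lambda>x. \<Sum>m'\<in>monomials d. u m' * \<Psi> (j, m') x) x"
      by (subst pd_mult[OF pfn_const pfn_sum[OF pfn_mult[OF pfn_const pfn[OF jm']]]]) auto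
    also have "pd k (\<lambda>x. \<Sum>m'\<in>monomials d. u m' * \<Psi> (j, m') x) x
        = (\<Sum>m'\<in>monomials d. pd k (\<lambda>x. u m' * \<Psi> (j, m') x) x)"
      by (rule pd_sum[OF pfn_mult[OF pfn_const pfn[OF jm']]])
    also have "\<dots> = (\<Sum>m'\<in>monomials d. u m' * pd k (\<Psi> (j, m')) x)"
      by (intro sum.cong refl) (subst pd_mult[OF pfn_const pfn[OF jm']], auto)
    also have "\<dots> = (\<Sum>m'\<in>monomials d. \<Sum>b\<in>C. u m' * T (j, m') b * pd k (\<Psi> b) x)"
      by (intro sum.cong refl) (simp add: comb[OF jm' ck(2)] sum_distrib_left mult.assoc)
    also have "\<dots> = (\<Sum>b\<in>C. (\<Sum>m'\<in>monomials d. u m' * T (j, m') b) * pd k (\<Psi> b) x)"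
      by (subst sum.swap) (simp add: sum_distrib_right)
    also have "pd k (\<Psi> (j, m)) x = (\<Sum>b\<in>C. T (j, m) b * pd k (\<Psi> b) x)"
      by (rule comb[OF jm'[OF jm] ck(2)])
    finally have 1: "pd k (\<Psi>' c) x = (\<Sum>b\<in>C. T (j, m) b * pd k (\<Psi> b) x) +
        ((if k = e then 1 else 0) * ?s j m +
         x e * (a m * (\<Sum>b\<in>C. (\<Sum>m'\<in>monomials d. u m' * T (j, m') b) * pd k (\<Psi> b) x)))" .
    have "t + (i * s + w * (\<Sum>b\<in>C. N b * p b)) = s * i + (t + (\<Sum>b\<in>C. w * (N b * p b)))"
      for t i s w :: complex and N p
      by (simp add: sum_distrib_left algebra_simps)
    from this[of _ _ _ "x e * a m" "\<lambda>b. \<Sum>m'\<in>monomials d. u m' * T (j, m') b" "\<lambda>b. pd k (\<Psi> b) x"]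
    have "pd k (\<Psi>' c) x = ?s j m * (if k = e then 1 else 0) + ((\<Sum>b\<in>C. T (j, m) b * pd k (\<Psi> b) x) +
        (\<Sum>b\<in>C. x e * a m * ((\<Sum>m'\<in>monomials d. u m' * T (j, m') b) * pd k (\<Psi> b) x)))"
      unfolding 1 mult.assoc[of "x e" "a m"] by (simp only: mult.assoc)
    also have "(\<Sum>b\<in>C. T (j, m) b * pd k (\<Psi> b) x) +
        (\<Sum>b\<in>C. x e * a m * ((\<Sum>m'\<in>monomials d. u m' * T (j, m') b) * pd k (\<Psi> b) x))
        = (\<Sum>b\<in>C. ?t j m b * pd k (\<Psi> b) x)"
      unfolding sum.distrib[symmetric] by (intro sum.cong refl) (simp only: distrib_right mult.assoc)
    also have "(\<Sum>b\<in>C. ?t j m b * pd k (\<Psi> b) x) = (\<Sum>b\<in>Some ` C.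
        (case_option (?s j m) (?t j m) b) * (case b of None \<Rightarrow> if k = e then 1 else 0 | Some b \<Rightarrow> pd k
            (\<Psi> b) x))"
      by (subst sum.reindex) auto
    also have "?s j m * (if k = e then 1 else 0) + \<dots> = (\<Sum>b\<in>insert None (Some ` C).
        (case_option (?s j m) (?t j m) b) * (case b of None \<Rightarrow> if k = e then 1 else 0 | Some b \<Rightarrow> pd k
            (\<Psi> b) x))"
      using finC by (subst sum.insert) auto
    finally show "pd k (\<Psi>' c) x = (\<Sum>b\<in>insert None (Some ` C). (case c of (j, m) \<Rightarrow> case_option (?s j
        m) (?t j m)) b *
        (case b of None \<Rightarrow> if k = e then 1 else 0 | Some b \<Rightarrow> pd k (\<Psi> b) x))"
      by (simp add: c)
  qed
  also have "\<dots> = Suc (card C)" using finC by (simp add: card_image)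
  finally show "\<exists>C\<subseteq>coord_inds d. lin_indep I (\<lambda>c k. pd k (\<Psi> c) x) C \<and> card D \<le> Suc (card C)"
    using C(1,2) by blast
qed

text \<open>The rank is bounded at all parameters, not at one, since this is what survives an
  enlargement, with \<open>n\<close> reduced by one. Fresh parameters exist because
  \<open>'k\<close> is infinite.\<close>

lemma chain_above_param_closure_ge:
  fixes \<Psi> :: "'r::finite \<times> ('v::finite \<Rightarrow>\<^sub>0 nat) \<Rightarrow> ('k \<Rightarrow> complex) \<Rightarrow> complex"
  assumes inf: "infinite (UNIV :: 'k set)"
    and par: "param d I \<Psi>"
    and rank: "\<And>x C. C \<subseteq> coord_inds d \<Longrightarrow> lin_indep I (\<lambda>c k. pd k (\<Psi> c) x) C \<Longrightarrow>
      card C + n \<le> card (coord_inds d :: ('r \<times> ('v \<Rightarrow>\<^sub>0 nat)) set)"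
  shows "chain_above (grassmannian_topology TYPE('r) d :: 'v mpoly set topology) (param_closure d \<Psi>) n"
  using par rank
proof (induction n arbitrary: I \<Psi>)
  case 0
  then show ?case unfolding chain_above_def
    by (intro exI[of _ "\<lambda>_. param_closure d \<Psi>"]) (simp add: irreducible_param_closure)
next
  case (Suc n)
  let ?fr = "frames d :: (('v mpoly)^'r) set"
  note par = Suc.prems(1)
  obtain x0 where x0: "lin_indep (monomials d) (\<lambda>j m. \<Psi> (j, m) x0) UNIV"
    using par unfolding param_def by blast
  \<comment> \<open>Algebraically independent coordinates would have independent gradients at some
    point, which the bound on the rank excludes.\<close>
  have "\<not> alg_indep (coord_inds d) \<Psi> UNIV"
    using gradients_indep_if_alg_indep[OF paramD(1)[OF par] finite_coord_inds paramD(2)[OF par]]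
      Suc.prems(2)[OF subset_refl] by fastforce
  then obtain P0 z0 where P0: "P0 \<in> vanishing d \<Psi>" "P0 z0 \<noteq> 0"
    unfolding alg_indep_def vanishing_def by auto
  define L where "L = (\<lambda>a u y (j :: 'r, m :: 'v \<Rightarrow>\<^sub>0 nat). y (j, m) + a m * (\<Sum>m'\<in>monomials d. u m' *
      y (j, m')) :: complex)"
  \<comment> \<open>If no transvection moved a point of the image off the closure, the closure would
    be stable under all of them and contain every tuple, which \<open>P0\<close> prevents.\<close>
  have "\<exists>a u P x. P \<in> vanishing d \<Psi> \<and> P (L a u (\<lambda>c. \<Psi> c x)) \<noteq> 0"
  proof (rule ccontr)
    assume *: "\<not> ?thesis"
    have "P0 z0 = 0"
    proof (rule transvection_stable_imp_all[where Ps = "vanishing d \<Psi>" and d = d and ?y0.0 = "\<lambda>c. \<Psi>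
        c x0" and P = P0])
      fix P y a u
      assume y: "\<And>P. P \<in> vanishing d \<Psi> \<Longrightarrow> P y = 0" and P: "P \<in> vanishing d \<Psi>"
      let ?Q = "\<lambda>y. P (\<lambda>c. (\<lambda>y. y c + a (snd c) * (\<Sum>m'\<in>monomials d. u m' * y (fst c, m'))) y)"
      have Q: "?Q y = P (L a u y)" for y
        by (rule arg_cong[of _ _ P]) (auto simp: L_def)
      have "?Q (\<lambda>c. \<Psi> c x) = 0" for x
      proof -
        have "P (L a u (\<lambda>c. \<Psi> c x)) = 0" using * P by blast
        then show ?thesis using Q[of "\<lambda>c. \<Psi> c x"] by simp
      qed
      moreover have "pfn (coord_inds d) ?Q"
        by (rule pfn_compose[of "coord_inds d"])
           (use P in \<open>auto simp: vanishing_def coord_inds_def intro!: pfn_add pfn_mult pfn_sum pfn_var\<close>)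
      ultimately have "?Q \<in> vanishing d \<Psi>" unfolding vanishing_def by blast
      from y[OF this] Q[of y]
      show "P (\<lambda>(j, m). y (j, m) + a m * (\<Sum>m'\<in>monomials d. u m' * y (j, m'))) = 0"
        by (simp add: L_def)
    qed (use P0 x0 in \<open>auto simp: vanishing_def\<close>)
    with P0(2) show False by simp
  qed
  then obtain a u P x1 where P: "P \<in> vanishing d \<Psi>" "P (L a u (\<lambda>c. \<Psi> c x1)) \<noteq> 0" by blast
  obtain e where e: "e \<notin> I" using inf paramD(1)[OF par] ex_new_if_finite by metis
  define \<Psi>' where "\<Psi>' = (\<lambda>(j, m) x. \<Psi> (j, m) x + x e * (a m * (\<Sum>m'\<in>monomials d. u m' * \<Psi> (j, m') x)))"
  note tr = param_transvection[OF par e, where a = a and u = u, folded \<Psi>'_def]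
  have "chain_above (grassmannian_topology TYPE('r) d) (param_closure d \<Psi>') n"
  proof (rule Suc.IH[OF tr(1)])
    fix x D assume "D \<subseteq> coord_inds d" "lin_indep (insert e I) (\<lambda>c k. pd k (\<Psi>' c) x) D"
    then obtain C where "C \<subseteq> coord_inds d" "lin_indep I (\<lambda>c k. pd k (\<Psi> c) x) C" "card D \<le> Suc (card C)"
      using tr(3)[of D x] by blast
    with Suc.prems(2)[of C x] show "card D + n \<le> card (coord_inds d :: ('r \<times> ('v \<Rightarrow>\<^sub>0 nat)) set)" by simp
  qed
  moreover have "param_closure d \<Psi> \<subseteq> param_closure d \<Psi>'"
    using tr(2) unfolding param_closure_def by blast
  moreover have "param_closure d \<Psi> \<noteq> param_closure d \<Psi>'"
  proof
    assume eq: "param_closure d \<Psi> = param_closure d \<Psi>'"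
    obtain h x2 where h: "pfn (insert e I) h" "h x2 \<noteq> 0"
      "\<And>x. h x \<noteq> 0 \<Longrightarrow> of_coord d (\<lambda>c. \<Psi>' c x) \<in> ?fr"
      by (rule param_generic_frame[OF tr(1)]) (rule that)
    have pP: "pfn (coord_inds d) P" using P(1) by (simp add: vanishing_def)
    \<comment> \<open>If the closures agreed, \<open>P\<close> would vanish on the image of
      \<open>\<Psi>'\<close> where this gives frames, hence everywhere; but it does not vanish at
      \<open>x1(e := 1)\<close>.\<close>
    have "P (\<lambda>c. \<Psi>' c (x1(e := 1))) = 0"
    proof (rule pfn_integral_domain[where g = "\<lambda>x. P (\<lambda>c. \<Psi>' c x)", OF h(1) param_compose_pfn[OF
        tr(1) pP] h(2)])
      fix x assume "h x \<noteq> 0"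
      then have B: "of_coord d (\<lambda>c. \<Psi>' c x) \<in> ?fr" by (rule h(3))
      then have "gspan (of_coord d (\<lambda>c. \<Psi>' c x)) \<in> param_closure d \<Psi>"
        unfolding eq by (rule param_image_in_closure[OF tr(1)])
      then have "P (coord (of_coord d (\<lambda>c. \<Psi>' c x))) = 0"
        using param_closure_iff[OF par B] P(1) by blast
      then show "P (\<lambda>c. \<Psi>' c x) = 0" by (simp add: pfn_coord_of_coord[OF pP])
    qed
    also have "P (\<lambda>c. \<Psi>' c (x1(e := 1))) = P (L a u (\<lambda>c. \<Psi> c x1))"
    proof (rule pfn_depends[OF pP])
      fix c assume c: "c \<in> (coord_inds d :: ('r \<times> ('v \<Rightarrow>\<^sub>0 nat)) set)"
      have dep: "\<Psi> c (x1(e := 1)) = \<Psi> c x1" if "c \<in> coord_inds d" for c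
        by (rule pfn_depends[OF paramD(2)[OF par that]]) (use e in auto)
      show "\<Psi>' c (x1(e := 1)) = L a u (\<lambda>c. \<Psi> c x1) c"
        using c dep by (cases c) (auto simp: \<Psi>'_def L_def coord_inds_def intro!: sum.cong)
    qed
    finally show False using P(2) by simp
  qed
  ultimately show ?case
    by (intro chain_above_Suc[OF irreducible_param_closure[OF par]]) auto
qed

text \<open>The closure of \<open>S\<close> is irreducible, so its own codimension is the infimum in
  \<open>codim\<close>, and the two bounds on chains above it meet at the generic corank.\<close>

lemma codim_param_locus:
  fixes \<Psi> :: "'r::finite \<times> ('v::finite \<Rightarrow>\<^sub>0 nat) \<Rightarrow> ('k \<Rightarrow> complex) \<Rightarrow> complex"
  assumes "infinite (UNIV :: 'k set)" and par: "param d I \<Psi>"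
    and cl: "grassmannian_topology TYPE('r) d closure_of S = param_closure d \<Psi>"
    and C: "C \<subseteq> coord_inds d" "lin_indep I (\<lambda>c k. pd k (\<Psi> c) x0) C"
    and max: "\<And>x D. D \<subseteq> coord_inds d \<Longrightarrow> lin_indep I (\<lambda>c k. pd k (\<Psi> c) x) D \<Longrightarrow> card D \<le> card C"
  shows "codim S (grassmannian_topology TYPE('r) d :: 'v mpoly set topology) =
    enat (card (coord_inds d :: ('r \<times> ('v \<Rightarrow>\<^sub>0 nat)) set) - card C)" (is "codim S ?G = enat ?n")
proof (rule antisym)
  have le: "card C \<le> card (coord_inds d :: ('r \<times> ('v \<Rightarrow>\<^sub>0 nat)) set)"
    using C(1) by (intro card_mono) auto
  have irr: "irreducible_closed ?G (param_closure d \<Psi>)" by (rule irreducible_param_closure[OF par])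
  have "codim_irreducible ?G (param_closure d \<Psi>) \<le> enat ?n"
    unfolding codim_irreducible_eq
  proof (rule SUP_least)
    fix k assume "k \<in> {k. chain_above ?G (param_closure d \<Psi>) k}"
    then have "card C + k \<le> card (coord_inds d :: ('r \<times> ('v \<Rightarrow>\<^sub>0 nat)) set)"
      by (intro chain_above_param_closure_le[OF par C]) simp
    then show "enat k \<le> enat ?n" by simp
  qed
  then show "codim S ?G \<le> enat ?n"
    unfolding codim_def cl by (rule INF_lower2[rotated]) (use irr in simp)
  have "chain_above ?G (param_closure d \<Psi>) ?n"
  proof (rule chain_above_param_closure_ge[OF assms(1) par])
    fix x D assume "D \<subseteq> (coord_inds d :: ('r \<times> ('v \<Rightarrow>\<^sub>0 nat)) set)" "lin_indep I (\<lambda>c k. pd k (\<Psi> c) x) D"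
    from max[OF this] le show "card D + ?n \<le> card (coord_inds d :: ('r \<times> ('v \<Rightarrow>\<^sub>0 nat)) set)" by simp
  qed
  then have "enat ?n \<le> codim_irreducible ?G (param_closure d \<Psi>)"
    unfolding codim_irreducible_eq by (intro SUP_upper) simp
  then show "enat ?n \<le> codim S ?G"
    unfolding codim_def cl
    by (intro INF_greatest) (auto intro: order_trans codim_irreducible_antimono)
qed


section \<open>The ideal of a point and its symbolic square\<close>

text \<open>The ring as a module over itself, which gives \<open>ideal_gen\<close> the rules of
  \<open>module.span\<close>.\<close>

lemma module_mult: "module ((*) :: 'a::comm_ring_1 \<Rightarrow> 'a \<Rightarrow> 'a)"
  by unfold_locales (auto simp: algebra_simps)

lemma ideal_gen_base: "a \<in> B \<Longrightarrow> a \<in> ideal_gen B"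
  unfolding ideal_gen_def by (rule module.span_base[OF module_mult])

lemma ideal_gen_0: "0 \<in> ideal_gen B"
  unfolding ideal_gen_def by (rule module.span_zero[OF module_mult])

lemma ideal_gen_add: "a \<in> ideal_gen B \<Longrightarrow> b \<in> ideal_gen B \<Longrightarrow> a + b \<in> ideal_gen B"
  unfolding ideal_gen_def by (rule module.span_add[OF module_mult])

lemma ideal_gen_mult: "a \<in> ideal_gen B \<Longrightarrow> c * a \<in> ideal_gen B"
  unfolding ideal_gen_def by (rule module.span_scale[OF module_mult])

lemma ideal_gen_sum: "(\<And>i. i \<in> A \<Longrightarrow> f i \<in> ideal_gen B) \<Longrightarrow> sum f A \<in> ideal_gen B"
  unfolding ideal_gen_def by (rule module.span_sum[OF module_mult])

lemma ideal_gen_induct [consumes 1, case_names zero step]: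
  assumes "a \<in> ideal_gen B" "P 0" "\<And>c x y. x \<in> B \<Longrightarrow> P y \<Longrightarrow> P (c * x + y)"
  shows "P a"
  using assms(1) unfolding ideal_gen_def
  by (rule module.span_induct_alt[OF module_mult]) (use assms(2,3) in auto)

definition pt :: "'v::finite mpoly \<Rightarrow> 'v \<Rightarrow> complex" where
  "pt q v = lookup q (single v 1)"

lemma eval_at_eq: "eval_at f q = peval f (pt q)"
  by (simp add: eval_at_def pt_def[abs_def])

lemma pt_pscale [simp]: "pt (pscale t q) = (\<lambda>v. t * pt q v)"
  by (simp add: pt_def[abs_def])

lemma line_eq: "line q = range (\<lambda>t. pscale t q)"
  unfolding line_def by (rule mp.span_singleton)

text \<open>Scalars are constant polynomials, so ideals are closed under
  \<open>pscale\<close>.\<close>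

lemma pscale_eq_mult: "pscale c p = single 0 c * p"
proof -
  have "p = (\<Sum>m\<in>keys p. single m (lookup p m))"
    by (simp add: sum_single_lookup)
  then have "single 0 c * p =
      (\<Sum>m\<in>keys p. single m (c * lookup p m))"
    by (metis (no_types, lifting) add_0 mult_single sum.cong sum_distrib_left)
  also have "\<dots> = (\<Sum>m\<in>keys p. single m (lookup (pscale c p) m))"
    by simp
  also have "\<dots> = pscale c p" by (rule sum_single_lookup) (auto simp: in_keys_iff)
  finally show ?thesis by simp
qed

lemma monom_eval_scale:
  assumes "m \<in> monomials k"
  shows "monom_eval m (\<lambda>v. t * x v) = t ^ k * monom_eval m x"
  using assms by (simp add: monom_eval_UNIV monomials_def power_mult_distrib prod.distrib
      power_sum[symmetric])

lemma peval_form: "f \<in> forms k \<Longrightarrow> peval f x = (\<Sum>m\<in>monomials k. lookup f m * monom_eval m x)"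
  by (rule peval_superset) (auto simp: forms_iff)

lemma peval_form_scale:
  assumes "f \<in> forms k"
  shows "peval f (\<lambda>v. t * x v) = t ^ k * peval f x"
  by (simp add: peval_form[OF assms] monom_eval_scale sum_distrib_left mult.left_commute)

lemma vanishing_ideal_eval:
  assumes "g \<in> vanishing_ideal X" "P \<in> X" "q \<in> P"
  shows "peval g (pt q) = 0"
  using assms(1) unfolding vanishing_ideal_def
  by (induction rule: ideal_gen_induct)
     (use assms(2,3) in \<open>auto simp: peval_add peval_mult eval_at_eq\<close>)

lemma form_in_vanishing_ideal:
  assumes "f \<in> forms k" "\<And>i. i \<in> S \<Longrightarrow> peval f (pt (q i)) = 0"
  shows "f \<in> vanishing_ideal ((\<lambda>i. line (q i)) ` S)"
  unfolding vanishing_ideal_def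
  by (rule ideal_gen_base) (use assms in \<open>auto simp: eval_at_eq line_eq peval_form_scale\<close>)

lemma vanishing_ideal_Int_forms:
  "u \<in> vanishing_ideal (range (\<lambda>i. line (q i))) \<inter> forms d \<longleftrightarrow>
     u \<in> forms d \<and> (\<forall>i. peval u (pt (q i)) = 0)"
proof
  assume u: "u \<in> vanishing_ideal (range (\<lambda>i. line (q i))) \<inter> forms d"
  have "q i \<in> line (q i)" for i by (simp add: line_def mp.span_base)
  then show "u \<in> forms d \<and> (\<forall>i. peval u (pt (q i)) = 0)"
    using u vanishing_ideal_eval by blast
qed (auto intro: form_in_vanishing_ideal)

text \<open>Vanishing on the whole line is a polynomial identity in \<open>t\<close>, whose
  coefficients are the values at \<open>q\<close> of the homogeneous components; so each component
  lies in the ideal.\<close>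

lemma in_vanishing_ideal_line:
  assumes "\<And>t. peval g (\<lambda>v. t * pt q v) = 0"
  shows "g \<in> vanishing_ideal {line q}"
proof -
  define deg :: "('a \<Rightarrow>\<^sub>0 nat) \<Rightarrow> nat" where "deg = (\<lambda>m. \<Sum>v\<in>UNIV. lookup m v)"
  let ?K = "keys g"
  define h where "h = (\<lambda>k. \<Sum>m\<in>{m\<in>?K. deg m = k}. single m (lookup g m))"
  have h_forms: "h k \<in> forms k" for k
    unfolding h_def by (rule mp.subspace_sum[OF subspace_forms])
      (auto intro: single_in_forms simp: deg_def monomials_def)
  have g: "g = (\<Sum>k\<in>deg ` ?K. h k)"
  proof -
    have "(\<Sum>k\<in>deg ` ?K. h k) = (\<Sum>m\<in>?K. single m (lookup g m))"
      unfolding h_def by (rule sum.group) auto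
    then show ?thesis by (simp add: sum_single_lookup)
  qed
  define p where "p = (\<Sum>k\<in>deg ` ?K. Polynomial.monom (peval (h k) (pt q)) k)"
  have "poly p t = 0" for t
  proof -
    have "peval g (\<lambda>v. t * pt q v) = (\<Sum>k\<in>deg ` ?K. peval (h k) (\<lambda>v. t * pt q v))"
      by (subst g) (rule peval_sum)
    then show ?thesis using assms[of t]
      by (simp add: p_def poly_sum poly_monom peval_form_scale[OF h_forms] mult.commute)
  qed
  then have "p = 0" using poly_all_0_iff_0 by blast
  have "peval (h k) (pt q) = 0" if "k \<in> deg ` ?K" for k
  proof -
    have "coeff p k = peval (h k) (pt q)"
      using that by (simp add: p_def coeff_sum)
    then show ?thesis using \<open>p = 0\<close> by simp
  qed
  then have "h k \<in> vanishing_ideal {line q}" if "k \<in> deg ` ?K" for k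
    using form_in_vanishing_ideal[OF h_forms, where S = "{()}" and q = "\<lambda>_. q"] that by simp
  then show ?thesis
    by (subst g) (auto simp: vanishing_ideal_def intro!: ideal_gen_sum)
qed

text \<open>The formal derivative of the monomial \<open>m\<close> by the variable \<open>v\<close>;
  at exponent \<open>0\<close> the first factor hides the truncated subtraction.\<close>

definition dmonom :: "'v::finite \<Rightarrow> ('v \<Rightarrow>\<^sub>0 nat) \<Rightarrow> ('v \<Rightarrow> complex) \<Rightarrow> complex" where
  "dmonom v m x = of_nat (lookup m v) * x v ^ (lookup m v - 1) *
     (\<Prod>w\<in>UNIV - {v}. x w ^ lookup m w)"

lemma pfn_monom_eval: "pfn UNIV (monom_eval m)"
proof -
  have "peval (single m 1) = monom_eval m" by (intro ext) simp
  with pfn_peval[of "single m 1"] show ?thesis by simp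
qed

lemma pd_monom_eval: "pd v (monom_eval m) x = dmonom v m x"
proof -
  let ?c = "\<Prod>w\<in>UNIV - {v}. x w ^ lookup m w"
  have "monom_eval m (x(v := t)) = t ^ lookup m v * ?c" for t
  proof -
    have "(\<Prod>w\<in>UNIV - {v}. (x(v := t)) w ^ lookup m w) = ?c"
      by (intro prod.cong) auto
    then show ?thesis by (simp add: monom_eval_UNIV prod.remove[of UNIV v])
  qed
  moreover have "((\<lambda>t. t ^ lookup m v * ?c) has_field_derivative
      of_nat (lookup m v) * x v ^ (lookup m v - 1) * ?c) (at (x v))"
    by (auto intro!: derivative_eq_intros)
  ultimately show ?thesis unfolding pd_def dmonom_def by (simp add: DERIV_imp_deriv)
qed

lemma pd_peval_form:
  assumes "f \<in> forms d"
  shows "pd v (peval f) x = (\<Sum>m\<in>monomials d. lookup f m * dmonom v m x)"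
proof -
  have "peval f = (\<lambda>x. \<Sum>m\<in>monomials d. lookup f m * monom_eval m x)"
    by (intro ext peval_form[OF assms])
  then show ?thesis
    by (simp add: pd_sum[OF pfn_mult[OF pfn_const pfn_monom_eval]]
        pd_mult[OF pfn_const pfn_monom_eval] pd_monom_eval)
qed

lemma mult_dmonom: "x v * dmonom v m x = of_nat (lookup m v) * monom_eval m x"
proof (cases "lookup m v")
  case (Suc k)
  have "monom_eval m x = x v ^ lookup m v * (\<Prod>w\<in>UNIV - {v}. x w ^ lookup m w)"
    unfolding monom_eval_UNIV by (rule prod.remove) auto
  then show ?thesis unfolding dmonom_def Suc by (simp del: of_nat_Suc)
qed (simp add: dmonom_def)

lemma dmonom_scale:
  assumes "m \<in> monomials d"
  shows "dmonom v m (\<lambda>v. t * x v) = t ^ (d - 1) * dmonom v m x"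
proof (cases "lookup m v")
  case (Suc k)
  have "d = Suc k + (\<Sum>w\<in>UNIV - {v}. lookup m w)"
    using assms Suc by (simp add: monomials_def sum.remove[of UNIV v])
  then have "d - 1 = k + (\<Sum>w\<in>UNIV - {v}. lookup m w)" by simp
  moreover have "(\<Prod>w\<in>UNIV - {v}. (t * x w) ^ lookup m w) =
      t ^ (\<Sum>w\<in>UNIV - {v}. lookup m w) * (\<Prod>w\<in>UNIV - {v}. x w ^ lookup m w)"
    unfolding power_mult_distrib prod.distrib power_sum ..
  ultimately show ?thesis
    unfolding dmonom_def Suc by (simp add: power_mult_distrib power_add del: of_nat_Suc)
qed (simp add: dmonom_def)

text \<open>Euler's identity: \<open>x v\<close> times the derivative by \<open>v\<close> multiplies
  each monomial by its exponent at \<open>v\<close>, and the exponents add up to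
  \<open>d\<close>.\<close>

lemma euler_form:
  assumes "f \<in> forms d"
  shows "(\<Sum>v\<in>UNIV. x v * pd v (peval f) x) = of_nat d * peval f x"
proof -
  have "(\<Sum>v\<in>UNIV. x v * pd v (peval f) x) =
      (\<Sum>v\<in>UNIV. \<Sum>m\<in>monomials d. lookup f m * (x v * dmonom v m x))"
    by (simp add: pd_peval_form[OF assms] sum_distrib_left mult.left_commute)
  also have "\<dots> = (\<Sum>m\<in>monomials d. \<Sum>v\<in>UNIV. of_nat (lookup m v) * (lookup f m * monom_eval m x))"
    by (subst sum.swap) (simp add: mult_dmonom mult.left_commute)
  also have "\<dots> = (\<Sum>m\<in>monomials d. of_nat d * (lookup f m * monom_eval m x))"
    by (intro sum.cong refl) (simp add: sum_distrib_right[symmetric] monomials_def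
        of_nat_sum[symmetric] del: of_nat_sum)
  finally show ?thesis by (simp add: peval_form[OF assms] sum_distrib_left)
qed

text \<open>By the product rule, a product of two polynomials that vanish at \<open>x\<close> is
  singular there, and so is every multiple of it.\<close>

lemma ideal_prod_singular:
  assumes "e \<in> ideal_prod I I" "\<And>a. a \<in> I \<Longrightarrow> peval a x = 0"
  shows "peval e x = 0 \<and> pd v (peval e) x = 0"
  using assms(1) unfolding ideal_prod_def
proof (induction rule: ideal_gen_induct)
  case zero
  have "peval 0 = (\<lambda>x. 0)" by auto
  then show ?case by simp
next
  case (step c ab y)
  then obtain a b where ab: "ab = a * b" "a \<in> I" "b \<in> I" by blast
  have "peval (c * ab + y) = (\<lambda>x. (peval c x * peval a x) * peval b x + peval y x)"
    by (intro ext) (simp add: ab peval_add peval_mult)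
  moreover have "pd v (\<lambda>x. (peval c x * peval a x) * peval b x + peval y x) x = 0"
    by (subst pd_add[OF pfn_mult[OF pfn_mult[OF pfn_peval pfn_peval] pfn_peval] pfn_peval],
        subst pd_mult[OF pfn_mult[OF pfn_peval pfn_peval] pfn_peval])
       (use step ab assms(2) in simp)
  ultimately show ?case using step ab assms(2) by simp
qed

lemma ideal_prod_memI: "a \<in> I \<Longrightarrow> b \<in> I \<Longrightarrow> a * b \<in> ideal_prod I I"
  unfolding ideal_prod_def by (rule ideal_gen_base) auto

lemma binomial_mod_square:
  assumes "l \<in> ideal_gen B"
  shows "\<exists>E\<in>ideal_prod (ideal_gen B) (ideal_gen B). (a + l) ^ k = a ^ k + of_nat k * a ^ (k - 1) * l
      + E"
proof (induction k)
  case 0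
  show ?case by (intro bexI[of _ 0]) (auto simp: ideal_prod_def ideal_gen_0)
next
  case (Suc k)
  then obtain E where E: "E \<in> ideal_prod (ideal_gen B) (ideal_gen B)"
    "(a + l) ^ k = a ^ k + of_nat k * a ^ (k - 1) * l + E" by blast
  have k: "of_nat k * a * a ^ (k - 1) = of_nat k * a ^ k" by (cases k) auto
  have "(a + l) * (p + c * b * l + E) = a * p + (c * a * b) * l + p * l + (c * b * (l * l) + (a + l)
      * E)"
    for p c b by (simp add: algebra_simps)
  then have 1: "(a + l) * (a ^ k + of_nat k * a ^ (k - 1) * l + E) =
      a * a ^ k + (of_nat k * a * a ^ (k - 1)) * l + a ^ k * l +
      (of_nat k * a ^ (k - 1) * (l * l) + (a + l) * E)" by this
  have 2: "a * p + c * p * l + p * l = a * p + (1 + c) * p * l" for p c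
    by (simp add: algebra_simps)
  have "(a + l) ^ Suc k = a ^ Suc k + of_nat (Suc k) * a ^ (Suc k - 1) * l +
      (of_nat k * a ^ (k - 1) * (l * l) + (a + l) * E)"
    by (simp only: power_Suc E(2) 1 k 2 of_nat_Suc diff_Suc_1)
  moreover have "of_nat k * a ^ (k - 1) * (l * l) + (a + l) * E \<in> ideal_prod (ideal_gen B)
      (ideal_gen B)"
    using E(1) ideal_prod_memI[OF assms assms] unfolding ideal_prod_def
    by (intro ideal_gen_add[OF ideal_gen_mult ideal_gen_mult])
  ultimately show ?case by blast
qed

text \<open>First-order Taylor expansion of a monomial in the \<open>a w + l w\<close>, obtained by
  multiplying the expansions of its factors; products of two first-order terms fall into the square
  of the ideal.\<close>

lemma taylor_mod_square:
  fixes a l :: "'a \<Rightarrow> 'b::comm_ring_1"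
  assumes "finite W" "\<And>w. w \<in> W \<Longrightarrow> l w \<in> ideal_gen B"
  shows "\<exists>E\<in>ideal_prod (ideal_gen B) (ideal_gen B). (\<Prod>w\<in>W. (a w + l w) ^ k w) = (\<Prod>w\<in>W. a w ^ k w) +
     (\<Sum>w\<in>W. of_nat (k w) * a w ^ (k w - 1) * (\<Prod>w'\<in>W - {w}. a w' ^ k w') * l w) + E"
  using assms
proof (induction W rule: finite_induct)
  case empty
  show ?case by (intro bexI[of _ 0]) (auto simp: ideal_prod_def ideal_gen_0)
next
  case (insert v W)
  let ?J = "ideal_prod (ideal_gen B) (ideal_gen B)"
  let ?s = "\<lambda>W w. of_nat (k w) * a w ^ (k w - 1) * (\<Prod>w'\<in>W - {w}. a w' ^ k w')"
  obtain E where E: "E \<in> ?J" "(\<Prod>w\<in>W. (a w + l w) ^ k w) = (\<Prod>w\<in>W. a w ^ k w) + (\<Sum>w\<in>W. ?s W w * l w) + E"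
    using insert.IH insert.prems by blast
  obtain E' where E': "E' \<in> ?J" "(a v + l v) ^ k v = a v ^ k v + of_nat (k v) * a v ^ (k v - 1) * l
      v + E'"
    using binomial_mod_square[of "l v" B "a v" "k v"] insert.prems by blast
  have s: "?s (insert v W) w = a v ^ k v * ?s W w" if "w \<in> W" for w
  proof -
    have "insert v W - {w} = insert v (W - {w})" using that insert.hyps by auto
    moreover have "(\<Prod>w'\<in>insert v (W - {w}). a w' ^ k w') = a v ^ k v * (\<Prod>w'\<in>W - {w}. a w' ^ k w')"
      using insert.hyps by simp
    ultimately show ?thesis by (simp only: mult.left_commute)
  qed
  have sv: "?s (insert v W) v = of_nat (k v) * a v ^ (k v - 1) * (\<Prod>w\<in>W. a w ^ k w)"
    using insert.hyps by simp
  let ?P = "\<Prod>w\<in>W. a w ^ k w" and ?S = "\<Sum>w\<in>W. ?s W w * l w" and ?c = "of_nat (k v) * a v ^ (k v - 1)"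
  have "(\<Sum>w\<in>insert v W. ?s (insert v W) w * l w) = ?c * ?P * l v + a v ^ k v * ?S"
  proof -
    have "(\<Sum>w\<in>W. ?s (insert v W) w * l w) = (\<Sum>w\<in>W. a v ^ k v * (?s W w * l w))"
      by (intro sum.cong refl, simp only: s, simp only: mult.assoc)
    then show ?thesis by (simp only: sum.insert[OF insert.hyps] sv sum_distrib_left)
  qed
  moreover have "(\<Prod>w\<in>insert v W. (a w + l w) ^ k w) = a v ^ k v * ?P + (?c * ?P * l v + a v ^ k v *
      ?S) +
      (?c * (l v * ?S) + (a v ^ k v + ?c * l v) * E + (?P + ?S + E) * E')"
  proof -
    have "(x + c * b + F) * (p + S + E) = x * p + (c * p * b + x * S) +
        (c * (b * S) + (x + c * b) * E + (p + S + E) * F)" for x c b F p S E :: 'b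
      by (simp add: algebra_simps)
    then show ?thesis using insert.hyps by (simp only: prod.insert[OF insert.hyps] E(2) E'(2))
  qed
  moreover have "?S \<in> ideal_gen B"
    using insert.prems by (intro ideal_gen_sum ideal_gen_mult) auto
  then have "l v * ?S \<in> ?J" using insert.prems by (intro ideal_prod_memI) auto
  then have "?c * (l v * ?S) + (a v ^ k v + ?c * l v) * E + (?P + ?S + E) * E' \<in> ?J"
    using E(1) E'(1) unfolding ideal_prod_def
    by (intro ideal_gen_add[OF ideal_gen_add[OF ideal_gen_mult ideal_gen_mult] ideal_gen_mult])
  ultimately show ?case by (intro bexI) (simp_all only: prod.insert[OF insert.hyps])
qed

abbreviation var :: "'v \<Rightarrow> 'v mpoly" where
  "var v \<equiv> single (single v 1) 1"

lemma single_eq_prod_var: "single m (1 :: complex) = (\<Prod>v\<in>UNIV. var v ^ lookup m v)"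
  for m :: "'v::finite \<Rightarrow>\<^sub>0 nat"
proof -
  have pow: "var v ^ k = single (single v k) 1" for v :: 'v and k
    by (induction k) (auto simp: mult_single single_add[symmetric])
  have "(\<Prod>v\<in>V. single (f v) (1 :: complex)) = single (\<Sum>v\<in>V. f v) 1"
    if "finite V" for V :: "'v set" and f :: "'v \<Rightarrow> 'v \<Rightarrow>\<^sub>0 nat"
    using that by (induction V) (auto simp: mult_single)
  moreover have "(\<Sum>v\<in>UNIV. single v (lookup m v)) = m"
  proof (rule poly_mapping_eqI)
    fix w
    have "(\<Sum>v\<in>UNIV. lookup (single v (lookup m v)) w)
        = (\<Sum>v\<in>UNIV. if v = w then lookup m w else 0)"
      by (intro sum.cong) (auto simp: lookup_single when_def)
    then show "lookup (\<Sum>v\<in>UNIV. single v (lookup m v)) w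
        = lookup m w"
      by (simp add: lookup_sum)
  qed
  ultimately have "(\<Prod>v\<in>UNIV. single (single v (lookup m v)) 1)
      = single m (1 :: complex)" by simp
  then show ?thesis unfolding pow by simp
qed

lemma var_in_forms: "var v \<in> forms 1"
  by (rule single_in_forms) (simp add: monomials_def lookup_single when_def)

text \<open>Multiplying by \<open>q\<^sub>v\<^sup>d\<close> for a nonzero coordinate \<open>q\<^sub>v\<close>, write \<open>q\<^sub>v x\<^sub>w = q\<^sub>w x\<^sub>v + l\<^sub>w\<close> with
  \<open>l\<^sub>w\<close> in the ideal of the point, and expand to first order in the \<open>l\<^sub>w\<close>.\<close>

lemma singular_form_in_square:
  assumes f: "f \<in> forms d" "\<And>v. pd v (peval f) (pt q) = 0" and v0: "pt q v0 \<noteq> 0" and d: "0 < d"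
  shows "f \<in> ideal_prod (vanishing_ideal {line q}) (vanishing_ideal {line q})"
proof -
  let ?x = "pt q" and ?J = "ideal_prod (vanishing_ideal {line q}) (vanishing_ideal {line q})"
  define l where "l = (\<lambda>w. pscale (?x v0) (var w) - pscale (?x w) (var v0))"
  define a where "a = (\<lambda>w. pscale (?x w) (var v0))"
  have l: "l w \<in> vanishing_ideal {line q}" for w
  proof -
    have l_eq: "l w = pscale (?x v0) (var w) + pscale (- ?x w) (var v0)"
      by (simp add: l_def mp.scale_minus_left)
    have "l w \<in> forms 1"
      unfolding l_eq by (intro mp.subspace_add[OF subspace_forms] mp.subspace_scale[OF
          subspace_forms] var_in_forms)
    moreover have "peval (l w) ?x = 0"
      unfolding l_eq peval_add peval_pscale peval_single monom_eval_single by simp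
    ultimately show ?thesis
      using form_in_vanishing_ideal[of "l w" 1, where S = "{()}" and q = "\<lambda>_. q"] by simp
  qed
  have pprod: "(\<Prod>w\<in>V. pscale (c w) (g w) ^ k w) = pscale (\<Prod>w\<in>V. c w ^ k w) (\<Prod>w\<in>V. g w ^ k w)"
    if "finite V" for V :: "'a set" and c :: "'a \<Rightarrow> complex" and g :: "'a \<Rightarrow> 'a mpoly" and k
  proof -
    have mult: "pscale c p * pscale c' p' = pscale (c * c') (p * p')" for c c' and p p' :: "'a mpoly"
    proof -
      have "pscale c p * pscale c' p' = (single 0 c * single 0 c') * (p * p')"
        by (simp add: pscale_eq_mult mult_ac)
      then show ?thesis by (simp add: mult_single pscale_eq_mult)
    qed
    have pow: "pscale c p ^ k = pscale (c ^ k) (p ^ k)" for c k and p :: "'a mpoly"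
      by (induction k) (auto simp: mult)
    show ?thesis using that by (induction V rule: finite_induct) (auto simp: mult pow)
  qed
  have mult_r: "p * pscale c p' = pscale c (p * p')" and mult_l: "pscale c p' * p = pscale c (p' * p)"
    for c and p p' :: "'a mpoly"
    by (simp_all add: pscale_eq_mult mult_ac)
  have of_nat: "of_nat k * p = pscale (of_nat k) p" for k and p :: "'a mpoly"
    by (simp add: pscale_eq_mult single_of_nat)
  have "\<exists>E\<in>?J. pscale (?x v0 ^ d) (single m 1) = pscale (monom_eval m ?x) (var v0 ^ d) +
      (\<Sum>w\<in>UNIV. pscale (dmonom w m ?x) (var v0 ^ (d - 1) * l w)) + E" if m: "m \<in> monomials d" for m
  proof -
    let ?k = "lookup m"
    have k_sum: "(\<Sum>w\<in>UNIV. ?k w) = d" using m by (simp add: monomials_def)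
    have "\<exists>E\<in>?J. (\<Prod>w\<in>UNIV. (a w + l w) ^ ?k w) = (\<Prod>w\<in>UNIV. a w ^ ?k w) +
        (\<Sum>w\<in>UNIV. of_nat (?k w) * a w ^ (?k w - 1) * (\<Prod>w'\<in>UNIV - {w}. a w' ^ ?k w') * l w) + E"
      unfolding vanishing_ideal_def
      by (rule taylor_mod_square) (use l in \<open>simp_all add: vanishing_ideal_def\<close>)
    then obtain E where E: "E \<in> ?J" "(\<Prod>w\<in>UNIV. (a w + l w) ^ ?k w) = (\<Prod>w\<in>UNIV. a w ^ ?k w) +
        (\<Sum>w\<in>UNIV. of_nat (?k w) * a w ^ (?k w - 1) * (\<Prod>w'\<in>UNIV - {w}. a w' ^ ?k w') * l w) + E"
      by (rule bexE)
    have "(\<Prod>w\<in>UNIV. (a w + l w) ^ ?k w) = (\<Prod>w\<in>UNIV. pscale (?x v0) (var w) ^ ?k w)"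
      by (simp add: a_def l_def)
    also have "\<dots> = pscale (?x v0 ^ d) (single m 1)"
      by (subst single_eq_prod_var[of m]) (simp only: pprod[OF finite] k_sum[symmetric] power_sum)
    finally have 1: "(\<Prod>w\<in>UNIV. (a w + l w) ^ ?k w) = pscale (?x v0 ^ d) (single m 1)" .
    have 2: "(\<Prod>w\<in>UNIV. a w ^ ?k w) = pscale (monom_eval m ?x) (var v0 ^ d)"
      unfolding a_def pprod[OF finite] monom_eval_UNIV k_sum[symmetric] power_sum ..
    have 3: "of_nat (?k w) * a w ^ (?k w - 1) * (\<Prod>w'\<in>UNIV - {w}. a w' ^ ?k w') * l w
        = pscale (dmonom w m ?x) (var v0 ^ (d - 1) * l w)" for w
    proof (cases "?k w")
      case (Suc k)
      have "d - 1 = k + (\<Sum>w\<in>UNIV - {w}. ?k w)"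
        using m Suc by (simp add: monomials_def sum.remove[of UNIV w])
      moreover have "pscale c p ^ k = pscale (c ^ k) (p ^ k)" for c and p :: "'a mpoly"
        using pprod[of "{w}" "\<lambda>_. c" "\<lambda>_. p" "\<lambda>_. k"] by simp
      ultimately show ?thesis
        unfolding a_def pprod[OF finite] Suc
        by (simp add: of_nat mult_r mult_l dmonom_def Suc power_add power_sum[symmetric] mult_ac
            del: of_nat_Suc)
    qed (simp add: dmonom_def)
    show ?thesis using E unfolding 1 2 3 by blast
  qed
  then have "\<forall>m\<in>monomials d. \<exists>E\<in>?J. pscale (?x v0 ^ d) (single m 1) = pscale (monom_eval m ?x) (var
      v0 ^ d) +
      (\<Sum>w\<in>UNIV. pscale (dmonom w m ?x) (var v0 ^ (d - 1) * l w)) + E" by blast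
  from bchoice[OF this[unfolded Bex_def]] obtain E where E': "\<forall>m\<in>monomials d. E m \<in> ?J \<and>
      pscale (?x v0 ^ d) (single m 1) = pscale (monom_eval m ?x) (var v0 ^ d) +
      (\<Sum>w\<in>UNIV. pscale (dmonom w m ?x) (var v0 ^ (d - 1) * l w)) + E m"
    by (rule exE)
  have E: "E m \<in> ?J"
    "pscale (?x v0 ^ d) (single m 1) = pscale (monom_eval m ?x) (var v0 ^ d) +
      (\<Sum>w\<in>UNIV. pscale (dmonom w m ?x) (var v0 ^ (d - 1) * l w)) + E m"
    if "m \<in> monomials d" for m
    using E'[rule_format, OF that] by (rule conjunct1, rule conjunct2)
  \<comment> \<open>Euler's identity supplies the vanishing at the point itself, so the terms of
    order zero drop out along with those of order one.\<close>
  have fx: "peval f ?x = 0"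
    using euler_form[OF f(1), of ?x] f(2) d by simp
  have "f = (\<Sum>m\<in>monomials d. single m (lookup f m))"
    by (rule sum_single_lookup[symmetric]) (use f(1) in \<open>auto simp: forms_iff\<close>)
  also have "\<dots> = (\<Sum>m\<in>monomials d. pscale (lookup f m) (single m 1))"
    by (intro sum.cong refl poly_mapping_eqI) (simp add: lookup_single when_def)
  finally have "pscale (?x v0 ^ d) f =
      (\<Sum>m\<in>monomials d. pscale (lookup f m) (pscale (?x v0 ^ d) (single m 1)))"
    by (metis (no_types, lifting) mp.scale_left_commute mp.scale_sum_right sum.cong)
  also have "\<dots> = (\<Sum>m\<in>monomials d. pscale (lookup f m * monom_eval m ?x) (var v0 ^ d)) +
      (\<Sum>m\<in>monomials d. \<Sum>w\<in>UNIV. pscale (lookup f m * dmonom w m ?x) (var v0 ^ (d - 1) * l w)) +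
      (\<Sum>m\<in>monomials d. pscale (lookup f m) (E m))"
    unfolding sum.distrib[symmetric]
    by (intro sum.cong refl) (simp add: E(2) mp.scale_right_distrib mp.scale_sum_right)
  also have "(\<Sum>m\<in>monomials d. pscale (lookup f m * monom_eval m ?x) (var v0 ^ d))
      = pscale (peval f ?x) (var v0 ^ d)"
    by (simp add: mp.scale_sum_left[symmetric] peval_form[OF f(1)])
  also have "(\<Sum>m\<in>monomials d. \<Sum>w\<in>UNIV. pscale (lookup f m * dmonom w m ?x) (var v0 ^ (d - 1) * l w))
      = (\<Sum>w\<in>UNIV. pscale (pd w (peval f) ?x) (var v0 ^ (d - 1) * l w))"
    by (subst sum.swap) (simp add: mp.scale_sum_left[symmetric] pd_peval_form[OF f(1)])
  finally have "pscale (?x v0 ^ d) f = (\<Sum>m\<in>monomials d. pscale (lookup f m) (E m))"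
    using fx f(2) by simp
  also have "\<dots> \<in> ?J"
    unfolding ideal_prod_def pscale_eq_mult
    by (intro ideal_gen_sum ideal_gen_mult) (use E(1) in \<open>simp add: ideal_prod_def\<close>)
  \<comment> \<open>This undoes the factor introduced to express monomials by \<open>var v0\<close>
    and the \<open>l w\<close>.\<close>
  finally have "pscale (inverse (?x v0 ^ d)) (pscale (?x v0 ^ d) f) \<in> ?J"
    unfolding ideal_prod_def pscale_eq_mult[of "inverse _"] by (rule ideal_gen_mult)
  then show ?thesis using v0 by simp
qed

section \<open>The kernel conditions in terms of values and derivatives at the points\<close>

lemma monomials_1: "m \<in> monomials 1 \<Longrightarrow> \<exists>v. m = single v 1"
proof -
  assume "m \<in> monomials 1"
  then have "(\<Sum>v\<in>UNIV. lookup m v) = 1" by (simp add: monomials_def)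
  then obtain v where v: "lookup m v = 1" "\<And>w. w \<noteq> v \<Longrightarrow> lookup m w = 0"
    by (metis (mono_tags, lifting) UNIV_I finite sum_eq_1_iff)
  have "m = single v 1"
    by (rule poly_mapping_eqI) (auto simp: lookup_single when_def v)
  then show ?thesis by blast
qed

lemma form1_pt_nonzero:
  assumes "q \<in> forms 1 - {0}"
  shows "\<exists>v. pt q v \<noteq> 0"
proof (rule ccontr)
  assume 0: "\<not> ?thesis"
  have "lookup q m = 0" if m: "m \<in> monomials 1" for m
    using monomials_1[OF m] 0 by (auto simp: pt_def)
  then have "q = 0" using assms by (intro form_eqI[of q 1]) (auto simp: mp.subspace_0[OF
      subspace_forms])
  then show False using assms by simp
qed

text \<open>If \<open>g * f\<close> lies in the square of the ideal and \<open>g\<close> does not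
  vanish identically on the line, then \<open>f\<close> is singular at a nonzero point of the line
  where \<open>g\<close> is nonzero, hence at \<open>q\<close> by homogeneity. Conversely, a
  singular form lies in the ordinary square, so \<open>g = 1\<close> works.\<close>

lemma symbolic_square_Int_forms:
  assumes q: "q \<in> forms 1 - {0}" and d: "0 < d"
  shows "symbolic_square (vanishing_ideal {line q}) \<inter> forms d =
    {f \<in> forms d. \<forall>v. pd v (peval f) (pt q) = 0}" (is "?L = ?R")
proof (intro equalityI subsetI)
  let ?I = "vanishing_ideal {line q}"
  have I0: "peval a (\<lambda>v. t * pt q v) = 0" if "a \<in> ?I" for a t
    using vanishing_ideal_eval[OF that, of "line q" "pscale t q"] by (auto simp: line_eq)
  fix f
  {
    assume "f \<in> ?L"
    then obtain g where f: "f \<in> forms d" and g: "g \<notin> ?I" "g * f \<in> ideal_prod ?I ?I"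
      by (auto simp: symbolic_square_def)
    obtain t0 where t0: "peval g (\<lambda>v. t0 * pt q v) \<noteq> 0" using in_vanishing_ideal_line g(1) by blast
    obtain p where p: "\<forall>t. peval g (\<lambda>v. 0 + t * pt q v) = poly p t"
      using pfn_line[OF pfn_peval, of g "\<lambda>_. 0" "pt q"] by blast
    have "p \<noteq> 0" using p t0 by auto
    \<comment> \<open>The polynomial \<open>[:0, 1:]\<close> keeps \<open>t\<close> away from
      \<open>0\<close>, so that derivatives can be scaled back to \<open>q\<close>.\<close>
    then have "\<exists>t. \<forall>r\<in>{p, [:0, 1:]}. poly r t \<noteq> 0"
      by (intro polys_common_nonroot) auto
    then obtain t where "\<forall>r\<in>{p, [:0, 1:]}. poly r t \<noteq> 0" by (rule exE)
    then have t: "t \<noteq> 0" "peval g (\<lambda>v. t * pt q v) \<noteq> 0" using p by auto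
    let ?y = "\<lambda>v. t * pt q v"
    have sing: "peval (g * f) ?y = 0" "pd v (peval (g * f)) ?y = 0" for v
      using ideal_prod_singular[OF g(2), of ?y v] I0 by auto
    have fy: "peval f ?y = 0" using sing(1) t(2) by (simp add: peval_mult)
    have "peval (g * f) = (\<lambda>x. peval g x * peval f x)" by (intro ext peval_mult)
    then have "pd v (peval f) ?y = 0" for v
      using sing(2)[of v] t(2) fy by (simp add: pd_mult[OF pfn_peval pfn_peval])
    moreover have "pd v (peval f) ?y = t ^ (d - 1) * pd v (peval f) (pt q)" for v
      by (simp add: pd_peval_form[OF f] dmonom_scale sum_distrib_left mult.left_commute)
    ultimately show "f \<in> ?R" using f t(1) by simp
  next
    assume f: "f \<in> ?R"
    obtain v0 where "pt q v0 \<noteq> 0" using form1_pt_nonzero[OF q] by blast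
    then have "f \<in> ideal_prod ?I ?I" using singular_form_in_square[of f d q v0] f d by auto
    \<comment> \<open>Evaluation at the origin, the point of the line at parameter \<open>0\<close>,
      separates \<open>1\<close> from the ideal.\<close>
    moreover have "1 \<notin> ?I" using I0[of 1 0] by auto
    ultimately show "f \<in> ?L" using f by (auto simp: symbolic_square_def intro!: exI[of _ 1])
  }
qed

text \<open>The zero of the target of \<open>eta\<close> is the family of subspaces themselves, as
  cosets. A coset of \<open>w i\<close> is the subspace exactly if \<open>w i\<close> lies in it,
  which is a condition on derivatives.\<close>

lemma ker_eta_iff:
  fixes u :: "('v::finite mpoly)^'r::finite" and A :: "complex^'r^'s::finite"
  assumes q: "\<And>i. q i \<in> forms 1 - {0}" and d: "0 < d"
  shows "u \<in> ker_eta d A (\<lambda>i. line (q i)) \<longleftrightarrow> (\<forall>j. u $ j \<in> forms d) \<and>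
    (\<forall>i j. peval (u $ j) (pt (q i)) = 0) \<and>
    (\<forall>i v. (\<Sum>j\<in>UNIV. A $ i $ j * pd v (peval (u $ j)) (pt (q i))) = 0)"
proof (cases "\<forall>j. u $ j \<in> forms d")
  case True
  define w where "w = (\<lambda>i. \<Sum>j\<in>UNIV. pscale (A $ i $ j) (u $ j))"
  define S where "S = (\<lambda>i. {f \<in> forms d. \<forall>v. pd v (peval f) (pt (q i)) = 0})"
  have w: "w i \<in> forms d" for i
    unfolding w_def using True by (intro mp.subspace_sum[OF subspace_forms] mp.subspace_scale[OF
        subspace_forms]) auto
  have pd_add': "pd v (peval (f + g)) x = pd v (peval f) x + pd v (peval g) x" for v f g and x ::
      "'v \<Rightarrow> complex"
  proof -
    have "peval (f + g) = (\<lambda>x. peval f x + peval g x)" by (intro ext peval_add)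
    then show ?thesis by (simp add: pd_add[OF pfn_peval pfn_peval])
  qed
  have pd_w: "pd v (peval (w i)) x = (\<Sum>j\<in>UNIV. A $ i $ j * pd v (peval (u $ j)) x)" for v i x
  proof -
    have "peval (w i) = (\<lambda>x. \<Sum>j\<in>UNIV. A $ i $ j * peval (u $ j) x)"
      by (intro ext) (simp add: w_def peval_sum peval_pscale)
    then show ?thesis
      by (simp add: pd_sum[OF pfn_mult[OF pfn_const pfn_peval]] pd_mult[OF pfn_const pfn_peval])
  qed
  have coset: "(+) (w i) ` S i = S i \<longleftrightarrow> w i \<in> S i" for i
  proof
    have "peval (0 :: 'v mpoly) = (\<lambda>x. 0)" by auto
    then have "0 \<in> S i" by (simp add: S_def mp.subspace_0[OF subspace_forms])
    moreover assume "(+) (w i) ` S i = S i"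
    ultimately show "w i \<in> S i" by (metis add.right_neutral image_eqI)
  next
    assume wS: "w i \<in> S i"
    have "f \<in> (+) (w i) ` S i" if f: "f \<in> S i" for f
    proof (rule image_eqI)
      have pd_f: "pd v (peval f) x = pd v (peval (w i)) x + pd v (peval (f - w i)) x" for v x
        using pd_add'[of v "w i" "f - w i" x] by simp
      show "f - w i \<in> S i"
        using f wS pd_f[of _ "pt (q i)"] mp.subspace_diff[OF subspace_forms, of f d "w i"]
        by (auto simp: S_def)
    qed simp
    moreover have "w i + f \<in> S i" if "f \<in> S i" for f
      using that wS mp.subspace_add[OF subspace_forms, of "w i" d f] by (auto simp: S_def pd_add')
    ultimately show "(+) (w i) ` S i = S i" by blast
  qed
  have "u \<in> ker_eta d A (\<lambda>i. line (q i)) \<longleftrightarrow>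
      (\<forall>i j. peval (u $ j) (pt (q i)) = 0) \<and> (\<forall>i. (+) (w i) ` S i = S i)"
    using True unfolding ker_eta_def eta_def symbolic_square_Int_forms[OF q d] vanishing_ideal_Int_forms
    by (auto simp: w_def S_def fun_eq_iff)
  also have "(\<forall>i. (+) (w i) ` S i = S i) \<longleftrightarrow>
      (\<forall>i v. (\<Sum>j\<in>UNIV. A $ i $ j * pd v (peval (u $ j)) (pt (q i))) = 0)"
    using w by (simp add: coset) (simp add: S_def pd_w)
  finally show ?thesis using True by simp
next
  case False
  then show ?thesis by (auto simp: ker_eta_def)
qed


section \<open>Powers of linear forms\<close>

lemma forms_mult:
  assumes "p \<in> forms a" "q \<in> forms b" shows "p * q \<in> forms (a + b)"
  unfolding forms_iff
proof
  fix m assume "m \<in> keys (p * q)"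
  then obtain k l where "k \<in> keys p" "l \<in> keys q" "m = k + l"
    using Poly_Mapping.keys_mult[of p q] by blast
  then show "m \<in> monomials (a + b)"
    using assms by (auto simp: forms_iff monomials_def lookup_add sum.distrib dest!: subsetD)
qed

lemma forms_power: "q \<in> forms 1 \<Longrightarrow> q ^ d \<in> forms d"
proof (induction d)
  case 0
  show ?case by (simp add: forms_iff monomials_def)
next
  case (Suc d)
  then show ?case using forms_mult[of q 1 "q ^ d" d] by simp
qed

lemma pscale_power: "pscale c p ^ d = pscale (c ^ d) (p ^ d)"
  by (induction d) (simp_all add: pscale_eq_mult mult_single power_mult_distrib mult_ac)

lemma single_inj: "single v (1 :: nat) = single w 1 \<longleftrightarrow> v = w"
  by (metis lookup_single_eq lookup_single_not_eq one_neq_zero)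

definition linear_form :: "('v::finite \<Rightarrow> complex) \<Rightarrow> 'v mpoly" where
  "linear_form x = (\<Sum>v\<in>UNIV. single (single v 1) (x v))"

lemma linear_form_in_forms: "linear_form x \<in> forms 1"
  unfolding linear_form_def
  by (rule mp.subspace_sum[OF subspace_forms])
     (auto intro!: single_in_forms simp: monomials_def lookup_single when_def)

lemma pt_linear_form [simp]: "pt (linear_form x) = x"
proof
  fix v
  have "pt (linear_form x) v = (\<Sum>w\<in>UNIV. if w = v then x v else 0)"
    unfolding pt_def linear_form_def lookup_sum
    by (intro sum.cong) (auto simp: lookup_single single_inj[unfolded One_nat_def] when_def)
  then show "pt (linear_form x) v = x v" by simp
qed

lemma linear_form_pt: "q \<in> forms 1 \<Longrightarrow> linear_form (pt q) = q"
proof (rule form_eqI[OF linear_form_in_forms])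
  fix m :: "'a \<Rightarrow>\<^sub>0 nat" assume "m \<in> monomials 1"
  then obtain v where "m = single v 1" using monomials_1 by blast
  then show "lookup (linear_form (pt q)) m = lookup q m"
    using fun_cong[OF pt_linear_form[of "pt q"], of v] unfolding pt_def[of _ v] by (simp only:)
qed

lemma lookup_var_mult:
  "lookup (single (single v 1) a * p) m =
     (if lookup m v = 0 then 0 else a * lookup p (m - single v 1))"
  for p :: "'v mpoly"
proof -
  let ?e = "single v (1 :: nat)"
  have "single ?e a * p =
      single ?e a * (\<Sum>k\<in>keys p. single k (lookup p k))"
    by (simp add: sum_single_lookup)
  also have "\<dots> = (\<Sum>k\<in>keys p. single (?e + k) (a * lookup p k))"
    by (simp add: sum_distrib_left mult_single)
  finally have eq: "lookup (single ?e a * p) m =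
      (\<Sum>k\<in>keys p. (a * lookup p k when ?e + k = m))"
    by (simp add: lookup_sum lookup_single)
  show ?thesis
  proof (cases "lookup m v = 0")
    case True
    then have "?e + k \<noteq> m" for k by (metis add_eq_0_iff_both_eq_0 lookup_add lookup_single_eq
        one_neq_zero)
    then show ?thesis using True eq by simp
  next
    case False
    have "?e + k = m \<longleftrightarrow> k = m - ?e" for k
    proof
      assume "k = m - ?e"
      then show "?e + k = m"
        using False by (intro poly_mapping_eqI) (auto simp: lookup_add lookup_minus lookup_single
            when_def)
    qed auto
    then have "lookup (single ?e a * p) m =
        (\<Sum>k\<in>keys p. if k = m - ?e then a * lookup p (m - ?e) else 0)"
      unfolding eq by (intro sum.cong) (auto simp: when_def)
    then show ?thesis using False by (auto simp: in_keys_iff)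
  qed
qed

text \<open>The \<open>c m\<close> are the multinomial coefficients; only that they do not vanish matters.\<close>

lemma power_coefficients:
  "\<exists>c :: ('v::finite \<Rightarrow>\<^sub>0 nat) \<Rightarrow> nat. (\<forall>m\<in>monomials d. c m \<noteq> 0) \<and>
     (\<forall>q\<in>forms 1. \<forall>m\<in>monomials d. lookup (q ^ d) m = of_nat (c m) * monom_eval m (pt q))"
proof (induction d)
  case 0
  have "m = 0" if "m \<in> monomials 0" for m :: "'v \<Rightarrow>\<^sub>0 nat"
    using that by (intro poly_mapping_eqI) (simp add: monomials_def)
  note 0 = this
  show ?case
  proof (intro exI[of _ "\<lambda>_. 1"] conjI ballI)
    fix q :: "'v mpoly" and m :: "'v \<Rightarrow>\<^sub>0 nat" assume "m \<in> monomials 0"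
    then have "m = 0" by (rule 0)
    then show "lookup (q ^ 0) m = of_nat 1 * monom_eval m (pt q)" by simp
  qed simp
next
  case (Suc d)
  then obtain c :: "('v \<Rightarrow>\<^sub>0 nat) \<Rightarrow> nat" where c: "\<And>m. m \<in> monomials d \<Longrightarrow> c m \<noteq> 0"
    "\<And>q m. q \<in> forms 1 \<Longrightarrow> m \<in> monomials d \<Longrightarrow> lookup (q ^ d) m = of_nat (c m) * monom_eval m (pt q)"
    by blast
  let ?e = "\<lambda>v :: 'v. single v (1 :: nat)"
  \<comment> \<open>Pascal's rule for multinomial coefficients: a monomial of the product arises
    once for every variable that divides it.\<close>
  let ?c = "\<lambda>m. \<Sum>v\<in>UNIV. if lookup m v = 0 then 0 else c (m - ?e v)"
  have m_eq: "m = ?e v + (m - ?e v)" if "lookup m v \<noteq> 0" for m v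
    using that by (intro poly_mapping_eqI) (auto simp: lookup_add lookup_minus lookup_single when_def)
  have deg: "m - ?e v \<in> monomials d" if "m \<in> monomials (Suc d)" "lookup m v \<noteq> 0" for m v
  proof -
    have "lookup m w = lookup (?e v) w + lookup (m - ?e v) w" for w
      by (subst m_eq[OF that(2)]) (rule lookup_add)
    then have "(\<Sum>w\<in>UNIV. lookup m w) = (\<Sum>w\<in>UNIV. lookup (?e v) w) +
        (\<Sum>w\<in>UNIV. lookup (m - ?e v) w)"
      by (subst sum.distrib[symmetric]) (intro sum.cong refl)
    moreover have "(\<Sum>w\<in>UNIV. lookup (?e v) w) = 1"
      by (simp add: lookup_single when_def)
    ultimately show ?thesis using that(1) by (simp add: monomials_def)
  qed
  have "?c m \<noteq> 0" if m: "m \<in> monomials (Suc d)" for m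
  proof -
    have "\<exists>v. lookup m v \<noteq> 0"
    proof (rule ccontr)
      assume "\<not> ?thesis"
      then show False using m by (simp add: monomials_def)
    qed
    then obtain v where v: "lookup m v \<noteq> 0" by blast
    then have "c (m - ?e v) \<noteq> 0" using c(1)[OF deg[OF m]] by blast
    with v show ?thesis by auto
  qed
  moreover have "lookup (q ^ Suc d) m = of_nat (?c m) * monom_eval m (pt q)"
    if q: "q \<in> forms 1" and m: "m \<in> monomials (Suc d)" for q m
  proof -
    have "q ^ Suc d = linear_form (pt q) * q ^ d" by (simp only: linear_form_pt[OF q] power_Suc)
    also have "\<dots> = (\<Sum>v\<in>UNIV. single (?e v) (pt q v) * q ^ d)"
      by (simp only: linear_form_def sum_distrib_right)
    finally have "lookup (q ^ Suc d) m =
        (\<Sum>v\<in>UNIV. lookup (single (?e v) (pt q v) * q ^ d) m)"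
      by (simp only: lookup_sum)
    also have "\<dots> = (\<Sum>v\<in>UNIV. of_nat (if lookup m v = 0 then 0 else c (m - ?e v)) * monom_eval m (pt q))"
    proof (intro sum.cong refl)
      fix v
      show "lookup (single (?e v) (pt q v) * q ^ d) m =
          of_nat (if lookup m v = 0 then 0 else c (m - ?e v)) * monom_eval m (pt q)"
      proof (cases "lookup m v = 0")
        case False
        have "monom_eval m (pt q) = pt q v * monom_eval (m - ?e v) (pt q)"
          by (subst m_eq[OF False]) (simp only: monom_eval_add monom_eval_single power_one_right)
        then show ?thesis unfolding lookup_var_mult using False by (simp add: c(2)[OF q deg[OF m
            False], unfolded One_nat_def])
      qed (simp add: lookup_var_mult[where p = "q ^ d"] del: One_nat_def)
    qed
    also have "\<dots> = of_nat (?c m) * monom_eval m (pt q)"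
      by (simp only: of_nat_sum sum_distrib_right)
    finally show ?thesis .
  qed
  ultimately show ?case by (intro exI[of _ ?c]) blast
qed

text \<open>While fewer than \<open>card (monomials d)\<close> powers have been chosen, some nonzero
  functional \<open>a\<close> kills them all. It does not kill every power, since monomials are
  independent as functions and the \<open>c m\<close> are nonzero; a power outside its kernel
  extends the family.\<close>

lemma exists_independent_powers:
  assumes "CARD('s::finite) \<le> card (monomials d :: ('v::finite \<Rightarrow>\<^sub>0 nat) set)"
    and c: "\<And>m. m \<in> monomials d \<Longrightarrow> c m \<noteq> 0"
  shows "\<exists>x :: 's \<Rightarrow> 'v \<Rightarrow> complex. lin_indep (monomials d) (\<lambda>i m. of_nat (c m) * monom_eval m (x i))
      UNIV"
proof -
  let ?M = "monomials d :: ('v \<Rightarrow>\<^sub>0 nat) set"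
  let ?r = "\<lambda>x m. of_nat (c m) * monom_eval m x :: complex"
  have "\<exists>x :: 's \<Rightarrow> 'v \<Rightarrow> complex. lin_indep ?M (\<lambda>i. ?r (x i)) J" if "finite J" for J
    using that
  proof (induction J rule: finite_induct)
    case empty
    show ?case by (simp add: lin_indep_def)
  next
    case (insert j J)
    then obtain x :: "'s \<Rightarrow> 'v \<Rightarrow> complex" where x: "lin_indep ?M (\<lambda>i. ?r (x i)) J" by blast
    have "card J < CARD('s)" using insert.hyps by (intro psubset_card_mono) auto
    then have "\<exists>a. (\<exists>m\<in>?M. a m \<noteq> 0) \<and> (\<forall>i\<in>J. (\<Sum>m\<in>?M. a m * ?r (x i) m) = 0)"
      using assms(1) insert.hyps by (intro homogeneous_system_nontrivial) auto
    then obtain a where a: "(\<exists>m\<in>?M. a m \<noteq> 0) \<and> (\<forall>i\<in>J. (\<Sum>m\<in>?M. a m * ?r (x i) m) = 0)"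
      by (rule exE)
    have "\<exists>y. (\<Sum>m\<in>?M. a m * ?r y m) \<noteq> 0"
    proof (rule ccontr)
      assume "\<not> ?thesis"
      then have 0: "(\<Sum>m\<in>?M. (a m * of_nat (c m)) * (\<Prod>v\<in>UNIV. y v ^ lookup m v)) = 0" for y
        by (simp add: monom_eval_UNIV mult.assoc)
      have "a m * of_nat (c m) = 0" if "m \<in> ?M" for m
        by (rule monomials_independent[where e = lookup and A = UNIV, OF finite finite_monomials _ 0
            that])
           (auto intro: poly_mapping_eqI)
      then show False using a c by auto
    qed
    then obtain y where y: "(\<Sum>m\<in>?M. a m * ?r y m) \<noteq> 0" by (rule exE)
    have "lin_indep ?M (\<lambda>i. ?r ((x(j := y)) i)) (insert j J)"
      unfolding lin_indep_def
    proof (intro allI impI)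
      fix l assume l: "\<forall>m\<in>?M. (\<Sum>i\<in>insert j J. l i * ?r ((x(j := y)) i) m) = 0"
      have split: "(\<Sum>i\<in>insert j J. l i * ?r ((x(j := y)) i) m) = l j * ?r y m + (\<Sum>i\<in>J. l i * ?r (x
          i) m)" for m
      proof -
        have "(\<Sum>i\<in>J. l i * ?r ((x(j := y)) i) m) = (\<Sum>i\<in>J. l i * ?r (x i) m)"
          using insert.hyps by (intro sum.cong) auto
        then show ?thesis using insert.hyps by simp
      qed
      have "0 = (\<Sum>m\<in>?M. a m * (l j * ?r y m + (\<Sum>i\<in>J. l i * ?r (x i) m)))"
        using l unfolding split by simp
      also have "\<dots> = l j * (\<Sum>m\<in>?M. a m * ?r y m) + (\<Sum>m\<in>?M. \<Sum>i\<in>J. l i * (a m * ?r (x i) m))"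
        by (simp add: distrib_left sum.distrib sum_distrib_left mult.left_commute)
      also have "(\<Sum>m\<in>?M. \<Sum>i\<in>J. l i * (a m * ?r (x i) m)) = (\<Sum>i\<in>J. l i * (\<Sum>m\<in>?M. a m * ?r (x i) m))"
        by (subst sum.swap) (simp only: sum_distrib_left)
      also have "\<dots> = 0" using a by simp
      finally have lj: "l j = 0" using y by simp
      then have "l i = 0" if "i \<in> J" for i
        using lin_indepD[OF x, of l i] l that unfolding split by simp
      with lj show "\<forall>i\<in>insert j J. l i = 0" by simp
    qed
    then show ?case by (intro exI[of _ "x(j := y)"])
  qed
  then show ?thesis by simp
qed

text \<open>Other representatives of the points multiply the powers by nonzero scalars, which
  preserves independence. No \<open>q i\<close> is zero, since for \<open>0 < d\<close> its power
  would be zero.\<close>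

lemma independent_tuple_of_powers:
  fixes q :: "'s::finite \<Rightarrow> 'v::finite mpoly"
  assumes q: "\<And>i. q i \<in> forms 1" and d: "0 < d"
    and L: "lin_indep (monomials d) (\<lambda>i. lookup (q i ^ d)) UNIV"
  shows "q i \<noteq> 0" "inj (\<lambda>i. line (q i))" "range (\<lambda>i. line (q i)) \<in> independent_tuples CARD('s) d"
proof -
  have nz: "q i \<noteq> 0" for i
  proof
    assume "q i = 0"
    have "(if i = i then 1 else 0 :: complex) = 0"
    proof (rule lin_indepD[OF L, of "\<lambda>k. if k = i then 1 else 0"])
      fix m show "(\<Sum>k\<in>UNIV. (if k = i then 1 else 0) * lookup (q k ^ d) m) = 0"
        using \<open>q i = 0\<close> d by (simp add: if_distrib[of "\<lambda>z. z * _"] power_0_left cong: if_cong)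
    qed simp
    then show False by simp
  qed
  then show "q i \<noteq> 0" .
  have ind: "inj (\<lambda>i. p (line (q i)) ^ d) \<and> mp.independent (range (\<lambda>i. p (line (q i)) ^ d))"
    if p: "\<And>i. p (line (q i)) \<in> line (q i) - {0}" for p
  proof -
    have "\<exists>t. t \<noteq> 0 \<and> p (line (q i)) = pscale t (q i)" for i
      using p[of i] by (force simp: line_eq)
    then have "\<forall>i. \<exists>t. t \<noteq> 0 \<and> p (line (q i)) = pscale t (q i)" by blast
    from choice[OF this] obtain t where t: "t i \<noteq> 0" "p (line (q i)) = pscale (t i) (q i)" for i
      by auto
    have "lin_indep (monomials d) (\<lambda>i. lookup (p (line (q i)) ^ d)) UNIV"
      unfolding lin_indep_def
    proof (intro allI impI ballI)
      fix l i assume "\<forall>m\<in>monomials d. (\<Sum>i\<in>UNIV. l i * lookup (p (line (q i)) ^ d) m) = 0"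
      then have "l i * t i ^ d = 0"
        by (intro lin_indepD[OF L, of "\<lambda>i. l i * t i ^ d"]) (simp_all add: t(2) pscale_power mult.assoc)
      then show "l i = 0" using t(1) by simp
    qed
    moreover have "p (line (q i)) ^ d \<in> forms d" for i
      using q by (simp add: t(2) pscale_power forms_power mp.subspace_scale[OF subspace_forms])
    ultimately show ?thesis
      using lin_indep_lookup_iff[of UNIV "\<lambda>i. p (line (q i)) ^ d" d] by simp
  qed
  \<comment> \<open>One choice of representatives depending only on the line suffices to see that
    the lines differ, since the powers of the chosen forms do.\<close>
  define p0 where "p0 = (\<lambda>P :: 'v mpoly set. SOME p. p \<in> P - {0})"
  have "q i \<in> line (q i) - {0}" for i using nz by (simp add: line_def mp.span_base)
  then have "p0 (line (q i)) \<in> line (q i) - {0}" for i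
    unfolding p0_def by (rule someI)
  from ind[of p0, OF this] have "inj ((\<lambda>P. p0 P ^ d) \<circ> (\<lambda>i. line (q i)))" by (simp add: o_def)
  then show inj: "inj (\<lambda>i. line (q i))" by (rule inj_on_imageI2)
  show "range (\<lambda>i. line (q i)) \<in> independent_tuples CARD('s) d"
    unfolding independent_tuples_def
  proof (intro CollectI conjI allI impI)
    show "range (\<lambda>i. line (q i)) \<subseteq> points" using q nz by (auto simp: points_def)
    show "card (range (\<lambda>i. line (q i))) = CARD('s)" by (rule card_image[OF inj])
    fix p :: "'v mpoly set \<Rightarrow> 'v mpoly"
    assume "\<forall>P\<in>range (\<lambda>i. line (q i)). p P \<in> P - {0}"
    then have *: "inj (\<lambda>i. p (line (q i)) ^ d)" "mp.independent (range (\<lambda>i. p (line (q i)) ^ d))"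
      using ind[of p] by auto
    from *(1) have "inj ((\<lambda>P. p P ^ d) \<circ> (\<lambda>i. line (q i)))" by (simp add: o_def)
    then show "inj_on (\<lambda>P. p P ^ d) (range (\<lambda>i. line (q i)))" by (rule inj_on_imageI)
    show "mp.independent ((\<lambda>P. p P ^ d) ` range (\<lambda>i. line (q i)))"
      using *(2) by (simp add: image_image)
  qed simp
qed


section \<open>Parametrization of the locus\<close>

type_synonym ('v, 'r, 's) ind = "(('s \<times> 'v) + ('s \<times> 'r)) + nat"

text \<open>The coordinates of \<open>(q, A) \<mapsto> (\<Sum>i. A\<^sub>i\<^sub>j q\<^sub>i\<^sup>d)\<^sub>j\<close>. The unused parameters \<open>Inr n\<close> leave room
  for the additional ones needed to build chains.\<close>

definition secant ::
  "(('v::finite \<Rightarrow>\<^sub>0 nat) \<Rightarrow> nat) \<Rightarrow> 'r::finite \<times> ('v \<Rightarrow>\<^sub>0 nat) \<Rightarrow> (('v, 'r, 's::finite) ind \<Rightarrow> complex) \<Rightarrow>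
      complex" where
  "secant c = (\<lambda>(j, m) x. \<Sum>i\<in>UNIV. x (Inl (Inr (i, j))) *
     (of_nat (c m) * monom_eval m (\<lambda>v. x (Inl (Inl (i, v))))))"

definition param_point ::
  "('s::finite \<Rightarrow> 'v::finite mpoly) \<Rightarrow> complex^'r^'s \<Rightarrow> ('v, 'r::finite, 's) ind \<Rightarrow> complex" where
  "param_point q A = case_sum (case_sum (\<lambda>(i, v). pt (q i) v) (\<lambda>(i, j). A $ i $ j)) (\<lambda>_. 0)"

lemma pfn_monom_part:
  "pfn (range Inl) (\<lambda>x :: ('v::finite, 'r::finite, 's::finite) ind \<Rightarrow> complex. monom_eval m (\<lambda>v. x
      (Inl (Inl (i, v)))))"
  by (rule pfn_compose[OF pfn_monom_eval]) auto

lemma pfn_secant: "pfn (range Inl) (secant c jm :: (('v::finite, 'r::finite, 's::finite) ind \<Rightarrow>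
    complex) \<Rightarrow> complex)"
  unfolding secant_def
  by (cases jm) (simp, intro pfn_sum pfn_mult pfn_const pfn_monom_part pfn_var rangeI)

lemma pd_monom_part:
  "pd k (\<lambda>x :: ('v::finite, 'r::finite, 's::finite) ind \<Rightarrow> complex. monom_eval m (\<lambda>v. x (Inl (Inl (i,
      v))))) x =
     (\<Sum>w\<in>UNIV. dmonom w m (\<lambda>v. x (Inl (Inl (i, v)))) * (if k = Inl (Inl (i, w)) then 1 else 0))"
  by (subst pd_compose[OF pfn_monom_eval, of "range Inl"]) (auto simp: pd_monom_eval)

lemma pd_secant:
  fixes x :: "('v::finite, 'r::finite, 's::finite) ind \<Rightarrow> complex"
  shows "pd k (secant c (j, m)) x = (\<Sum>i\<in>UNIV. (if k = Inl (Inr (i, j)) then 1 else 0) *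
      (of_nat (c m) * monom_eval m (\<lambda>v. x (Inl (Inl (i, v))))) +
    x (Inl (Inr (i, j))) * (of_nat (c m) *
      (\<Sum>w\<in>UNIV. dmonom w m (\<lambda>v. x (Inl (Inl (i, v)))) * (if k = Inl (Inl (i, w)) then 1 else 0))))"
proof -
  have pf: "pfn (range Inl) (\<lambda>x :: ('v, 'r, 's) ind \<Rightarrow> complex. of_nat (c m) * monom_eval m (\<lambda>v. x
      (Inl (Inl (i, v)))))" for i
    by (intro pfn_mult pfn_const pfn_monom_part)
  have pv: "pfn (range Inl) (\<lambda>x :: ('v, 'r, 's) ind \<Rightarrow> complex. x (Inl (Inr (i, j))))" for i
    by (intro pfn_var rangeI)
  have eq: "secant c (j, m) = (\<lambda>x :: ('v, 'r, 's) ind \<Rightarrow> complex. \<Sum>i\<in>UNIV. x (Inl (Inr (i, j))) *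
      (of_nat (c m) * monom_eval m (\<lambda>v. x (Inl (Inl (i, v))))))"
    by (simp add: secant_def)
  show ?thesis unfolding eq
    by (subst pd_sum[OF pfn_mult[OF pv pf]])
       (simp add: pd_mult[OF pv pf] pd_mult[OF pfn_const pfn_monom_part] pd_monom_part)
qed

text \<open>A change of frame is absorbed by the matrix entries alone. To obtain an independent
  tuple, the matrix selects \<open>CARD('r)\<close> among \<open>CARD('s)\<close> independent
  powers.\<close>

lemma param_secant:
  assumes c: "\<And>m. m \<in> monomials d \<Longrightarrow> c m \<noteq> 0" and "CARD('r::finite) \<le> CARD('s::finite)"
    and "CARD('s) \<le> card (monomials d :: ('v::finite \<Rightarrow>\<^sub>0 nat) set)"
  shows "param d (range Inl) (secant c :: _ \<Rightarrow> (('v, 'r, 's) ind \<Rightarrow> complex) \<Rightarrow> complex)"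
  unfolding param_def
proof (intro conjI ballI allI)
  fix x :: "('v, 'r, 's) ind \<Rightarrow> complex" and g :: "'r \<Rightarrow> 'r \<Rightarrow> complex"
  define x' where "x' = (\<lambda>k. case k of Inl (Inr (i, j)) \<Rightarrow> \<Sum>l\<in>UNIV. g l j * x (Inl (Inr (i, l))) | _
      \<Rightarrow> x k)"
  have "secant c (j, m) x' = (\<Sum>l\<in>UNIV. g l j * secant c (l, m) x)" for j m
  proof -
    have "secant c (j, m) x' = (\<Sum>i\<in>UNIV. \<Sum>l\<in>UNIV. g l j * (x (Inl (Inr (i, l))) *
        (of_nat (c m) * monom_eval m (\<lambda>v. x (Inl (Inl (i, v)))))))"
      by (simp add: secant_def x'_def sum_distrib_right mult.assoc)
    also have "\<dots> = (\<Sum>l\<in>UNIV. g l j * secant c (l, m) x)"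
      by (subst sum.swap) (simp add: secant_def sum_distrib_left)
    finally show ?thesis .
  qed
  then show "\<exists>x' :: ('v, 'r, 's) ind \<Rightarrow> complex. \<forall>j. \<forall>m\<in>monomials d. secant c (j, m) x' = (\<Sum>l\<in>UNIV. g
      l j * secant c (l, m) x)"
    by (intro exI[of _ x'] allI ballI)
next
  have "\<exists>y :: 's \<Rightarrow> 'v \<Rightarrow> complex. lin_indep (monomials d) (\<lambda>i m. of_nat (c m) * monom_eval m (y i)) UNIV"
    by (rule exists_independent_powers[OF assms(3)]) (rule c)
  then obtain y :: "'s \<Rightarrow> 'v \<Rightarrow> complex" where y: "lin_indep (monomials d) (\<lambda>i m. of_nat (c m) *
      monom_eval m (y i)) UNIV"
    by (rule exE)
  obtain e :: "'r \<Rightarrow> 's" where e: "inj e"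
    using card_le_inj[of "UNIV :: 'r set" "UNIV :: 's set"] assms(2) by auto
  define x :: "('v, 'r, 's) ind \<Rightarrow> complex" where
    "x = (\<lambda>k. case k of Inl (Inl (i, v)) \<Rightarrow> y i v | Inl (Inr (i, j)) \<Rightarrow> if i = e j then 1 else 0 | Inr
        n \<Rightarrow> 0)"
  have x: "secant c (j, m) x = of_nat (c m) * monom_eval m (y (e j))" for j m
    by (simp add: secant_def x_def if_distrib[of "\<lambda>z. z * _"] cong: if_cong)
  have "lin_indep (monomials d) (\<lambda>j m. secant c (j, m) x) UNIV"
    unfolding lin_indep_def
  proof (intro allI impI ballI)
    fix l j assume l: "\<forall>m\<in>monomials d. (\<Sum>j\<in>UNIV. l j * secant c (j, m) x) = 0"
    let ?l = "\<lambda>i. if i \<in> range e then l (inv e i) else 0"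
    have "?l (e j) = 0"
    proof (rule lin_indepD[OF y])
      fix m :: "'v \<Rightarrow>\<^sub>0 nat" assume m: "m \<in> monomials d"
      have "(\<Sum>i\<in>UNIV. ?l i * (of_nat (c m) * monom_eval m (y i)))
          = (\<Sum>i\<in>range e. l (inv e i) * (of_nat (c m) * monom_eval m (y i)))"
        by (intro sum.mono_neutral_cong_right) auto
      also have "\<dots> = (\<Sum>j\<in>UNIV. l j * secant c (j, m) x)"
        by (subst sum.reindex[OF e]) (simp add: x inv_f_f[OF e])
      finally show "(\<Sum>i\<in>UNIV. ?l i * (of_nat (c m) * monom_eval m (y i))) = 0" using l m by simp
    qed simp
    then show "l j = 0" by (simp add: inv_f_f[OF e])
  qed
  then show "\<exists>x :: ('v, 'r, 's) ind \<Rightarrow> complex. lin_indep (monomials d) (\<lambda>j m. secant c (j, m) x) UNIV"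
    by blast
qed (auto intro: pfn_secant)

text \<open>The coordinates of a frame of a subspace in the locus are values of
  \<open>secant\<close>: its members are combinations of the powers, and the coefficients form the
  matrix.\<close>

lemma Sigma_locus_subset_param_closure:
  fixes c :: "('v::finite \<Rightarrow>\<^sub>0 nat) \<Rightarrow> nat"
  assumes c: "\<And>q m. q \<in> forms 1 \<Longrightarrow> m \<in> monomials d \<Longrightarrow>
      lookup (q ^ d) m = of_nat (c m) * monom_eval m (pt q)"
  shows "Sigma_locus CARD('r::finite) CARD('s::finite) d \<subseteq>
    param_closure d (secant c :: 'r \<times> _ \<Rightarrow> (('v, 'r, 's) ind \<Rightarrow> complex) \<Rightarrow> complex)"
proof
  fix L :: "'v mpoly set" assume "L \<in> Sigma_locus CARD('r) CARD('s) d"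
  then obtain X where L: "L \<in> grassmannian CARD('r) d" and X: "X \<in> independent_tuples CARD('s) d"
    and LX: "L \<subseteq> mp.span {q ^ d | q P. P \<in> X \<and> q \<in> P - {0}}"
    by (auto simp: Sigma_locus_def)
  obtain P :: "'s \<Rightarrow> 'v mpoly set" where P: "bij_betw P UNIV X"
    using X finite_same_card_bij[of "UNIV :: 's set" X] by (auto simp: independent_tuples_def)
  have "P i \<in> points" for i
    using X bij_betw_apply[OF P, of i] by (auto simp: independent_tuples_def)
  then have "\<forall>i. \<exists>q. q \<in> forms 1 \<and> P i = line q" by (auto simp: points_def)
  from choice[OF this] obtain q where q: "q i \<in> forms 1" "P i = line (q i)" for i by auto
  let ?D = "\<chi> i. q i ^ d"
  have "{q ^ d | q P. P \<in> X \<and> q \<in> P - {0}} \<subseteq> gspan ?D"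
  proof
    fix f assume "f \<in> {q ^ d | q P. P \<in> X \<and> q \<in> P - {0}}"
    then obtain p P' where p: "f = p ^ d" "P' \<in> X" "p \<in> P'" by blast
    then obtain i where "P' = line (q i)" using P q by (auto simp: bij_betw_def)
    then obtain t where t: "p = pscale t (q i)" using p by (auto simp: line_eq)
    have "?D $ i \<in> gspan ?D" unfolding gspan_def by (intro mp.span_base) blast
    then show "f \<in> gspan ?D" by (simp add: p(1) t pscale_power gspan_def mp.span_scale)
  qed
  then have "mp.span {q ^ d | q P. P \<in> X \<and> q \<in> P - {0}} \<subseteq> gspan ?D"
    unfolding gspan_def by (intro mp.span_minimal) auto
  with LX have LD: "L \<subseteq> gspan ?D" by blast
  obtain B :: "('v mpoly)^'r" where B: "B \<in> frames d" "L = gspan B"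
    using L unfolding grassmannian_eq_image by blast
  have "\<forall>j. \<exists>a. B $ j = (\<Sum>i\<in>UNIV. pscale (a i) (?D $ i))"
  proof
    fix j
    have "B $ j \<in> L" unfolding B(2) gspan_def by (intro mp.span_base) blast
    with LD show "\<exists>a. B $ j = (\<Sum>i\<in>UNIV. pscale (a i) (?D $ i))" by (auto simp: gspan_iff)
  qed
  from choice[OF this] obtain a where a: "\<forall>j. B $ j = (\<Sum>i\<in>UNIV. pscale (a j i) (?D $ i))" by (rule exE)
  let ?x = "param_point q (\<chi> i j. a j i) :: ('v, 'r, 's) ind \<Rightarrow> complex"
  have coord: "coord B (j, m) = secant c (j, m) ?x" if "m \<in> monomials d" for j m
    using a c[OF q(1) that] by (simp add: coord_def secant_def param_point_def lookup_sum)
  have "P (coord B) = 0" if "P \<in> vanishing d (secant c :: 'r \<times> _ \<Rightarrow> (('v, 'r, 's) ind \<Rightarrow> complex) \<Rightarrow>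
      complex)" for P
  proof -
    have "P (coord B) = P (\<lambda>jm. secant c jm ?x)"
      by (rule pfn_depends[of "coord_inds d" P])
         (use that coord in \<open>auto simp: vanishing_def coord_inds_def\<close>)
    then show ?thesis using that by (simp add: vanishing_def)
  qed
  then show "L \<in> param_closure d (secant c :: 'r \<times> _ \<Rightarrow> (('v, 'r, 's) ind \<Rightarrow> complex) \<Rightarrow> complex)"
    using B by (auto simp: param_closure_def)
qed

text \<open>The partial converse needed for density: it requires the points to have independent
  powers and the combinations to form a frame.\<close>

lemma secant_in_Sigma_locus:
  fixes x :: "('v::finite, 'r::finite, 's::finite) ind \<Rightarrow> complex"
  assumes d: "0 < d"
    and c: "\<And>q m. q \<in> forms 1 \<Longrightarrow> m \<in> monomials d \<Longrightarrow>
      lookup (q ^ d) m = of_nat (c m) * monom_eval m (pt q)"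
    and x: "lin_indep (monomials d) (\<lambda>i m. of_nat (c m) * monom_eval m (\<lambda>v. x (Inl (Inl (i, v))))) UNIV"
    and fr: "of_coord d (\<lambda>jm. secant c jm x) \<in> (frames d :: (('v mpoly)^'r) set)"
  shows "gspan (of_coord d (\<lambda>jm. secant c jm x)) \<in> Sigma_locus CARD('r) CARD('s) d"
proof -
  define q where "q = (\<lambda>i. linear_form (\<lambda>v. x (Inl (Inl (i, v)))))"
  have q: "q i \<in> forms 1" for i unfolding q_def by (rule linear_form_in_forms)
  have look: "lookup (q i ^ d) m = of_nat (c m) * monom_eval m (\<lambda>v. x (Inl (Inl (i, v))))"
    if "m \<in> monomials d" for i m
    using c[OF q that] by (simp add: q_def)
  have "lin_indep (monomials d) (\<lambda>i. lookup (q i ^ d)) UNIV"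
    using x lin_indep_cong[of UNIV "monomials d" "\<lambda>i. lookup (q i ^ d)"] look by simp
  note tup = independent_tuple_of_powers[OF q d this]
  let ?B = "of_coord d (\<lambda>jm. secant c jm x) :: ('v mpoly)^'r"
  let ?W = "mp.span {p ^ d | p P. P \<in> range (\<lambda>i. line (q i)) \<and> p \<in> P - {0}}"
  have "?B $ j \<in> ?W" for j
  proof -
    have "?B $ j = (\<Sum>i\<in>UNIV. pscale (x (Inl (Inr (i, j)))) (q i ^ d))"
    proof (rule form_eqI[OF of_coord_forms])
      show "(\<Sum>i\<in>UNIV. pscale (x (Inl (Inr (i, j)))) (q i ^ d)) \<in> forms d"
        by (intro mp.subspace_sum[OF subspace_forms] mp.subspace_scale[OF subspace_forms] forms_power q)
      fix m :: "'v \<Rightarrow>\<^sub>0 nat" assume m: "m \<in> monomials d"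
      have "lookup (?B $ j) m = secant c (j, m) x"
        using coord_of_coord[of d "\<lambda>jm. secant c jm x" j m] m by (simp add: coord_def)
      then show "lookup (?B $ j) m =
          lookup (\<Sum>i\<in>UNIV. pscale (x (Inl (Inr (i, j)))) (q i ^ d)) m"
        using m by (simp add: secant_def lookup_sum look)
    qed
    also have "\<dots> \<in> ?W"
    proof (intro mp.span_sum mp.span_scale mp.span_base CollectI exI conjI)
      fix i show "line (q i) \<in> range (\<lambda>i. line (q i))" by blast
      show "q i \<in> line (q i) - {0}" using tup(1)[of i] by (simp add: line_def mp.span_base)
    qed simp
    finally show ?thesis .
  qed
  then have "gspan ?B \<subseteq> ?W" unfolding gspan_def[of ?B] by (intro mp.span_minimal) auto
  moreover have "gspan ?B \<in> grassmannian CARD('r) d" using fr grassmannian_eq_image by blast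
  ultimately show ?thesis using tup(3) unfolding Sigma_locus_def by blast
qed


section \<open>The kernel of \<open>\<eta>\<close>\<close>

text \<open>Under the apolarity pairing, \<open>ker \<eta>\<close> is the annihilator of the image of the differential of the
  parametrization.\<close>

lemma ker_eta_iff_gradient:
  fixes u :: "('v::finite mpoly)^'r::finite" and A :: "complex^'r^'s::finite"
  assumes q: "\<And>i. q i \<in> forms 1 - {0}" and d: "0 < d" and c: "\<And>m. m \<in> monomials d \<Longrightarrow> c m \<noteq> 0"
  shows "u \<in> ker_eta d A (\<lambda>i. line (q i)) \<longleftrightarrow> (\<forall>j. u $ j \<in> forms d) \<and>
    (\<forall>k\<in>range Inl. (\<Sum>jm\<in>coord_inds d. coord u jm / of_nat (c (snd jm)) * pd k (secant c jm)
        (param_point q A)) = 0)"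
proof (cases "\<forall>j. u $ j \<in> forms d")
  case True
  let ?x = "param_point q A"
  have x: "?x (Inl (Inl (i, v))) = pt (q i) v" "?x (Inl (Inr (i, j))) = A $ i $ j" for i v j
    by (simp_all add: param_point_def)
  \<comment> \<open>The weights \<open>c m\<close> cancel against the multinomial coefficients in
    the derivatives of \<open>secant\<close>.\<close>
  have sum: "(\<Sum>jm\<in>coord_inds d. coord u jm / of_nat (c (snd jm)) * pd k (secant c jm) ?x) =
      (\<Sum>j\<in>UNIV. \<Sum>m\<in>monomials d. lookup (u $ j) m *
        (\<Sum>i\<in>UNIV. (if k = Inl (Inr (i, j)) then 1 else 0) * monom_eval m (pt (q i)) +
          A $ i $ j * (\<Sum>w\<in>UNIV. dmonom w m (pt (q i)) * (if k = Inl (Inl (i, w)) then 1 else 0))))"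
              for k
  proof -
    have "coord u (j, m) / of_nat (c m) * pd k (secant c (j, m)) ?x = lookup (u $ j) m *
        (\<Sum>i\<in>UNIV. (if k = Inl (Inr (i, j)) then 1 else 0) * monom_eval m (pt (q i)) +
          A $ i $ j * (\<Sum>w\<in>UNIV. dmonom w m (pt (q i)) * (if k = Inl (Inl (i, w)) then 1 else 0)))"
      if "m \<in> monomials d" for j m
    proof -
      have "pd k (secant c (j, m)) ?x = of_nat (c m) *
        (\<Sum>i\<in>UNIV. (if k = Inl (Inr (i, j)) then 1 else 0) * monom_eval m (pt (q i)) +
          A $ i $ j * (\<Sum>w\<in>UNIV. dmonom w m (pt (q i)) * (if k = Inl (Inl (i, w)) then 1 else 0)))"
        unfolding pd_secant x
        by (rule trans[OF _ sum_distrib_left[symmetric]])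
           (intro sum.cong refl, simp only: distrib_left mult.left_commute)
      then show ?thesis using c[OF that] by (simp add: coord_def)
    qed
    then show ?thesis unfolding coord_inds_def
      by (subst sum.cartesian_product) (auto intro!: sum.cong)
  qed
  \<comment> \<open>The derivatives by the matrix entries test the vanishing of the
    \<open>u $ j\<close> at the points.\<close>
  have R: "(\<Sum>jm\<in>coord_inds d. coord u jm / of_nat (c (snd jm)) * pd (Inl (Inr (i, j))) (secant c jm)
      ?x) =
      peval (u $ j) (pt (q i))" for i j
  proof -
    have "(\<Sum>jm\<in>coord_inds d. coord u jm / of_nat (c (snd jm)) * pd (Inl (Inr (i, j))) (secant c jm)
        ?x) =
        (\<Sum>l\<in>UNIV. if l = j then peval (u $ j) (pt (q i)) else 0)"
      unfolding sum
    proof (intro sum.cong refl)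
      fix l
      have "(\<Sum>k\<in>UNIV. (if Inl (Inr (i, j)) = (Inl (Inr (k, l)) :: ('v, 'r, 's) ind) then 1 else 0) *
          monom_eval m (pt (q k)))
          = (if l = j then monom_eval m (pt (q i)) else 0)" for m
        by (auto simp: if_distrib[of "\<lambda>z. z * _"] cong: if_cong)
      then show "(\<Sum>m\<in>monomials d. lookup (u $ l) m *
          (\<Sum>k\<in>UNIV. (if Inl (Inr (i, j)) = (Inl (Inr (k, l)) :: ('v, 'r, 's) ind) then 1 else 0) *
              monom_eval m (pt (q k)) +
            A $ k $ l * (\<Sum>w\<in>UNIV. dmonom w m (pt (q k)) * (if Inl (Inr (i, j)) = (Inl (Inl (k, w))
                :: ('v, 'r, 's) ind) then 1 else 0))))
          = (if l = j then peval (u $ j) (pt (q i)) else 0)"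
        using True by (simp add: peval_form[of _ d])
    qed
    then show ?thesis by simp
  qed
  \<comment> \<open>The derivatives by the coordinates of the points test the vanishing to second
    order of the combinations of the \<open>u $ j\<close>.\<close>
  have Q: "(\<Sum>jm\<in>coord_inds d. coord u jm / of_nat (c (snd jm)) * pd (Inl (Inl (i, v))) (secant c jm)
      ?x) =
      (\<Sum>j\<in>UNIV. A $ i $ j * pd v (peval (u $ j)) (pt (q i)))" for i v
    unfolding sum
  proof (intro sum.cong refl)
    fix j
    have 1: "(\<Sum>w\<in>UNIV. dmonom w m (pt (q k)) * (if Inl (Inl (i, v)) = (Inl (Inl (k, w)) :: ('v, 'r,
        's) ind) then 1 else 0))
        = (if k = i then dmonom v m (pt (q i)) else 0)" for k m
      by (auto simp: if_distrib[of "\<lambda>z. _ * z"] cong: if_cong)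
    have 2: "(\<Sum>k\<in>UNIV. (if Inl (Inl (i, v)) = (Inl (Inr (k, j)) :: ('v, 'r, 's) ind) then 1 else 0)
        * monom_eval m (pt (q k)) +
          A $ k $ j * (if k = i then dmonom v m (pt (q i)) else 0)) = A $ i $ j * dmonom v m (pt (q
              i))" for m
      by (simp add: if_distrib[of "\<lambda>z. _ * z"] cong: if_cong)
    show "(\<Sum>m\<in>monomials d. lookup (u $ j) m *
        (\<Sum>k\<in>UNIV. (if Inl (Inl (i, v)) = (Inl (Inr (k, j)) :: ('v, 'r, 's) ind) then 1 else 0) *
            monom_eval m (pt (q k)) +
          A $ k $ j * (\<Sum>w\<in>UNIV. dmonom w m (pt (q k)) * (if Inl (Inl (i, v)) = (Inl (Inl (k, w)) ::
              ('v, 'r, 's) ind) then 1 else 0))))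
        = A $ i $ j * pd v (peval (u $ j)) (pt (q i))"
      unfolding 1 2 using True by (simp add: pd_peval_form[of _ d] sum_distrib_left mult.left_commute)
  qed
  have "(\<forall>k\<in>range Inl. (\<Sum>jm\<in>coord_inds d. coord u jm / of_nat (c (snd jm)) * pd k (secant c jm) ?x)
      = 0) \<longleftrightarrow>
      (\<forall>i j. peval (u $ j) (pt (q i)) = 0) \<and> (\<forall>i v. (\<Sum>j\<in>UNIV. A $ i $ j * pd v (peval (u $ j)) (pt
          (q i))) = 0)"
    (is "?G \<longleftrightarrow> ?H")
  proof
    assume G: ?G
    show ?H
    proof (intro conjI allI)
      show "peval (u $ j) (pt (q i)) = 0" for i j using G R[of i j] by auto
      show "(\<Sum>j\<in>UNIV. A $ i $ j * pd v (peval (u $ j)) (pt (q i))) = 0" for i v using G Q[of i v] by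
          auto
    qed
  next
    assume H: ?H
    show ?G
    proof
      fix k :: "('v, 'r, 's) ind" assume "k \<in> range Inl"
      then consider i j where "k = Inl (Inr (i, j))" | i v where "k = Inl (Inl (i, v))"
        by (metis imageE obj_sumE surj_pair)
      then show "(\<Sum>jm\<in>coord_inds d. coord u jm / of_nat (c (snd jm)) * pd k (secant c jm) ?x) = 0"
        by cases (use H Q R in simp_all)
    qed
  qed
  then show ?thesis unfolding ker_eta_iff[OF q d] using True by simp
next
  case False
  then show ?thesis by (auto simp: ker_eta_def)
qed

section \<open>Dimension of the space of relations among the gradients\<close>

lemma row_scale_component [simp]: "row_scale a u $ j = pscale a (u $ j)"
  by (simp add: row_scale_def)

lemma coord_row_sum: "coord (\<Sum>a\<in>S. row_scale (f a) (u a)) jm = (\<Sum>a\<in>S. f a * coord (u a) jm)"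
  by (cases jm) (simp add: coord_def lookup_sum)

text \<open>Rank and nullity: the indices outside the basis \<open>C\<close> are free, and each of
  them contributes the relation that expresses its row through \<open>C\<close>. The weights
  \<open>w\<close> rescale the coordinates of the relations.\<close>

lemma row_dim_relations:
  fixes M :: "'r::finite \<times> ('v::finite \<Rightarrow>\<^sub>0 nat) \<Rightarrow> 'k \<Rightarrow> complex"
  assumes C: "C \<subseteq> coord_inds d" "lin_indep I M C"
    and T: "\<And>a k. a \<in> coord_inds d \<Longrightarrow> k \<in> I \<Longrightarrow> M a k = (\<Sum>b\<in>C. T a b * M b k)"
    and w: "\<And>a. a \<in> coord_inds d \<Longrightarrow> w a \<noteq> 0"
  shows "row.dim {u :: ('v mpoly)^'r. (\<forall>j. u $ j \<in> forms d) \<and>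
      (\<forall>k\<in>I. (\<Sum>a\<in>coord_inds d. coord u a / w a * M a k) = 0)} =
    card (coord_inds d :: ('r \<times> ('v \<Rightarrow>\<^sub>0 nat)) set) - card C" (is "row.dim ?K = _")
proof -
  let ?I = "coord_inds d :: ('r \<times> ('v \<Rightarrow>\<^sub>0 nat)) set"
  let ?N = "?I - C"
  have finC: "finite C" using C(1) finite_coord_inds finite_subset by blast
  \<comment> \<open>For \<open>a\<close> outside \<open>C\<close> these are the coefficients of the
    relation that expresses \<open>M a\<close> through \<open>C\<close>, multiplied by the weights.
    Outside \<open>C\<close> it is supported at \<open>a\<close> alone, which makes the relations
    independent.\<close>
  define y where "y = (\<lambda>a b. w b * ((if b = a then 1 else 0) - (if b \<in> C then T a b else 0)))"
  define v :: "'r \<times> ('v \<Rightarrow>\<^sub>0 nat) \<Rightarrow> ('v mpoly)^'r" where "v = (\<lambda>a. of_coord d (y a))"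
  have cv: "coord (v a) b = y a b" if "b \<in> ?I" for a b
    using that by (cases b) (simp add: v_def coord_of_coord coord_inds_def)
  have cvN: "coord (v a) b = (if b = a then w b else 0)" if "b \<in> ?N" for a b
    using that by (simp add: cv y_def)
  have eqI: "u = u'" if "\<And>j. u $ j \<in> forms d" "\<And>j. u' $ j \<in> forms d" "\<And>a. a \<in> ?I \<Longrightarrow> coord u a = coord
      u' a"
    for u u' :: "('v mpoly)^'r"
    unfolding vec_eq_iff
  proof
    fix j show "u $ j = u' $ j"
      by (rule form_eqI[OF that(1,2)]) (use that(3)[of "(j, _)"] in \<open>auto simp: coord_def
          coord_inds_def\<close>)
  qed
  have v_forms: "v a $ j \<in> forms d" for a j by (simp add: v_def of_coord_forms)
  have inj: "inj_on v ?N"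
  proof (rule inj_onI)
    fix a b assume ab: "a \<in> ?N" "b \<in> ?N" "v a = v b"
    show "a = b"
    proof (rule ccontr)
      assume "a \<noteq> b"
      then have "w a = 0" using cvN[OF ab(1), of a] cvN[OF ab(1), of b] ab(3) by simp
      then show False using w ab(1) by auto
    qed
  qed
  show ?thesis
  proof (rule row.dim_unique)
    show "v ` ?N \<subseteq> ?K"
    proof (intro image_subsetI CollectI conjI allI ballI v_forms)
      fix a k assume a: "a \<in> ?N" and k: "k \<in> I"
      have "coord (v a) b / w b = (if b = a then 1 else 0) - (if b \<in> C then T a b else 0)" if "b \<in>
          ?I" for b
        using that by (simp add: cv y_def w)
      then have "(\<Sum>b\<in>?I. coord (v a) b / w b * M b k) =
          (\<Sum>b\<in>?I. (if b = a then M b k else 0) - (if b \<in> C then T a b * M b k else 0))"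
        by (intro sum.cong refl) (auto simp: left_diff_distrib)
      also have "\<dots> = M a k - (\<Sum>b\<in>C. T a b * M b k)"
        using a C(1) by (simp add: sum_subtractf sum.If_cases Int_absorb1)
      finally show "(\<Sum>b\<in>?I. coord (v a) b / w b * M b k) = 0" using T[of a k] a k by simp
    qed
    show "row.independent (v ` ?N)"
    proof
      assume "row.dependent (v ` ?N)"
      then obtain f where f: "\<exists>x\<in>v ` ?N. f x \<noteq> 0" "(\<Sum>x\<in>v ` ?N. row_scale (f x) x) = 0"
        using row.dependent_finite[of "v ` ?N"] by auto
      have sum: "(\<Sum>a\<in>?N. row_scale (f (v a)) (v a)) = 0"
        using f(2) by (subst (asm) sum.reindex[OF inj]) simp
      have "f (v b) = 0" if b: "b \<in> ?N" for b
      proof -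
        have "0 = coord (\<Sum>a\<in>?N. row_scale (f (v a)) (v a)) b"
          unfolding sum by (cases b) (simp add: coord_def)
        also have "\<dots> = (\<Sum>a\<in>?N. if b = a then f (v b) * w b else 0)"
          unfolding coord_row_sum by (intro sum.cong refl) (auto simp: cvN[OF b])
        also have "\<dots> = f (v b) * w b" using b by simp
        finally show ?thesis using w b by simp
      qed
      with f(1) show False by auto
    qed
    show "?K \<subseteq> row.span (v ` ?N)"
    proof
      fix u assume "u \<in> ?K"
      then have u: "\<And>j. u $ j \<in> forms d" "\<And>k. k \<in> I \<Longrightarrow> (\<Sum>a\<in>?I. coord u a / w a * M a k) = 0" by auto
      define f where "f = (\<lambda>a. coord u a / w a)"
      \<comment> \<open>The coefficients of a relation at \<open>C\<close> are determined by the
        others, because the rows in \<open>C\<close> are independent.\<close>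
      have fC: "f b + (\<Sum>a\<in>?N. f a * T a b) = 0" if "b \<in> C" for b
      proof (rule lin_indepD[OF C(2) _ that])
        fix k assume k: "k \<in> I"
        have "(\<Sum>b\<in>C. (f b + (\<Sum>a\<in>?N. f a * T a b)) * M b k) =
            (\<Sum>b\<in>C. f b * M b k) + (\<Sum>b\<in>C. \<Sum>a\<in>?N. f a * (T a b * M b k))"
          by (simp add: distrib_right sum.distrib sum_distrib_right mult.assoc)
        also have "(\<Sum>b\<in>C. \<Sum>a\<in>?N. f a * (T a b * M b k)) = (\<Sum>a\<in>?N. f a * (\<Sum>b\<in>C. T a b * M b k))"
          by (subst sum.swap) (simp only: sum_distrib_left)
        also have "\<dots> = (\<Sum>a\<in>?N. f a * M a k)"
          by (intro sum.cong refl) (use T[OF _ k] in simp)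
        also have "(\<Sum>b\<in>C. f b * M b k) + \<dots> = (\<Sum>a\<in>?I. f a * M a k)"
          using sum.subset_diff[OF C(1) finite_coord_inds, of "\<lambda>a. f a * M a k"] by simp
        also have "\<dots> = 0" using u(2)[OF k] by (simp add: f_def)
        finally show "(\<Sum>b\<in>C. (f b + (\<Sum>a\<in>?N. f a * T a b)) * M b k) = 0" .
      qed
      have "u = (\<Sum>a\<in>?N. row_scale (f a) (v a))"
      proof (rule eqI)
        fix j show "u $ j \<in> forms d" by (rule u(1))
        have "(\<Sum>a\<in>?N. row_scale (f a) (v a)) $ j = (\<Sum>a\<in>?N. pscale (f a) (v a $ j))" by simp
        also have "\<dots> \<in> forms d"
          by (intro mp.subspace_sum[OF subspace_forms] mp.subspace_scale[OF subspace_forms] v_forms)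
        finally show "(\<Sum>a\<in>?N. row_scale (f a) (v a)) $ j \<in> forms d" .
      next
        fix b assume b: "b \<in> ?I"
        show "coord u b = coord (\<Sum>a\<in>?N. row_scale (f a) (v a)) b"
        proof (cases "b \<in> C")
          case True
          have "coord (\<Sum>a\<in>?N. row_scale (f a) (v a)) b = (\<Sum>a\<in>?N. - w b * (f a * T a b))"
            unfolding coord_row_sum by (intro sum.cong refl) (use True in \<open>auto simp: cv[OF b] y_def\<close>)
          also have "\<dots> = - w b * (\<Sum>a\<in>?N. f a * T a b)" by (rule sum_distrib_left[symmetric])
          also have "\<dots> = w b * f b" using fC[OF True] by (simp add: add_eq_0_iff2)
          finally show ?thesis using w[OF b] by (simp add: f_def)
        next
          case False
          have "coord (\<Sum>a\<in>?N. row_scale (f a) (v a)) b = (\<Sum>a\<in>?N. if b = a then f b * w b else 0)"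
            unfolding coord_row_sum by (intro sum.cong refl) (use b False in \<open>auto simp: cvN\<close>)
          also have "\<dots> = f b * w b" using b False by simp
          finally show ?thesis using w[OF b] by (simp add: f_def)
        qed
      qed
      also have "\<dots> \<in> row.span (v ` ?N)"
        by (intro row.span_sum row.span_scale row.span_base) auto
      finally show "u \<in> row.span (v ` ?N)" .
    qed
    show "card (v ` ?N) = card ?I - card C"
      by (simp add: card_image[OF inj] card_Diff_subset[OF finC C(1)])
  qed
qed


section \<open>General parameters\<close>

lemma openin_parameter_topology_iff:
  fixes U :: "(('s::finite \<Rightarrow> 'v::finite mpoly set) \<times> (complex^'r::finite^'s)) set"
  defines "D \<equiv> {(q, A :: complex^'r^'s). (\<forall>i :: 's. q i \<in> (forms 1 - {0} :: 'v mpoly set)) \<and> inj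
      (\<lambda>i. line (q i))}"
  shows "openin parameter_topology U \<longleftrightarrow> U \<subseteq> (\<lambda>(q, A). (\<lambda>i. line (q i), A)) ` D \<and>
    openin (zariski D (\<lambda>(q, A). case_sum (\<lambda>(i, v). pt (q i) v) (\<lambda>(i, j). A $ i $ j)))
      {p \<in> D. (\<lambda>(q, A). (\<lambda>i. line (q i), A)) p \<in> U}"
  unfolding parameter_topology_def openin_quotient_topology topspace_zariski D_def pt_def ..

theorem theorem2p1:
  fixes n d r s :: nat
  assumes "CARD('v::finite) = n + 1" and "CARD('r::finite) = r" and "CARD('s::finite) = s"
    and "0 < n" and "0 < d" and "0 < r" and "0 < s"
    and "r \<le> s" and "s \<le> mp.dim (forms d :: 'v mpoly set)"
  shows "\<exists>U. openin parameter_topology U \<and> U \<noteq> {} \<and>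
           (\<forall>(Q :: 's \<Rightarrow> 'v mpoly set, A :: complex^'r^'s) \<in> U.
              codim (Sigma_locus r s d) (grassmannian_topology TYPE('r) d :: 'v mpoly set topology)
                = enat (row.dim (ker_eta d A Q)))"
proof -
  let ?Iset = "range Inl :: ('v, 'r, 's) ind set"
  let ?C = "coord_inds d :: ('r \<times> ('v \<Rightarrow>\<^sub>0 nat)) set"
  note d = \<open>0 < d\<close>
  have rs: "CARD('r) \<le> CARD('s)" "CARD('s) \<le> card (monomials d :: ('v \<Rightarrow>\<^sub>0 nat) set)"
    using assms by (simp_all add: dim_forms)
  obtain c :: "('v \<Rightarrow>\<^sub>0 nat) \<Rightarrow> nat" where c0: "\<And>m. m \<in> monomials d \<Longrightarrow> c m \<noteq> 0"
    and c: "\<And>q m. q \<in> forms 1 \<Longrightarrow> m \<in> monomials d \<Longrightarrow>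
      lookup (q ^ d) m = of_nat (c m) * monom_eval m (pt q)"
    using power_coefficients[of d] by blast
  let ?f = "secant c :: 'r \<times> ('v \<Rightarrow>\<^sub>0 nat) \<Rightarrow> (('v, 'r, 's) ind \<Rightarrow> complex) \<Rightarrow> complex"
  let ?row = "\<lambda>x jm k. pd k (?f jm) x"
  have par: "param d ?Iset ?f" by (rule param_secant[OF c0 rs])

  \<comment> \<open>This says that the Jacobian matrix of the parametrization at \<open>x\<close>
    has rank at least \<open>k\<close>; the maximal such \<open>k\<close>, called
    \<open>\<rho>\<close>, is the generic rank.\<close>
  define has_rank where "has_rank = (\<lambda>x k. \<exists>C\<subseteq>?C. card C = k \<and> lin_indep ?Iset (?row x) C)"
  have "has_rank (\<lambda>_. 0) 0" unfolding has_rank_def by (intro exI[of _ "{}"]) (simp add: lin_indep_def)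
  then have ex: "\<exists>x. has_rank x 0" by blast
  have bound: "k \<le> card ?C" if "has_rank x k" for x k
    using that card_mono[OF finite_coord_inds] unfolding has_rank_def by blast
  have "\<exists>k. (\<exists>x. has_rank x k) \<and> (\<forall>l. (\<exists>x. has_rank x l) \<longrightarrow> l \<le> k)"
    by (rule ex_has_greatest_nat[where P = "\<lambda>k. \<exists>x. has_rank x k" and f = "\<lambda>k. k" and b = "Suc (card
        ?C)", OF ex])
       (use bound in \<open>auto intro: le_imp_less_Suc\<close>)
  then obtain \<rho> x1 where \<rho>: "has_rank x1 \<rho>" "\<And>x k. has_rank x k \<Longrightarrow> k \<le> \<rho>" by blast
  obtain C1 where C1: "C1 \<subseteq> ?C" "card C1 = \<rho>" "lin_indep ?Iset (?row x1) C1"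
    using \<rho>(1) unfolding has_rank_def by blast
  have \<rho>_le: "\<rho> \<le> card ?C" using bound \<rho>(1) by blast

  have rank_open: "\<exists>h. pfn ?Iset h \<and> h x \<noteq> 0 \<and> (\<forall>y. h y \<noteq> 0 \<longrightarrow> has_rank y \<rho>)" if x: "has_rank x \<rho>" for x
  proof -
    obtain C where C: "C \<subseteq> ?C" "card C = \<rho>" "lin_indep ?Iset (?row x) C"
      using x unfolding has_rank_def by blast
    have "finite C" using C(1) finite_coord_inds finite_subset by blast
    then obtain h where "pfn ?Iset h" "h x \<noteq> 0" "\<And>y. h y \<noteq> 0 \<Longrightarrow> lin_indep ?Iset (?row y) C"
      by (rule lin_indep_open[where v = "\<lambda>jm k. pd k (?f jm)" and J = ?Iset, OF _ _ C(3)])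
         (auto intro: pfn_pd pfn_secant)
    with C show ?thesis unfolding has_rank_def by blast
  qed
  \<comment> \<open>The dimension of the kernel is the corank at \<open>(q, A)\<close>; by
    maximality of \<open>\<rho>\<close>, rank at least \<open>\<rho>\<close> means rank exactly
    \<open>\<rho>\<close>.\<close>
  have ker: "row.dim (ker_eta d A (\<lambda>i. line (q i))) = card ?C - \<rho> \<longleftrightarrow> has_rank (param_point q A) \<rho>"
    if q: "\<And>i. q i \<in> forms 1 - {0}" for q and A :: "complex^'r^'s"
  proof -
    let ?x = "param_point q A"
    obtain C T where C: "C \<subseteq> ?C" "lin_indep ?Iset (?row ?x) C"
      "\<And>jm k. jm \<in> ?C \<Longrightarrow> k \<in> ?Iset \<Longrightarrow> ?row ?x jm k = (\<Sum>b\<in>C. T jm b * ?row ?x b k)"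
      "\<And>D. D \<subseteq> ?C \<Longrightarrow> lin_indep ?Iset (?row ?x) D \<Longrightarrow> card D \<le> card C"
      by (rule maximal_lin_indep_spans[OF finite_coord_inds[of d], of ?Iset "?row ?x"]) (rule that)
    have "ker_eta d A (\<lambda>i. line (q i)) = {u. (\<forall>j. u $ j \<in> forms d) \<and>
        (\<forall>k\<in>?Iset. (\<Sum>jm\<in>coord_inds d. coord u jm / of_nat (c (snd jm)) * ?row ?x jm k) = 0)}"
      by (intro set_eqI, unfold mem_Collect_eq) (rule ker_eta_iff_gradient[OF q d c0])
    also have "row.dim \<dots> = card ?C - card C"
      by (rule row_dim_relations[OF C(1,2,3)]) (simp_all add: coord_inds_def mem_Times_iff c0 del:
          neq0_conv)
    finally have dim: "row.dim (ker_eta d A (\<lambda>i. line (q i))) = card ?C - card C" .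
    have "has_rank ?x (card C)" using C(1,2) unfolding has_rank_def by blast
    then have "card C \<le> \<rho>" by (rule \<rho>(2))
    moreover have "has_rank ?x \<rho> \<Longrightarrow> \<rho> \<le> card C" using C(4) unfolding has_rank_def by blast
    ultimately have "has_rank ?x \<rho> \<longleftrightarrow> card C = \<rho>"
      using \<open>has_rank ?x (card C)\<close> by auto
    then show ?thesis using dim \<open>card C \<le> \<rho>\<close> \<rho>_le by auto
  qed

  let ?pow = "\<lambda>x :: ('v, 'r, 's) ind \<Rightarrow> complex. \<lambda>i m. of_nat (c m) * monom_eval m (\<lambda>v. x (Inl (Inl
      (i, v)))) :: complex"
  have "\<exists>y :: 's \<Rightarrow> 'v \<Rightarrow> complex. lin_indep (monomials d) (\<lambda>i m. of_nat (c m) * monom_eval m (y i)) UNIV"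
    by (rule exists_independent_powers[OF rs(2)]) (rule c0)
  then obtain y :: "'s \<Rightarrow> 'v \<Rightarrow> complex" where
    "lin_indep (monomials d) (\<lambda>i m. of_nat (c m) * monom_eval m (y i)) UNIV" by (rule exE)
  then have y: "lin_indep (monomials d) (?pow (case_sum (case_sum (\<lambda>(i, v). y i v) (\<lambda>_. 0)) (\<lambda>_.
      0))) UNIV"
    by simp
  have pfn_pow: "pfn ?Iset (\<lambda>x. ?pow x i m)" for i m
    by (intro pfn_mult pfn_const pfn_monom_part)
  \<comment> \<open>\<open>h1\<close> guarantees that the points have independent powers; it serves
    both for the density of general subspaces of \<open>Sigma_locus\<close> and for the nonemptiness
    of \<open>U\<close>.\<close>
  obtain h1 where h1: "pfn ?Iset h1" "h1 (case_sum (case_sum (\<lambda>(i, v). y i v) (\<lambda>_. 0)) (\<lambda>_. 0)) \<noteq> 0"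
    "\<And>x. h1 x \<noteq> 0 \<Longrightarrow> lin_indep (monomials d) (?pow x) UNIV"
    by (rule lin_indep_open[where v = "\<lambda>i m x. ?pow x i m" and J = ?Iset, OF finite pfn_pow y])
        (rule that)

  have codim: "codim (Sigma_locus r s d) (grassmannian_topology TYPE('r) d :: 'v mpoly set topology) =
      enat (card ?C - \<rho>)"
  proof -
    obtain h2 x2 where h2: "pfn ?Iset h2" "h2 x2 \<noteq> 0"
      "\<And>x. h2 x \<noteq> 0 \<Longrightarrow> of_coord d (\<lambda>jm. ?f jm x) \<in> frames d"
      by (rule param_generic_frame[OF par]) (rule that)
    obtain x0 where x0: "h1 x0 \<noteq> 0" "h2 x0 \<noteq> 0"
      by (rule pfn_common_nonzero[where f = h1 and g = h2, OF h1(1) h2(1) h1(2) h2(2)]) (rule that)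
    have cl: "grassmannian_topology TYPE('r) d closure_of Sigma_locus CARD('r) CARD('s) d =
        param_closure d ?f"
    proof (rule closure_of_eq_param_closure[OF par])
      show "Sigma_locus CARD('r) CARD('s) d \<subseteq> param_closure d ?f"
        by (rule Sigma_locus_subset_param_closure) (rule c)
      show "pfn ?Iset (\<lambda>x. h1 x * h2 x)" using h1(1) h2(1) by blast
      show "h1 x0 * h2 x0 \<noteq> 0" using x0 by simp
      fix x assume x: "h1 x * h2 x \<noteq> 0"
      then show fr: "of_coord d (\<lambda>jm. ?f jm x) \<in> frames d" using h2(3) by simp
      have "lin_indep (monomials d) (?pow x) UNIV" using h1(3) x by simp
      from secant_in_Sigma_locus[OF d c this fr]
      show "gspan (of_coord d (\<lambda>jm. ?f jm x)) \<in> Sigma_locus CARD('r) CARD('s) d" .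
    qed
    have inf: "infinite (UNIV :: ('v, 'r, 's) ind set)"
      by simp
    have "codim (Sigma_locus CARD('r) CARD('s) d) (grassmannian_topology TYPE('r) d :: 'v mpoly set
        topology) =
        enat (card ?C - card C1)"
    proof (rule codim_param_locus[OF inf par cl C1(1,3)])
      fix x D assume "D \<subseteq> ?C" "lin_indep ?Iset (?row x) D"
      then have "has_rank x (card D)" unfolding has_rank_def by blast
      then show "card D \<le> card C1" using \<rho>(2) C1(2) by simp
    qed
    then show ?thesis using assms(2,3) C1(2) by simp
  qed

  define D where "D = {(q, A :: complex^'r^'s). (\<forall>i :: 's. q i \<in> (forms 1 - {0} :: 'v mpoly set)) \<and>
      inj (\<lambda>i. line (q i))}"
  define pr where "pr = (\<lambda>(q :: 's \<Rightarrow> 'v mpoly, A :: complex^'r^'s). (\<lambda>i. line (q i), A))"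
  define cc where "cc = (\<lambda>(q :: 's \<Rightarrow> 'v mpoly, A :: complex^'r^'s).
      case_sum (\<lambda>(i, v). pt (q i) v) (\<lambda>(i, j). A $ i $ j))"
  \<comment> \<open>The codimension is the constant \<open>card ?C - \<rho>\<close>, so the wanted
    equality itself can define \<open>U\<close>; what remains is that \<open>U\<close> is open and
    nonempty.\<close>
  define U where "U = {(Q, A). (Q, A) \<in> pr ` D \<and> row.dim (ker_eta d A Q) = card ?C - \<rho>}"
  have pre: "{p \<in> D. pr p \<in> U} = {p \<in> D. has_rank (case_prod param_point p) \<rho>}"
  proof -
    have "pr p \<in> U \<longleftrightarrow> has_rank (case_prod param_point p) \<rho>" if p: "p \<in> D" for p
    proof -
      obtain q A where qA: "p = (q, A)" by (cases p)
      have q: "q i \<in> forms 1 - {0}" for i using p by (simp add: qA D_def)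
      have "pr p \<in> pr ` D" using p by (rule imageI)
      then show ?thesis using ker[OF q, of A] by (simp add: qA U_def pr_def)
    qed
    then show ?thesis by blast
  qed
  have "openin (zariski D cc) {p \<in> D. pr p \<in> U}"
  proof -
    \<comment> \<open>The preimage is covered by principal open sets on which the rank stays
      maximal. The parameters \<open>Inr n\<close> are set to \<open>0\<close>, as they are not
      coordinates of the parameter space.\<close>
    have "{p \<in> D. pr p \<in> U} = (\<Union>h\<in>{h. pfn ?Iset h \<and> (\<forall>y. h y \<noteq> 0 \<longrightarrow> has_rank y \<rho>)}.
        {p \<in> D. h (case_sum (cc p) (\<lambda>_. 0)) \<noteq> 0})" (is "?L = ?R")
    proof (intro equalityI subsetI)
      fix p assume p: "p \<in> ?L"
      then have "has_rank (case_prod param_point p) \<rho>" using pre by auto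
      then obtain h where "pfn ?Iset h" "h (case_prod param_point p) \<noteq> 0" "\<forall>y. h y \<noteq> 0 \<longrightarrow> has_rank y \<rho>"
        using rank_open by blast
      moreover have "case_prod param_point p = case_sum (cc p) (\<lambda>_. 0)"
        by (auto simp: param_point_def cc_def split: prod.split)
      ultimately show "p \<in> ?R" using p by auto
    next
      fix p assume "p \<in> ?R"
      moreover have "case_prod param_point p = case_sum (cc p) (\<lambda>_. 0)"
        by (auto simp: param_point_def cc_def split: prod.split)
      ultimately show "p \<in> ?L" unfolding pre by auto
    qed
    also have "openin (zariski D cc) \<dots>"
    proof (rule openin_Union, clarify)
      fix h assume h: "pfn ?Iset h"
      have "pfn UNIV (\<lambda>y. h (\<lambda>k. (case k of Inl a \<Rightarrow> (\<lambda>y. y a) | Inr n \<Rightarrow> (\<lambda>y. 0)) y))"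
        by (rule pfn_compose[OF h]) (auto simp: pfn_var)
      moreover have "(\<lambda>y. h (\<lambda>k. (case k of Inl a \<Rightarrow> (\<lambda>y. y a) | Inr n \<Rightarrow> (\<lambda>y. 0)) y)) =
          (\<lambda>y. h (case_sum y (\<lambda>_. 0)))"
        by (intro ext arg_cong[of _ _ h]) (auto split: sum.split)
      ultimately have "pfn UNIV (\<lambda>y. h (case_sum y (\<lambda>_. 0)))" by (simp only:)
      then show "openin (zariski D cc) {p \<in> D. h (case_sum (cc p) (\<lambda>_. 0)) \<noteq> 0}"
        by (rule openin_zariski_principal)
    qed
    finally show ?thesis .
  qed
  moreover have "U \<subseteq> pr ` D" by (auto simp: U_def)
  ultimately have "openin parameter_topology U"
    unfolding openin_parameter_topology_iff D_def pr_def cc_def by blast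
  moreover have "U \<noteq> {}"
  proof -
    obtain h where h: "pfn ?Iset h" "h x1 \<noteq> 0" "\<And>y. h y \<noteq> 0 \<Longrightarrow> has_rank y \<rho>"
      using rank_open[OF \<rho>(1)] by blast
    \<comment> \<open>Maximal rank alone does not provide nonzero forms with distinct lines;
      \<open>h1\<close> does.\<close>
    obtain x where x: "h x \<noteq> 0" "h1 x \<noteq> 0"
      by (rule pfn_common_nonzero[where f = h and g = h1, OF h(1) h1(1) h(2) h1(2)]) (rule that)
    define q where "q = (\<lambda>i. linear_form (\<lambda>v. x (Inl (Inl (i, v)))))"
    define A :: "complex^'r^'s" where "A = (\<chi> i j. x (Inl (Inr (i, j))))"
    have q: "q i \<in> forms 1" for i unfolding q_def by (rule linear_form_in_forms)
    have "lin_indep (monomials d) (\<lambda>i. lookup (q i ^ d)) UNIV \<longleftrightarrow> lin_indep (monomials d) (?pow x) UNIV"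
      by (rule lin_indep_cong) (simp only: c[OF q], simp only: q_def pt_linear_form)
    then have "lin_indep (monomials d) (\<lambda>i. lookup (q i ^ d)) UNIV"
      using h1(3)[OF x(2)] by simp
    note tup = independent_tuple_of_powers[OF q d this]
    have "h (param_point q A) = h x"
      by (rule pfn_depends[OF h(1)]) (auto simp: param_point_def q_def A_def split: sum.split)
    then have "has_rank (param_point q A) \<rho>" using h(3) x(1) by simp
    moreover have "(q, A) \<in> D" using q tup(1,2) by (simp add: D_def)
    ultimately have "(q, A) \<in> {p \<in> D. pr p \<in> U}" unfolding pre by simp
    then show ?thesis by blast
  qed
  moreover have "codim (Sigma_locus r s d) (grassmannian_topology TYPE('r) d :: 'v mpoly set topology)
      = enat (row.dim (ker_eta d A Q))" if "(Q, A) \<in> U" for Q A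
    using that codim by (simp add: U_def)
  ultimately show ?thesis by (intro exI[of _ U]) blast
qed

end
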